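(* Let $\mathsf B$ be a category with finite products, $P\colon \mathsf{X}\to\mathsf{B}$ a cartesian monoidal opfibration, and $F\colon \mathsf{B}\to\mathbb{C}\mathsf{at}$ its associated pseudofunctor, with its lax monoidal structure $(R,R^1)$ given by finite products in $\mathsf X$. The following statements are equivalent. (i) The unit $\eta^1\colon 1_{F(I_{\mathsf{B}})}\Rightarrow R^1\circ L^1$ of the adjunction $L^1\dashv R^1$ is a natural isomorphism (equivalently, for all $X$ in $F(I_{\mathsf B})$ the terminal map $\tau_X\colon X\to I_{\mathsf X}$ is $P$-cocartesian; equivalently, for all $X$ in $\mathsf X$ the terminal map $\tau_X\colon X\to I_{\mathsf X}$ is $P$-cocartesian), and, for every object $A$ in $\mathsf{B}$ endowed with an internal group structure $(A,m,e,i)$, the unit $\eta^{A,A}\colon 1_{F(A\times A)}\Rightarrow R^{A,A}\circ L^{A,A}$ of the adjunction $L^{A,A}\dashv R^{A,A}$ is a natural isomorphism. (ii) The lax monoidal pseudofunctor $F$ is groupal.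
   Context: A cartesian monoidal opfibration is a (cloven) opfibration $P\colon\mathsf X\to\mathsf B$ such that $\mathsf X$ and $\mathsf B$ have finite products, $P$ strictly preserves them (as a strict monoidal functor $(\mathsf X,\times,I_{\mathsf X})\to(\mathsf B,\times,I_{\mathsf B})$), and products of cocartesian arrows are cocartesian. The associated pseudofunctor $F$ sends $A$ to the fibre $F(A)$ of $P$ over $A$ and $f\colon A\to B$ to the change-of-base functor $F(f)=f_*\colon F(A)\to F(B)$, where $\hat f\colon X\to f_*(X)$ is the chosen cocartesian lifting. $\mathsf I$ is the terminal category with object $\star$ and $\mathbb{C}\mathsf{at}$ is the 2-category of categories. $L^1\colon F(I_{\mathsf B})\to\mathsf I$ is the unique functor and $L^{A,B}=\langle\pi_{1*},\pi_{2*}\rangle\colon F(A\times B)\to F(A)\times F(B)$. Under the hypothesis on $P$ they have right adjoints $R^1(\star)=I_{\mathsf X}$ and $R^{A,B}(X,Y)=X\times Y$ (product in $\mathsf X$), which make $F\colon(\mathsf B,\times,I_{\mathsf B})\to(\mathbb{C}\mathsf{at},\times,\mathsf I)$ a lax (symmetric) monoidal pseudofunctor. For a monoid $(M,m,e)$ in $\mathsf B$, a lax monoidal pseudofunctor $F$ makes $F(M)$ a monoidal category with tensor $\otimes=F(m)\circ R^{M,M}$ and unit object $(F(e)\circ R^1)(\star)$; for a monoid morphism $f$, $F(f)$ is a strong monoidal functor. A group object $(A,m,e,i)$ in $\mathsf B$ is a monoid object with an arrow $i\colon A\to A$ such that $m\circ\langle 1,i\rangle=e\circ\tau_A$. A 2-group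 is a monoidal groupoid in which every object is weakly invertible with respect to the tensor product; $2\mathbb{G}\mathsf p$ denotes the 2-category of 2-groups. The lax monoidal pseudofunctor $F$ is called groupal when it sends internal groups in $\mathsf B$ to 2-groups (where, for an internal group $(A,m,e,i)$, $F(A)$ carries the monoidal structure with tensor $\otimes=F(m)\circ R^{A,A}$ and unit object $(F(e)\circ R^1)(\star)$), namely it determines a pseudofunctor $2\mathbb{G}\mathsf p(F)\colon\mathsf{Gp}(\mathsf B)\to 2\mathbb{G}\mathsf p$ such that $U\circ 2\mathbb{G}\mathsf p(F)=F\circ U$, where $U$ denotes the forgetful functors $\mathsf{Gp}(\mathsf B)\to\mathsf B$ and $2\mathbb{G}\mathsf p\to\mathbb{C}\mathsf{at}$. *)

theory Defs
  imports Main "HOL-Library.FuncSet"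
begin

section \<open>Categories, functors, natural transformations\<close>

record ('o, 'a) cat =
  Obj :: "'o set"
  Arr :: "'a set"
  Dom :: "'a \<Rightarrow> 'o"
  Cod :: "'a \<Rightarrow> 'o"
  idn :: "'o \<Rightarrow> 'a"
  Comp :: "'a \<Rightarrow> 'a \<Rightarrow> 'a"  (infixr "\<cdot>\<index>" 55)

definition hom :: "('o, 'a) cat \<Rightarrow> 'o \<Rightarrow> 'o \<Rightarrow> 'a set" where
  "hom C x y = {f \<in> Arr C. Dom C f = x \<and> Cod C f = y}"

definition category :: "('o, 'a) cat \<Rightarrow> bool" where
  "category C \<longleftrightarrow>
     (\<forall>f \<in> Arr C. Dom C f \<in> Obj C \<and> Cod C f \<in> Obj C) \<and>
     (\<forall>x \<in> Obj C. idn C x \<in> hom C x x) \<and>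
     (\<forall>f \<in> Arr C. \<forall>g \<in> Arr C. Dom C g = Cod C f \<longrightarrow>
        g \<cdot>\<^bsub>C\<^esub> f \<in> hom C (Dom C f) (Cod C g)) \<and>
     (\<forall>f \<in> Arr C. f \<cdot>\<^bsub>C\<^esub> idn C (Dom C f) = f \<and> idn C (Cod C f) \<cdot>\<^bsub>C\<^esub> f = f) \<and>
     (\<forall>f \<in> Arr C. \<forall>g \<in> Arr C. \<forall>h \<in> Arr C. Dom C g = Cod C f \<longrightarrow> Dom C h = Cod C g \<longrightarrow>
        h \<cdot>\<^bsub>C\<^esub> (g \<cdot>\<^bsub>C\<^esub> f) = (h \<cdot>\<^bsub>C\<^esub> g) \<cdot>\<^bsub>C\<^esub> f)"

definition iso :: "('o, 'a) cat \<Rightarrow> 'a \<Rightarrow> bool" where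
  "iso C f \<longleftrightarrow> f \<in> Arr C \<and>
     (\<exists>g \<in> hom C (Cod C f) (Dom C f).
        g \<cdot>\<^bsub>C\<^esub> f = idn C (Dom C f) \<and> f \<cdot>\<^bsub>C\<^esub> g = idn C (Cod C f))"

definition isomorphic :: "('o, 'a) cat \<Rightarrow> 'o \<Rightarrow> 'o \<Rightarrow> bool" where
  "isomorphic C x y \<longleftrightarrow> (\<exists>f \<in> hom C x y. iso C f)"

definition groupoid :: "('o, 'a) cat \<Rightarrow> bool" where
  "groupoid C \<longleftrightarrow> category C \<and> (\<forall>f \<in> Arr C. iso C f)"

definition prod_cat :: "('o, 'a) cat \<Rightarrow> ('p, 'b) cat \<Rightarrow> ('o \<times> 'p, 'a \<times> 'b) cat" where
  "prod_cat C D = \<lparr>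
     Obj = Obj C \<times> Obj D,
     Arr = Arr C \<times> Arr D,
     Dom = (\<lambda>(f, g). (Dom C f, Dom D g)),
     Cod = (\<lambda>(f, g). (Cod C f, Cod D g)),
     idn = (\<lambda>(x, y). (idn C x, idn D y)),
     Comp = (\<lambda>(f', g') (f, g). (f' \<cdot>\<^bsub>C\<^esub> f, g' \<cdot>\<^bsub>D\<^esub> g))\<rparr>"

definition terminal_cat :: "(unit, unit) cat" where
  "terminal_cat = \<lparr>Obj = {()}, Arr = {()}, Dom = (\<lambda>_. ()), Cod = (\<lambda>_. ()),
     idn = (\<lambda>_. ()), Comp = (\<lambda>_ _. ())\<rparr>"

text \<open>Functors and natural transformations carry their source and target, and their underlying
  maps are extensional (\<open>undefined\<close> outside the carrier), so that HOL equality of these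
  records is equality of functors and of transformations.\<close>

record ('o, 'a, 'p, 'b) ftor =
  fsrc :: "('o, 'a) cat"
  ftrg :: "('p, 'b) cat"
  fO :: "'o \<Rightarrow> 'p"
  fA :: "'a \<Rightarrow> 'b"

definition is_functor :: "('o, 'a, 'p, 'b) ftor \<Rightarrow> bool" where
  "is_functor F \<longleftrightarrow> (let C = fsrc F; D = ftrg F in
     category C \<and> category D \<and>
     fO F \<in> extensional (Obj C) \<and> fA F \<in> extensional (Arr C) \<and>
     (\<forall>x \<in> Obj C. fO F x \<in> Obj D \<and> fA F (idn C x) = idn D (fO F x)) \<and>
     (\<forall>f \<in> Arr C. fA F f \<in> hom D (fO F (Dom C f)) (fO F (Cod C f))) \<and>
     (\<forall>f \<in> Arr C. \<forall>g \<in> Arr C. Dom C g = Cod C f \<longrightarrow>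
        fA F (g \<cdot>\<^bsub>C\<^esub> f) = fA F g \<cdot>\<^bsub>D\<^esub> fA F f))"

definition fid :: "('o, 'a) cat \<Rightarrow> ('o, 'a, 'o, 'a) ftor" where
  "fid C = \<lparr>fsrc = C, ftrg = C, fO = (\<lambda>x \<in> Obj C. x), fA = (\<lambda>f \<in> Arr C. f)\<rparr>"

definition fcomp :: "('p, 'b, 'q, 'c) ftor \<Rightarrow> ('o, 'a, 'p, 'b) ftor \<Rightarrow> ('o, 'a, 'q, 'c) ftor"
    (infixr "\<bullet>" 60) where
  "G \<bullet> F = \<lparr>fsrc = fsrc F, ftrg = ftrg G,
     fO = (\<lambda>x \<in> Obj (fsrc F). fO G (fO F x)),
     fA = (\<lambda>f \<in> Arr (fsrc F). fA G (fA F f))\<rparr>"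

definition fpair :: "('o, 'a, 'p, 'b) ftor \<Rightarrow> ('o, 'a, 'q, 'c) ftor \<Rightarrow>
    ('o, 'a, 'p \<times> 'q, 'b \<times> 'c) ftor" where
  "fpair F G = \<lparr>fsrc = fsrc F, ftrg = prod_cat (ftrg F) (ftrg G),
     fO = (\<lambda>x \<in> Obj (fsrc F). (fO F x, fO G x)),
     fA = (\<lambda>f \<in> Arr (fsrc F). (fA F f, fA G f))\<rparr>"

record ('o, 'a, 'p, 'b) ntrans =
  nsrc :: "('o, 'a, 'p, 'b) ftor"
  ntrg :: "('o, 'a, 'p, 'b) ftor"
  nc :: "'o \<Rightarrow> 'b"

definition is_ntrans :: "('o, 'a, 'p, 'b) ntrans \<Rightarrow> bool" where
  "is_ntrans t \<longleftrightarrow> (let F = nsrc t; G = ntrg t; C = fsrc F; D = ftrg F in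
     is_functor F \<and> is_functor G \<and> fsrc G = C \<and> ftrg G = D \<and>
     nc t \<in> extensional (Obj C) \<and>
     (\<forall>x \<in> Obj C. nc t x \<in> hom D (fO F x) (fO G x)) \<and>
     (\<forall>f \<in> Arr C. nc t (Cod C f) \<cdot>\<^bsub>D\<^esub> fA F f = fA G f \<cdot>\<^bsub>D\<^esub> nc t (Dom C f)))"

definition is_niso :: "('o, 'a, 'p, 'b) ntrans \<Rightarrow> bool" where
  "is_niso t \<longleftrightarrow> is_ntrans t \<and> (\<forall>x \<in> Obj (fsrc (nsrc t)). iso (ftrg (nsrc t)) (nc t x))"

definition nid :: "('o, 'a, 'p, 'b) ftor \<Rightarrow> ('o, 'a, 'p, 'b) ntrans" where
  "nid F = \<lparr>nsrc = F, ntrg = F, nc = (\<lambda>x \<in> Obj (fsrc F). idn (ftrg F) (fO F x))\<rparr>"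

definition nvcomp :: "('o, 'a, 'p, 'b) ntrans \<Rightarrow> ('o, 'a, 'p, 'b) ntrans \<Rightarrow>
    ('o, 'a, 'p, 'b) ntrans" where
  "nvcomp s t = \<lparr>nsrc = nsrc t, ntrg = ntrg s,
     nc = (\<lambda>x \<in> Obj (fsrc (nsrc t)). nc s x \<cdot>\<^bsub>ftrg (nsrc t)\<^esub> nc t x)\<rparr>"

definition nlwhisker :: "('p, 'b, 'q, 'c) ftor \<Rightarrow> ('o, 'a, 'p, 'b) ntrans \<Rightarrow>
    ('o, 'a, 'q, 'c) ntrans" where
  "nlwhisker H t = \<lparr>nsrc = H \<bullet> nsrc t, ntrg = H \<bullet> ntrg t,
     nc = (\<lambda>x \<in> Obj (fsrc (nsrc t)). fA H (nc t x))\<rparr>"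

definition nrwhisker :: "('p, 'b, 'q, 'c) ntrans \<Rightarrow> ('o, 'a, 'p, 'b) ftor \<Rightarrow>
    ('o, 'a, 'q, 'c) ntrans" where
  "nrwhisker t F = \<lparr>nsrc = nsrc t \<bullet> F, ntrg = ntrg t \<bullet> F,
     nc = (\<lambda>x \<in> Obj (fsrc F). nc t (fO F x))\<rparr>"

definition adjunction :: "('o, 'a, 'p, 'b) ftor \<Rightarrow> ('p, 'b, 'o, 'a) ftor \<Rightarrow>
    ('o, 'a, 'o, 'a) ntrans \<Rightarrow> ('p, 'b, 'p, 'b) ntrans \<Rightarrow> bool" where
  "adjunction L R \<eta> \<epsilon> \<longleftrightarrow>
     is_functor L \<and> is_functor R \<and> fsrc R = ftrg L \<and> ftrg R = fsrc L \<and>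
     is_ntrans \<eta> \<and> nsrc \<eta> = fid (fsrc L) \<and> ntrg \<eta> = R \<bullet> L \<and>
     is_ntrans \<epsilon> \<and> nsrc \<epsilon> = L \<bullet> R \<and> ntrg \<epsilon> = fid (ftrg L) \<and>
     (\<forall>x \<in> Obj (fsrc L).
        nc \<epsilon> (fO L x) \<cdot>\<^bsub>ftrg L\<^esub> fA L (nc \<eta> x) = idn (ftrg L) (fO L x)) \<and>
     (\<forall>y \<in> Obj (ftrg L).
        fA R (nc \<epsilon> y) \<cdot>\<^bsub>fsrc L\<^esub> nc \<eta> (fO R y) = idn (fsrc L) (fO R y))"


section \<open>Chosen finite products, internal groups\<close>

record ('o, 'a) cart =
  ccat :: "('o, 'a) cat"
  one :: "'o"
  prd :: "'o \<Rightarrow> 'o \<Rightarrow> 'o"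
  pr1 :: "'o \<Rightarrow> 'o \<Rightarrow> 'a"
  pr2 :: "'o \<Rightarrow> 'o \<Rightarrow> 'a"

definition finite_products :: "('o, 'a) cart \<Rightarrow> bool" where
  "finite_products K \<longleftrightarrow> (let C = ccat K in
     category C \<and>
     one K \<in> Obj C \<and> (\<forall>x \<in> Obj C. \<exists>!t. t \<in> hom C x (one K)) \<and>
     (\<forall>x \<in> Obj C. \<forall>y \<in> Obj C.
        prd K x y \<in> Obj C \<and>
        pr1 K x y \<in> hom C (prd K x y) x \<and> pr2 K x y \<in> hom C (prd K x y) y \<and>
        (\<forall>z \<in> Obj C. \<forall>f \<in> hom C z x. \<forall>g \<in> hom C z y.
           \<exists>!h. h \<in> hom C z (prd K x y) \<and> pr1 K x y \<cdot>\<^bsub>C\<^esub> h = f \<and> pr2 K x y \<cdot>\<^bsub>C\<^esub> h = g)))"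

definition term_map :: "('o, 'a) cart \<Rightarrow> 'o \<Rightarrow> 'a" where
  "term_map K x = (THE t. t \<in> hom (ccat K) x (one K))"

definition pairing :: "('o, 'a) cart \<Rightarrow> 'a \<Rightarrow> 'a \<Rightarrow> 'a" where
  "pairing K f g = (let C = ccat K; x = Cod C f; y = Cod C g in
     THE h. h \<in> hom C (Dom C f) (prd K x y) \<and> pr1 K x y \<cdot>\<^bsub>C\<^esub> h = f \<and> pr2 K x y \<cdot>\<^bsub>C\<^esub> h = g)"

definition prodmap :: "('o, 'a) cart \<Rightarrow> 'a \<Rightarrow> 'a \<Rightarrow> 'a" where
  "prodmap K f g = (let C = ccat K; x = Dom C f; y = Dom C g in
     pairing K (f \<cdot>\<^bsub>C\<^esub> pr1 K x y) (g \<cdot>\<^bsub>C\<^esub> pr2 K x y))"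

text \<open>The canonical isomorphism \<open>(x \<times> y) \<times> z \<rightarrow> x \<times> (y \<times> z)\<close>.\<close>

definition prod_assoc :: "('o, 'a) cart \<Rightarrow> 'o \<Rightarrow> 'o \<Rightarrow> 'o \<Rightarrow> 'a" where
  "prod_assoc K x y z = (let C = ccat K; p = pr1 K (prd K x y) z in
     pairing K (pr1 K x y \<cdot>\<^bsub>C\<^esub> p) (pairing K (pr2 K x y \<cdot>\<^bsub>C\<^esub> p) (pr2 K (prd K x y) z)))"

definition monoid_object :: "('o, 'a) cart \<Rightarrow> 'o \<Rightarrow> 'a \<Rightarrow> 'a \<Rightarrow> bool" where
  "monoid_object K A m e \<longleftrightarrow> (let C = ccat K in
     A \<in> Obj C \<and> m \<in> hom C (prd K A A) A \<and> e \<in> hom C (one K) A \<and>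
     m \<cdot>\<^bsub>C\<^esub> prodmap K m (idn C A) =
       m \<cdot>\<^bsub>C\<^esub> prodmap K (idn C A) m \<cdot>\<^bsub>C\<^esub> prod_assoc K A A A \<and>
     m \<cdot>\<^bsub>C\<^esub> prodmap K e (idn C A) = pr2 K (one K) A \<and>
     m \<cdot>\<^bsub>C\<^esub> prodmap K (idn C A) e = pr1 K A (one K))"

record ('o, 'a) grp =
  gcar :: "'o"
  gmul :: "'a"
  gunit :: "'a"
  ginv :: "'a"

definition group_object :: "('o, 'a) cart \<Rightarrow> ('o, 'a) grp \<Rightarrow> bool" where
  "group_object K G \<longleftrightarrow> (let C = ccat K; A = gcar G in
     monoid_object K A (gmul G) (gunit G) \<and> ginv G \<in> hom C A A \<and>
     gmul G \<cdot>\<^bsub>C\<^esub> pairing K (idn C A) (ginv G) = gunit G \<cdot>\<^bsub>C\<^esub> term_map K A)"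

text \<open>Arrows of the category of internal groups are monoid morphisms (which automatically
  commute with inverses), tagged with their domain and codomain.\<close>

definition group_cat :: "('o, 'a) cart \<Rightarrow>
    (('o, 'a) grp, ('o, 'a) grp \<times> 'a \<times> ('o, 'a) grp) cat" where
  "group_cat K = (let C = ccat K in \<lparr>
     Obj = {G. group_object K G},
     Arr = {(G, f, H). group_object K G \<and> group_object K H \<and> f \<in> hom C (gcar G) (gcar H) \<and>
        f \<cdot>\<^bsub>C\<^esub> gmul G = gmul H \<cdot>\<^bsub>C\<^esub> prodmap K f f \<and> f \<cdot>\<^bsub>C\<^esub> gunit G = gunit H},
     Dom = (\<lambda>(G, f, H). G),
     Cod = (\<lambda>(G, f, H). H),
     idn = (\<lambda>G. (G, idn C (gcar G), G)),
     Comp = (\<lambda>(G', g, H') (G, f, H). (G, g \<cdot>\<^bsub>C\<^esub> f, H'))\<rparr>)"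

definition group_forget :: "('o, 'a) cart \<Rightarrow>
    (('o, 'a) grp, ('o, 'a) grp \<times> 'a \<times> ('o, 'a) grp, 'o, 'a) ftor" where
  "group_forget K = \<lparr>fsrc = group_cat K, ftrg = ccat K,
     fO = (\<lambda>G \<in> Obj (group_cat K). gcar G),
     fA = (\<lambda>h \<in> Arr (group_cat K). fst (snd h))\<rparr>"


section \<open>2-categories and pseudofunctors\<close>

text \<open>The operations of a (strict) 2-category: \<open>mor2 K x y\<close> is the set of 1-cells
  \<open>x \<rightarrow> y\<close> and \<open>cell2 K f g\<close> the set of 2-cells \<open>f \<Rightarrow> g\<close>.\<close>

record ('o, 'm, 'c) two_cat =
  obj2 :: "'o set"
  mor2 :: "'o \<Rightarrow> 'o \<Rightarrow> 'm set"
  cell2 :: "'m \<Rightarrow> 'm \<Rightarrow> 'c set"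
  one1 :: "'o \<Rightarrow> 'm"
  comp1 :: "'m \<Rightarrow> 'm \<Rightarrow> 'm"
  one2 :: "'m \<Rightarrow> 'c"
  vcomp2 :: "'c \<Rightarrow> 'c \<Rightarrow> 'c"
  lwhisker2 :: "'m \<Rightarrow> 'c \<Rightarrow> 'c"
  rwhisker2 :: "'c \<Rightarrow> 'm \<Rightarrow> 'c"

definition inv_cell2 :: "('o, 'm, 'c) two_cat \<Rightarrow> 'm \<Rightarrow> 'm \<Rightarrow> 'c \<Rightarrow> bool" where
  "inv_cell2 K f g t \<longleftrightarrow> t \<in> cell2 K f g \<and>
     (\<exists>s \<in> cell2 K g f. vcomp2 K s t = one2 K f \<and> vcomp2 K t s = one2 K g)"

text \<open>Pseudofunctors from a category, regarded as a locally discrete 2-category;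
  \<open>psC g f\<close> is the 2-cell \<open>F(g) \<circ> F(f) \<Rightarrow> F(g \<circ> f)\<close> and \<open>psI A\<close> the 2-cell
  \<open>1 \<Rightarrow> F(1\<^sub>A)\<close>.\<close>

record ('b, 'f, 'o, 'm, 'c) psfun =
  psO :: "'b \<Rightarrow> 'o"
  psA :: "'f \<Rightarrow> 'm"
  psC :: "'f \<Rightarrow> 'f \<Rightarrow> 'c"
  psI :: "'b \<Rightarrow> 'c"

definition pseudofunctor :: "('b, 'f) cat \<Rightarrow> ('o, 'm, 'c) two_cat \<Rightarrow>
    ('b, 'f, 'o, 'm, 'c) psfun \<Rightarrow> bool" where
  "pseudofunctor B K F \<longleftrightarrow>
     category B \<and>
     (\<forall>A \<in> Obj B. psO F A \<in> obj2 K) \<and>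
     (\<forall>f \<in> Arr B. psA F f \<in> mor2 K (psO F (Dom B f)) (psO F (Cod B f))) \<and>
     (\<forall>A \<in> Obj B. inv_cell2 K (one1 K (psO F A)) (psA F (idn B A)) (psI F A)) \<and>
     (\<forall>f \<in> Arr B. \<forall>g \<in> Arr B. Dom B g = Cod B f \<longrightarrow>
        inv_cell2 K (comp1 K (psA F g) (psA F f)) (psA F (g \<cdot>\<^bsub>B\<^esub> f)) (psC F g f)) \<and>
     (\<forall>f \<in> Arr B. \<forall>g \<in> Arr B. \<forall>h \<in> Arr B. Dom B g = Cod B f \<longrightarrow> Dom B h = Cod B g \<longrightarrow>
        vcomp2 K (psC F h (g \<cdot>\<^bsub>B\<^esub> f)) (lwhisker2 K (psA F h) (psC F g f)) =
        vcomp2 K (psC F (h \<cdot>\<^bsub>B\<^esub> g) f) (rwhisker2 K (psC F h g) (psA F f))) \<and>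
     (\<forall>f \<in> Arr B.
        vcomp2 K (psC F f (idn B (Dom B f))) (lwhisker2 K (psA F f) (psI F (Dom B f))) =
          one2 K (psA F f) \<and>
        vcomp2 K (psC F (idn B (Cod B f)) f) (rwhisker2 K (psI F (Cod B f)) (psA F f)) =
          one2 K (psA F f))"

definition psfun_eq :: "('b, 'f) cat \<Rightarrow> ('b, 'f, 'o, 'm, 'c) psfun \<Rightarrow>
    ('b, 'f, 'o, 'm, 'c) psfun \<Rightarrow> bool" where
  "psfun_eq B F G \<longleftrightarrow>
     (\<forall>A \<in> Obj B. psO F A = psO G A \<and> psI F A = psI G A) \<and>
     (\<forall>f \<in> Arr B. psA F f = psA G f) \<and>
     (\<forall>f \<in> Arr B. \<forall>g \<in> Arr B. Dom B g = Cod B f \<longrightarrow> psC F g f = psC G g f)"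

definition ps_precomp :: "('b, 'f, 'o, 'm, 'c) psfun \<Rightarrow> ('d, 'e, 'b, 'f) ftor \<Rightarrow>
    ('d, 'e, 'o, 'm, 'c) psfun" where
  "ps_precomp F U = \<lparr>
     psO = (\<lambda>A. psO F (fO U A)),
     psA = (\<lambda>f. psA F (fA U f)),
     psC = (\<lambda>g f. psC F (fA U g) (fA U f)),
     psI = (\<lambda>A. psI F (fO U A))\<rparr>"

text \<open>Postcomposition with a strict 2-functor, given by its actions on 0-, 1- and 2-cells.\<close>

definition ps_postcomp :: "('o \<Rightarrow> 'o') \<Rightarrow> ('m \<Rightarrow> 'm') \<Rightarrow> ('c \<Rightarrow> 'c') \<Rightarrow>
    ('b, 'f, 'o, 'm, 'c) psfun \<Rightarrow> ('b, 'f, 'o', 'm', 'c') psfun" where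
  "ps_postcomp U0 U1 U2 F = \<lparr>
     psO = (\<lambda>A. U0 (psO F A)),
     psA = (\<lambda>f. U1 (psA F f)),
     psC = (\<lambda>g f. U2 (psC F g f)),
     psI = (\<lambda>A. U2 (psI F A))\<rparr>"

definition CAT :: "(('o, 'a) cat, ('o, 'a, 'o, 'a) ftor, ('o, 'a, 'o, 'a) ntrans) two_cat" where
  "CAT = \<lparr>
     obj2 = {C. category C},
     mor2 = (\<lambda>C D. {F. is_functor F \<and> fsrc F = C \<and> ftrg F = D}),
     cell2 = (\<lambda>F G. {t. is_ntrans t \<and> nsrc t = F \<and> ntrg t = G}),
     one1 = fid,
     comp1 = fcomp,
     one2 = nid,
     vcomp2 = nvcomp,
     lwhisker2 = nlwhisker,
     rwhisker2 = nrwhisker\<rparr>"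


section \<open>Monoidal categories and 2-groups\<close>

record ('o, 'a) moncat =
  mcat :: "('o, 'a) cat"
  mten :: "('o \<times> 'o, 'a \<times> 'a, 'o, 'a) ftor"
  munit :: "'o"
  massoc :: "'o \<Rightarrow> 'o \<Rightarrow> 'o \<Rightarrow> 'a"
  mlunit :: "'o \<Rightarrow> 'a"
  mrunit :: "'o \<Rightarrow> 'a"

abbreviation tenO :: "('o, 'a) moncat \<Rightarrow> 'o \<Rightarrow> 'o \<Rightarrow> 'o" where
  "tenO V x y \<equiv> fO (mten V) (x, y)"

abbreviation tenA :: "('o, 'a) moncat \<Rightarrow> 'a \<Rightarrow> 'a \<Rightarrow> 'a" where
  "tenA V f g \<equiv> fA (mten V) (f, g)"

definition monoidal_category :: "('o, 'a) moncat \<Rightarrow> bool" where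
  "monoidal_category V \<longleftrightarrow>
     (let C = mcat V; T = tenO V; TA = tenA V; I = munit V;
          a = massoc V; l = mlunit V; r = mrunit V in
     category C \<and>
     is_functor (mten V) \<and> fsrc (mten V) = prod_cat C C \<and> ftrg (mten V) = C \<and>
     I \<in> Obj C \<and>
     (\<forall>x \<in> Obj C. \<forall>y \<in> Obj C. \<forall>z \<in> Obj C.
        a x y z \<in> hom C (T (T x y) z) (T x (T y z)) \<and> iso C (a x y z)) \<and>
     (\<forall>f \<in> Arr C. \<forall>g \<in> Arr C. \<forall>h \<in> Arr C.
        a (Cod C f) (Cod C g) (Cod C h) \<cdot>\<^bsub>C\<^esub> TA (TA f g) h =
        TA f (TA g h) \<cdot>\<^bsub>C\<^esub> a (Dom C f) (Dom C g) (Dom C h)) \<and>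
     (\<forall>x \<in> Obj C. l x \<in> hom C (T I x) x \<and> iso C (l x) \<and>
                   r x \<in> hom C (T x I) x \<and> iso C (r x)) \<and>
     (\<forall>f \<in> Arr C.
        l (Cod C f) \<cdot>\<^bsub>C\<^esub> TA (idn C I) f = f \<cdot>\<^bsub>C\<^esub> l (Dom C f) \<and>
        r (Cod C f) \<cdot>\<^bsub>C\<^esub> TA f (idn C I) = f \<cdot>\<^bsub>C\<^esub> r (Dom C f)) \<and>
     (\<forall>w \<in> Obj C. \<forall>x \<in> Obj C. \<forall>y \<in> Obj C. \<forall>z \<in> Obj C.
        a w x (T y z) \<cdot>\<^bsub>C\<^esub> a (T w x) y z =
        TA (idn C w) (a x y z) \<cdot>\<^bsub>C\<^esub> a w (T x y) z \<cdot>\<^bsub>C\<^esub> TA (a w x y) (idn C z)) \<and>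
     (\<forall>x \<in> Obj C. \<forall>y \<in> Obj C.
        TA (idn C x) (l y) \<cdot>\<^bsub>C\<^esub> a x I y = TA (r x) (idn C y)))"

definition two_group :: "('o, 'a) moncat \<Rightarrow> bool" where
  "two_group V \<longleftrightarrow> monoidal_category V \<and> groupoid (mcat V) \<and>
     (\<forall>x \<in> Obj (mcat V). \<exists>y \<in> Obj (mcat V).
        isomorphic (mcat V) (tenO V x y) (munit V) \<and> isomorphic (mcat V) (tenO V y x) (munit V))"

text \<open>Strong monoidal functors, with structure maps
  \<open>sphi (x, y) : F x \<otimes> F y \<rightarrow> F (x \<otimes> y)\<close> and \<open>sphi0 : I \<rightarrow> F I\<close>.\<close>

record ('o, 'a) smfun =
  ssrc :: "('o, 'a) moncat"
  strg :: "('o, 'a) moncat"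
  sfun :: "('o, 'a, 'o, 'a) ftor"
  sphi :: "'o \<times> 'o \<Rightarrow> 'a"
  sphi0 :: "'a"

definition strong_monoidal :: "('o, 'a) smfun \<Rightarrow> bool" where
  "strong_monoidal S \<longleftrightarrow>
     (let V = ssrc S; W = strg S; C = mcat V; D = mcat W; F = sfun S; p = sphi S; p0 = sphi0 S in
     monoidal_category V \<and> monoidal_category W \<and>
     is_functor F \<and> fsrc F = C \<and> ftrg F = D \<and>
     p \<in> extensional (Obj C \<times> Obj C) \<and>
     (\<forall>x \<in> Obj C. \<forall>y \<in> Obj C.
        p (x, y) \<in> hom D (tenO W (fO F x) (fO F y)) (fO F (tenO V x y)) \<and> iso D (p (x, y))) \<and>
     (\<forall>f \<in> Arr C. \<forall>g \<in> Arr C.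
        p (Cod C f, Cod C g) \<cdot>\<^bsub>D\<^esub> tenA W (fA F f) (fA F g) =
        fA F (tenA V f g) \<cdot>\<^bsub>D\<^esub> p (Dom C f, Dom C g)) \<and>
     p0 \<in> hom D (munit W) (fO F (munit V)) \<and> iso D p0 \<and>
     (\<forall>x \<in> Obj C. \<forall>y \<in> Obj C. \<forall>z \<in> Obj C.
        fA F (massoc V x y z) \<cdot>\<^bsub>D\<^esub> p (tenO V x y, z) \<cdot>\<^bsub>D\<^esub> tenA W (p (x, y)) (idn D (fO F z)) =
        p (x, tenO V y z) \<cdot>\<^bsub>D\<^esub> tenA W (idn D (fO F x)) (p (y, z))
          \<cdot>\<^bsub>D\<^esub> massoc W (fO F x) (fO F y) (fO F z)) \<and>
     (\<forall>x \<in> Obj C.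
        fA F (mlunit V x) \<cdot>\<^bsub>D\<^esub> p (munit V, x) \<cdot>\<^bsub>D\<^esub> tenA W p0 (idn D (fO F x)) =
          mlunit W (fO F x) \<and>
        fA F (mrunit V x) \<cdot>\<^bsub>D\<^esub> p (x, munit V) \<cdot>\<^bsub>D\<^esub> tenA W (idn D (fO F x)) p0 =
          mrunit W (fO F x)))"

definition smid :: "('o, 'a) moncat \<Rightarrow> ('o, 'a) smfun" where
  "smid V = \<lparr>ssrc = V, strg = V, sfun = fid (mcat V),
     sphi = (\<lambda>(x, y) \<in> Obj (mcat V) \<times> Obj (mcat V). idn (mcat V) (tenO V x y)),
     sphi0 = idn (mcat V) (munit V)\<rparr>"

definition smcomp :: "('o, 'a) smfun \<Rightarrow> ('o, 'a) smfun \<Rightarrow> ('o, 'a) smfun" where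
  "smcomp T S = (let D = mcat (strg T); C = mcat (ssrc S) in
     \<lparr>ssrc = ssrc S, strg = strg T, sfun = sfun T \<bullet> sfun S,
      sphi = (\<lambda>(x, y) \<in> Obj C \<times> Obj C.
        fA (sfun T) (sphi S (x, y)) \<cdot>\<^bsub>D\<^esub> sphi T (fO (sfun S) x, fO (sfun S) y)),
      sphi0 = fA (sfun T) (sphi0 S) \<cdot>\<^bsub>D\<^esub> sphi0 T\<rparr>)"

record ('o, 'a) mntrans =
  mnsrc :: "('o, 'a) smfun"
  mntrg :: "('o, 'a) smfun"
  mnt :: "('o, 'a, 'o, 'a) ntrans"

definition monoidal_ntrans :: "('o, 'a) mntrans \<Rightarrow> bool" where
  "monoidal_ntrans t \<longleftrightarrow>
     (let S = mnsrc t; T = mntrg t; V = ssrc S; W = strg S; C = mcat V; D = mcat W;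
          c = nc (mnt t) in
     strong_monoidal S \<and> strong_monoidal T \<and> ssrc T = V \<and> strg T = W \<and>
     is_ntrans (mnt t) \<and> nsrc (mnt t) = sfun S \<and> ntrg (mnt t) = sfun T \<and>
     (\<forall>x \<in> Obj C. \<forall>y \<in> Obj C.
        c (tenO V x y) \<cdot>\<^bsub>D\<^esub> sphi S (x, y) = sphi T (x, y) \<cdot>\<^bsub>D\<^esub> tenA W (c x) (c y)) \<and>
     c (munit V) \<cdot>\<^bsub>D\<^esub> sphi0 S = sphi0 T)"

text \<open>2-groups, strong monoidal functors and monoidal natural transformations.\<close>

definition TWOGP :: "(('o, 'a) moncat, ('o, 'a) smfun, ('o, 'a) mntrans) two_cat" where
  "TWOGP = \<lparr>
     obj2 = {V. two_group V},
     mor2 = (\<lambda>V W. {S. two_group V \<and> two_group W \<and> strong_monoidal S \<and> ssrc S = V \<and> strg S = W}),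
     cell2 = (\<lambda>S T. {t. monoidal_ntrans t \<and> mnsrc t = S \<and> mntrg t = T}),
     one1 = smid,
     comp1 = smcomp,
     one2 = (\<lambda>S. \<lparr>mnsrc = S, mntrg = S, mnt = nid (sfun S)\<rparr>),
     vcomp2 = (\<lambda>s t. \<lparr>mnsrc = mnsrc t, mntrg = mntrg s, mnt = nvcomp (mnt s) (mnt t)\<rparr>),
     lwhisker2 = (\<lambda>H t. \<lparr>mnsrc = smcomp H (mnsrc t), mntrg = smcomp H (mntrg t),
        mnt = nlwhisker (sfun H) (mnt t)\<rparr>),
     rwhisker2 = (\<lambda>t S. \<lparr>mnsrc = smcomp (mnsrc t) S, mntrg = smcomp (mntrg t) S,
        mnt = nrwhisker (mnt t) (sfun S)\<rparr>)\<rparr>"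


section \<open>Cartesian monoidal opfibrations\<close>

definition cocartesian :: "('x, 'u, 'b, 'f) ftor \<Rightarrow> 'u \<Rightarrow> bool" where
  "cocartesian P f \<longleftrightarrow> (let X = fsrc P; B = ftrg P in
     f \<in> Arr X \<and>
     (\<forall>g \<in> Arr X. \<forall>v \<in> hom B (fO P (Cod X f)) (fO P (Cod X g)).
        Dom X g = Dom X f \<longrightarrow> fA P g = v \<cdot>\<^bsub>B\<^esub> fA P f \<longrightarrow>
        (\<exists>!h. h \<in> hom X (Cod X f) (Cod X g) \<and> fA P h = v \<and> h \<cdot>\<^bsub>X\<^esub> f = g)))"

text \<open>\<open>lift E f X\<close> is the chosen cocartesian lifting of \<open>f : A \<rightarrow> B\<close> at \<open>X\<close> over \<open>A\<close>.\<close>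

record ('x, 'u, 'b, 'f) opfib =
  tot :: "('x, 'u) cart"
  base :: "('b, 'f) cart"
  proj :: "('x, 'u, 'b, 'f) ftor"
  lift :: "'f \<Rightarrow> 'x \<Rightarrow> 'u"

definition cloven_opfibration :: "('x, 'u, 'b, 'f) ftor \<Rightarrow> ('f \<Rightarrow> 'x \<Rightarrow> 'u) \<Rightarrow> bool" where
  "cloven_opfibration P lft \<longleftrightarrow> is_functor P \<and>
     (\<forall>f \<in> Arr (ftrg P). \<forall>X \<in> Obj (fsrc P). fO P X = Dom (ftrg P) f \<longrightarrow>
        cocartesian P (lft f X) \<and> Dom (fsrc P) (lft f X) = X \<and> fA P (lft f X) = f)"

text \<open>For cartesian monoidal structures a functor is strict monoidal exactly when it preserves
  the chosen terminal object, the chosen products and their projections on the nose.\<close>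

definition cartesian_monoidal_opfibration :: "('x, 'u, 'b, 'f) opfib \<Rightarrow> bool" where
  "cartesian_monoidal_opfibration E \<longleftrightarrow> (let K = tot E; L = base E; P = proj E in
     finite_products K \<and> finite_products L \<and>
     cloven_opfibration P (lift E) \<and> fsrc P = ccat K \<and> ftrg P = ccat L \<and>
     fO P (one K) = one L \<and>
     (\<forall>x \<in> Obj (ccat K). \<forall>y \<in> Obj (ccat K).
        fO P (prd K x y) = prd L (fO P x) (fO P y) \<and>
        fA P (pr1 K x y) = pr1 L (fO P x) (fO P y) \<and>
        fA P (pr2 K x y) = pr2 L (fO P x) (fO P y)) \<and>
     (\<forall>f g. cocartesian P f \<longrightarrow> cocartesian P g \<longrightarrow> cocartesian P (prodmap K f g)))"

abbreviation cX :: "('x, 'u, 'b, 'f) opfib \<Rightarrow> ('x, 'u) cat" where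
  "cX E \<equiv> ccat (tot E)"

abbreviation cB :: "('x, 'u, 'b, 'f) opfib \<Rightarrow> ('b, 'f) cat" where
  "cB E \<equiv> ccat (base E)"

definition fibre :: "('x, 'u, 'b, 'f) opfib \<Rightarrow> 'b \<Rightarrow> ('x, 'u) cat" where
  "fibre E A = \<lparr>
     Obj = {X \<in> Obj (cX E). fO (proj E) X = A},
     Arr = {u \<in> Arr (cX E). fO (proj E) (Dom (cX E) u) = A \<and> fO (proj E) (Cod (cX E) u) = A \<and>
              fA (proj E) u = idn (cB E) A},
     Dom = Dom (cX E),
     Cod = Cod (cX E),
     idn = idn (cX E),
     Comp = Comp (cX E)\<rparr>"

text \<open>For \<open>c\<close> cocartesian and \<open>g\<close> with the same domain and the same image in the base, the
  unique vertical \<open>w\<close> with \<open>w \<circ> c = g\<close>.\<close>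

definition vfactor :: "('x, 'u, 'b, 'f) opfib \<Rightarrow> 'u \<Rightarrow> 'u \<Rightarrow> 'u" where
  "vfactor E c g = (THE w. w \<in> hom (cX E) (Cod (cX E) c) (Cod (cX E) g) \<and>
     fA (proj E) w = idn (cB E) (fO (proj E) (Cod (cX E) g)) \<and> w \<cdot>\<^bsub>cX E\<^esub> c = g)"

definition push :: "('x, 'u, 'b, 'f) opfib \<Rightarrow> 'f \<Rightarrow> 'x \<Rightarrow> 'x" where
  "push E f X = Cod (cX E) (lift E f X)"

definition change_base :: "('x, 'u, 'b, 'f) opfib \<Rightarrow> 'f \<Rightarrow> ('x, 'u, 'x, 'u) ftor" where
  "change_base E f = (let S = fibre E (Dom (cB E) f) in
     \<lparr>fsrc = S, ftrg = fibre E (Cod (cB E) f),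
      fO = (\<lambda>X \<in> Obj S. push E f X),
      fA = (\<lambda>u \<in> Arr S. vfactor E (lift E f (Dom (cX E) u))
                                  (lift E f (Cod (cX E) u) \<cdot>\<^bsub>cX E\<^esub> u))\<rparr>)"

definition assoc_pseudofunctor :: "('x, 'u, 'b, 'f) opfib \<Rightarrow>
    ('b, 'f, ('x, 'u) cat, ('x, 'u, 'x, 'u) ftor, ('x, 'u, 'x, 'u) ntrans) psfun" where
  "assoc_pseudofunctor E = \<lparr>
     psO = fibre E,
     psA = change_base E,
     psC = (\<lambda>g f. \<lparr>nsrc = change_base E g \<bullet> change_base E f,
                   ntrg = change_base E (g \<cdot>\<^bsub>cB E\<^esub> f),
                   nc = (\<lambda>X \<in> Obj (fibre E (Dom (cB E) f)).
                     vfactor E (lift E g (push E f X) \<cdot>\<^bsub>cX E\<^esub> lift E f X)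
                               (lift E (g \<cdot>\<^bsub>cB E\<^esub> f) X))\<rparr>),
     psI = (\<lambda>A. \<lparr>nsrc = fid (fibre E A),
                 ntrg = change_base E (idn (cB E) A),
                 nc = (\<lambda>X \<in> Obj (fibre E A). lift E (idn (cB E) A) X)\<rparr>)\<rparr>"


section \<open>The lax monoidal structure and the adjunctions\<close>

definition L1 :: "('x, 'u, 'b, 'f) opfib \<Rightarrow> ('x, 'u, unit, unit) ftor" where
  "L1 E = (let S = fibre E (one (base E)) in
     \<lparr>fsrc = S, ftrg = terminal_cat, fO = (\<lambda>X \<in> Obj S. ()), fA = (\<lambda>u \<in> Arr S. ())\<rparr>)"

definition R1 :: "('x, 'u, 'b, 'f) opfib \<Rightarrow> (unit, unit, 'x, 'u) ftor" where
  "R1 E = \<lparr>fsrc = terminal_cat, ftrg = fibre E (one (base E)),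
     fO = (\<lambda>_. one (tot E)), fA = (\<lambda>_. idn (cX E) (one (tot E)))\<rparr>"

definition LL :: "('x, 'u, 'b, 'f) opfib \<Rightarrow> 'b \<Rightarrow> 'b \<Rightarrow> ('x, 'u, 'x \<times> 'x, 'u \<times> 'u) ftor" where
  "LL E A B = fpair (change_base E (pr1 (base E) A B)) (change_base E (pr2 (base E) A B))"

definition RR :: "('x, 'u, 'b, 'f) opfib \<Rightarrow> 'b \<Rightarrow> 'b \<Rightarrow> ('x \<times> 'x, 'u \<times> 'u, 'x, 'u) ftor" where
  "RR E A B = (let S = prod_cat (fibre E A) (fibre E B) in
     \<lparr>fsrc = S, ftrg = fibre E (prd (base E) A B),
      fO = (\<lambda>(X, Y) \<in> Obj S. prd (tot E) X Y),
      fA = (\<lambda>(u, v) \<in> Arr S. prodmap (tot E) u v)\<rparr>)"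

definition eta1 :: "('x, 'u, 'b, 'f) opfib \<Rightarrow> ('x, 'u, 'x, 'u) ntrans" where
  "eta1 E = (let S = fibre E (one (base E)) in
     \<lparr>nsrc = fid S, ntrg = R1 E \<bullet> L1 E, nc = (\<lambda>X \<in> Obj S. term_map (tot E) X)\<rparr>)"

definition eps1 :: "('x, 'u, 'b, 'f) opfib \<Rightarrow> (unit, unit, unit, unit) ntrans" where
  "eps1 E = \<lparr>nsrc = L1 E \<bullet> R1 E, ntrg = fid terminal_cat, nc = (\<lambda>_. ())\<rparr>"

definition eta :: "('x, 'u, 'b, 'f) opfib \<Rightarrow> 'b \<Rightarrow> 'b \<Rightarrow> ('x, 'u, 'x, 'u) ntrans" where
  "eta E A B = (let S = fibre E (prd (base E) A B) in
     \<lparr>nsrc = fid S, ntrg = RR E A B \<bullet> LL E A B,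
      nc = (\<lambda>Z \<in> Obj S. pairing (tot E) (lift E (pr1 (base E) A B) Z)
                                          (lift E (pr2 (base E) A B) Z))\<rparr>)"

definition eps :: "('x, 'u, 'b, 'f) opfib \<Rightarrow> 'b \<Rightarrow> 'b \<Rightarrow>
    ('x \<times> 'x, 'u \<times> 'u, 'x \<times> 'x, 'u \<times> 'u) ntrans" where
  "eps E A B = (let S = prod_cat (fibre E A) (fibre E B); K = tot E; L = base E in
     \<lparr>nsrc = LL E A B \<bullet> RR E A B, ntrg = fid S,
      nc = (\<lambda>(X, Y) \<in> Obj S.
        (vfactor E (lift E (pr1 L A B) (prd K X Y)) (pr1 K X Y),
         vfactor E (lift E (pr2 L A B) (prd K X Y)) (pr2 K X Y)))\<rparr>)"


section \<open>The induced monoidal structures and groupal pseudofunctors\<close>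

text \<open>The monoidal structure on \<open>F(M)\<close> for a monoid \<open>(M, m, e)\<close>. Its constraints are the
  vertical arrows induced by the associativity and unit isomorphisms of the products in the
  total category: the domain of each is the codomain of a composite of (products of) chosen
  liftings, which is cocartesian over \<open>m \<circ> (m \<times> 1)\<close>, \<open>m \<circ> (e \<times> 1)\<close>, \<open>m \<circ> (1 \<times> e)\<close> respectively.\<close>

definition monoid_moncat :: "('x, 'u, 'b, 'f) opfib \<Rightarrow> 'b \<Rightarrow> 'f \<Rightarrow> 'f \<Rightarrow> ('x, 'u) moncat" where
  "monoid_moncat E M m e =
     (let C = cX E; K = tot E;
          I = fO (change_base E e \<bullet> R1 E) ();
          T = (\<lambda>X Y. push E m (prd K X Y));
          q = (\<lambda>X Y. lift E m (prd K X Y)) in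
     \<lparr>mcat = fibre E M,
      mten = change_base E m \<bullet> RR E M M,
      munit = I,
      massoc = (\<lambda>X Y Z. vfactor E
        (q (T X Y) Z \<cdot>\<^bsub>C\<^esub> prodmap K (q X Y) (idn C Z))
        (q X (T Y Z) \<cdot>\<^bsub>C\<^esub> prodmap K (idn C X) (q Y Z) \<cdot>\<^bsub>C\<^esub> prod_assoc K X Y Z)),
      mlunit = (\<lambda>X. vfactor E
        (q I X \<cdot>\<^bsub>C\<^esub> prodmap K (lift E e (one K)) (idn C X)) (pr2 K (one K) X)),
      mrunit = (\<lambda>X. vfactor E
        (q X I \<cdot>\<^bsub>C\<^esub> prodmap K (idn C X) (lift E e (one K))) (pr1 K X (one K)))\<rparr>)"

abbreviation group_moncat :: "('x, 'u, 'b, 'f) opfib \<Rightarrow> ('b, 'f) grp \<Rightarrow> ('x, 'u) moncat" where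
  "group_moncat E G \<equiv> monoid_moncat E (gcar G) (gmul G) (gunit G)"

text \<open>The strong monoidal structure on \<open>F(f)\<close> for a morphism \<open>f : G \<rightarrow> H\<close>; it is induced by
  \<open>n \<circ> (f \<times> f) = f \<circ> m\<close> and \<open>e' = f \<circ> e\<close>.\<close>

definition group_smfun :: "('x, 'u, 'b, 'f) opfib \<Rightarrow> ('b, 'f) grp \<times> 'f \<times> ('b, 'f) grp \<Rightarrow>
    ('x, 'u) smfun" where
  "group_smfun E = (\<lambda>(G, f, H).
     (let C = cX E; K = tot E; S = fibre E (gcar G);
          m = gmul G; n = gmul H; e = gunit G; e' = gunit H in
     \<lparr>ssrc = group_moncat E G, strg = group_moncat E H, sfun = change_base E f,
      sphi = (\<lambda>(X, Y) \<in> Obj S \<times> Obj S. vfactor E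
        (lift E n (prd K (push E f X) (push E f Y)) \<cdot>\<^bsub>C\<^esub> prodmap K (lift E f X) (lift E f Y))
        (lift E f (push E m (prd K X Y)) \<cdot>\<^bsub>C\<^esub> lift E m (prd K X Y))),
      sphi0 = vfactor E (lift E e' (one K))
        (lift E f (push E e (one K)) \<cdot>\<^bsub>C\<^esub> lift E e (one K))\<rparr>))"

definition group_pseudofunctor :: "('x, 'u, 'b, 'f) opfib \<Rightarrow>
    (('b, 'f) grp, ('b, 'f) grp \<times> 'f \<times> ('b, 'f) grp,
     ('x, 'u) moncat, ('x, 'u) smfun, ('x, 'u) mntrans) psfun" where
  "group_pseudofunctor E = (let F = ps_precomp (assoc_pseudofunctor E) (group_forget (base E)) in
     \<lparr>psO = group_moncat E,
      psA = group_smfun E,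
      psC = (\<lambda>g f. \<lparr>mnsrc = smcomp (group_smfun E g) (group_smfun E f),
                    mntrg = group_smfun E (g \<cdot>\<^bsub>group_cat (base E)\<^esub> f),
                    mnt = psC F g f\<rparr>),
      psI = (\<lambda>G. \<lparr>mnsrc = smid (group_moncat E G),
                  mntrg = group_smfun E (idn (group_cat (base E)) G),
                  mnt = psI F G\<rparr>)\<rparr>)"

text \<open>The last conjunct is the equation \<open>U \<circ> 2Gp(F) = F \<circ> U\<close>.\<close>

definition groupal :: "('x, 'u, 'b, 'f) opfib \<Rightarrow> bool" where
  "groupal E \<longleftrightarrow>
     pseudofunctor (group_cat (base E)) TWOGP (group_pseudofunctor E) \<and>
     psfun_eq (group_cat (base E))
       (ps_postcomp mcat sfun mnt (group_pseudofunctor E))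
       (ps_precomp (assoc_pseudofunctor E) (group_forget (base E)))"


section \<open>The associated pseudofunctor and the adjunctions are well defined\<close>

text \<open>The main facts are \<open>pseudofunctor_assoc\<close> (\<open>F\<close> is a pseudofunctor to \<open>CAT\<close>),
  \<open>adjunction_LR1\<close> and \<open>adjunction_LR\<close> (\<open>eta1\<close> and \<open>eta\<close> are the units of adjunctions
  whose right adjoints are given by the products of the total category).\<close>

lemma category_homI:
  assumes "category C" "f \<in> hom C x y" "g \<in> hom C y z"
  shows "g \<cdot>\<^bsub>C\<^esub> f \<in> hom C x z"
  using assms unfolding category_def hom_def by auto

lemma category_assoc:
  assumes "category C" "f \<in> hom C x y" "g \<in> hom C y z" "h \<in> hom C z w"
  shows "(h \<cdot>\<^bsub>C\<^esub> g) \<cdot>\<^bsub>C\<^esub> f = h \<cdot>\<^bsub>C\<^esub> (g \<cdot>\<^bsub>C\<^esub> f)"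
  using assms unfolding category_def hom_def by auto

lemma category_ids:
  assumes "category C" "f \<in> hom C x y"
  shows "x \<in> Obj C" "y \<in> Obj C" "idn C x \<in> hom C x x" "idn C y \<in> hom C y y"
    "f \<cdot>\<^bsub>C\<^esub> idn C x = f" "idn C y \<cdot>\<^bsub>C\<^esub> f = f"
  using assms unfolding category_def hom_def by auto

lemma category_idI: "category C \<Longrightarrow> x \<in> Obj C \<Longrightarrow> idn C x \<in> hom C x x"
  by (simp add: category_def)

lemma category_prod_cat:
  assumes "category C" "category D"
  shows "category (prod_cat C D)"
  using assms unfolding category_def prod_cat_def hom_def by auto

lemma category_terminal_cat: "category terminal_cat"
  unfolding category_def terminal_cat_def hom_def by auto

lemma is_functor_fid: "category C \<Longrightarrow> is_functor (fid C)"
  unfolding is_functor_def fid_def Let_def by (auto simp: category_def hom_def)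

lemma is_functor_fcomp:
  assumes "is_functor F" "is_functor G" "fsrc G = ftrg F"
  shows "is_functor (G \<bullet> F)"
proof -
  have c: "category (fsrc F)" using assms(1) by (simp add: is_functor_def Let_def)
  then have cl: "\<And>f g. f \<in> Arr (fsrc F) \<Longrightarrow> g \<in> Arr (fsrc F) \<Longrightarrow> Dom (fsrc F) g = Cod (fsrc F) f
      \<Longrightarrow> g \<cdot>\<^bsub>fsrc F\<^esub> f \<in> Arr (fsrc F)"
    "\<And>f. f \<in> Arr (fsrc F) \<Longrightarrow> Dom (fsrc F) f \<in> Obj (fsrc F) \<and> Cod (fsrc F) f \<in> Obj (fsrc F)"
    "\<And>x. x \<in> Obj (fsrc F) \<Longrightarrow> idn (fsrc F) x \<in> Arr (fsrc F)"
    by (auto simp: category_def hom_def)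
  show ?thesis
    using assms unfolding is_functor_def fcomp_def Let_def
    by (auto simp: cl hom_def)
qed

lemma is_functor_fpair:
  assumes "is_functor F" "is_functor G" "fsrc G = fsrc F"
  shows "is_functor (fpair F G)"
proof -
  have c: "category (fsrc F)" using assms(1) by (simp add: is_functor_def Let_def)
  then have cl: "\<And>f g. f \<in> Arr (fsrc F) \<Longrightarrow> g \<in> Arr (fsrc F) \<Longrightarrow> Dom (fsrc F) g = Cod (fsrc F) f
      \<Longrightarrow> g \<cdot>\<^bsub>fsrc F\<^esub> f \<in> Arr (fsrc F)"
    "\<And>f. f \<in> Arr (fsrc F) \<Longrightarrow> Dom (fsrc F) f \<in> Obj (fsrc F) \<and> Cod (fsrc F) f \<in> Obj (fsrc F)"
    "\<And>x. x \<in> Obj (fsrc F) \<Longrightarrow> idn (fsrc F) x \<in> Arr (fsrc F)"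
    by (auto simp: category_def hom_def)
  show ?thesis
    using assms category_prod_cat[of "ftrg F" "ftrg G"] unfolding is_functor_def fpair_def Let_def
    by (auto simp: cl hom_def prod_cat_def)
qed

lemma term_map:
  assumes "finite_products K" "x \<in> Obj (ccat K)"
  shows "term_map K x \<in> hom (ccat K) x (one K)"
    "t \<in> hom (ccat K) x (one K) \<Longrightarrow> t = term_map K x"
proof -
  have ex: "\<exists>!t. t \<in> hom (ccat K) x (one K)"
    using assms by (simp add: finite_products_def Let_def)
  show a: "term_map K x \<in> hom (ccat K) x (one K)"
    unfolding term_map_def by (rule theI'[OF ex])
  show "t = term_map K x" if "t \<in> hom (ccat K) x (one K)"
    using ex a that by auto
qed

lemma pairing:
  assumes K: "finite_products K" and f: "f \<in> hom (ccat K) z x" and g: "g \<in> hom (ccat K) z y"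
  shows "pairing K f g \<in> hom (ccat K) z (prd K x y)"
    "pr1 K x y \<cdot>\<^bsub>ccat K\<^esub> pairing K f g = f" "pr2 K x y \<cdot>\<^bsub>ccat K\<^esub> pairing K f g = g"
    "\<And>h. h \<in> hom (ccat K) z (prd K x y) \<Longrightarrow> pr1 K x y \<cdot>\<^bsub>ccat K\<^esub> h = f \<Longrightarrow>
       pr2 K x y \<cdot>\<^bsub>ccat K\<^esub> h = g \<Longrightarrow> h = pairing K f g"
proof -
  have c: "category (ccat K)" using K by (simp add: finite_products_def Let_def)
  have o: "x \<in> Obj (ccat K)" "y \<in> Obj (ccat K)" "z \<in> Obj (ccat K)"
    using category_ids[OF c f] category_ids[OF c g] by auto
  have d: "Dom (ccat K) f = z" "Cod (ccat K) f = x" "Cod (ccat K) g = y"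
    using f g by (auto simp: hom_def)
  have ex: "\<exists>!h. h \<in> hom (ccat K) z (prd K x y) \<and> pr1 K x y \<cdot>\<^bsub>ccat K\<^esub> h = f
      \<and> pr2 K x y \<cdot>\<^bsub>ccat K\<^esub> h = g"
    using K o f g by (simp add: finite_products_def Let_def)
  have p: "pairing K f g \<in> hom (ccat K) z (prd K x y) \<and> pr1 K x y \<cdot>\<^bsub>ccat K\<^esub> pairing K f g = f
      \<and> pr2 K x y \<cdot>\<^bsub>ccat K\<^esub> pairing K f g = g"
    unfolding pairing_def Let_def d by (rule theI'[OF ex])
  then show "pairing K f g \<in> hom (ccat K) z (prd K x y)"
    "pr1 K x y \<cdot>\<^bsub>ccat K\<^esub> pairing K f g = f" "pr2 K x y \<cdot>\<^bsub>ccat K\<^esub> pairing K f g = g" by auto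
  show "h = pairing K f g" if "h \<in> hom (ccat K) z (prd K x y)" "pr1 K x y \<cdot>\<^bsub>ccat K\<^esub> h = f"
    "pr2 K x y \<cdot>\<^bsub>ccat K\<^esub> h = g" for h
    using ex p that by auto
qed

lemma prd_in:
  assumes K: "finite_products K" and "x \<in> Obj (ccat K)" "y \<in> Obj (ccat K)"
  shows "prd K x y \<in> Obj (ccat K)" "pr1 K x y \<in> hom (ccat K) (prd K x y) x"
    "pr2 K x y \<in> hom (ccat K) (prd K x y) y"
  using assms by (auto simp: finite_products_def Let_def)

lemma prd_ext:
  assumes K: "finite_products K" and "x \<in> Obj (ccat K)" "y \<in> Obj (ccat K)"
    and h: "h \<in> hom (ccat K) z (prd K x y)" and k: "k \<in> hom (ccat K) z (prd K x y)"
    and e: "pr1 K x y \<cdot>\<^bsub>ccat K\<^esub> h = pr1 K x y \<cdot>\<^bsub>ccat K\<^esub> k"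
       "pr2 K x y \<cdot>\<^bsub>ccat K\<^esub> h = pr2 K x y \<cdot>\<^bsub>ccat K\<^esub> k"
  shows "h = k"
proof -
  have c: "category (ccat K)" using K by (simp add: finite_products_def Let_def)
  note p = prd_in[OF K assms(2,3)]
  have "h = pairing K (pr1 K x y \<cdot>\<^bsub>ccat K\<^esub> k) (pr2 K x y \<cdot>\<^bsub>ccat K\<^esub> k)"
    by (rule pairing(4)[OF K category_homI[OF c k p(2)] category_homI[OF c k p(3)] h e])
  also have "\<dots> = k"
    by (rule pairing(4)[OF K category_homI[OF c k p(2)] category_homI[OF c k p(3)] k refl refl,
          symmetric])
  finally show ?thesis .
qed

lemma prodmap:
  assumes K: "finite_products K" and f: "f \<in> hom (ccat K) x x'" and g: "g \<in> hom (ccat K) y y'"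
  shows "prodmap K f g \<in> hom (ccat K) (prd K x y) (prd K x' y')"
    "pr1 K x' y' \<cdot>\<^bsub>ccat K\<^esub> prodmap K f g = f \<cdot>\<^bsub>ccat K\<^esub> pr1 K x y"
    "pr2 K x' y' \<cdot>\<^bsub>ccat K\<^esub> prodmap K f g = g \<cdot>\<^bsub>ccat K\<^esub> pr2 K x y"
proof -
  have c: "category (ccat K)" using K by (simp add: finite_products_def Let_def)
  have d: "Dom (ccat K) f = x" "Dom (ccat K) g = y" using f g by (auto simp: hom_def)
  note p = prd_in[OF K category_ids(1)[OF c f] category_ids(1)[OF c g]]
  show "prodmap K f g \<in> hom (ccat K) (prd K x y) (prd K x' y')"
    "pr1 K x' y' \<cdot>\<^bsub>ccat K\<^esub> prodmap K f g = f \<cdot>\<^bsub>ccat K\<^esub> pr1 K x y"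
    "pr2 K x' y' \<cdot>\<^bsub>ccat K\<^esub> prodmap K f g = g \<cdot>\<^bsub>ccat K\<^esub> pr2 K x y"
    unfolding prodmap_def Let_def d
    using pairing(1-3)[OF K category_homI[OF c p(2) f] category_homI[OF c p(3) g]] by auto
qed

locale cmo =
  fixes E :: "('x, 'u, 'b, 'f) opfib"
  assumes cmo: "cartesian_monoidal_opfibration E"
begin

abbreviation "X \<equiv> ccat (tot E)"
abbreviation "B \<equiv> ccat (base E)"
abbreviation "K \<equiv> tot E"
abbreviation "L \<equiv> base E"
abbreviation "PO \<equiv> fO (proj E)"
abbreviation "PA \<equiv> fA (proj E)"

lemma fpK: "finite_products K" and fpL: "finite_products L"
  using cmo by (auto simp: cartesian_monoidal_opfibration_def Let_def)

lemma catX: "category X" and catB: "category B"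
  using fpK fpL by (auto simp: finite_products_def Let_def)

lemma proj: "is_functor (proj E)" "fsrc (proj E) = X" "ftrg (proj E) = B"
  using cmo by (auto simp: cartesian_monoidal_opfibration_def Let_def cloven_opfibration_def)

lemma PA_hom: "u \<in> hom X x y \<Longrightarrow> PA u \<in> hom B (PO x) (PO y)"
  using proj by (auto simp: is_functor_def Let_def hom_def)

lemma PO_Obj: "x \<in> Obj X \<Longrightarrow> PO x \<in> Obj B"
  using proj by (auto simp: is_functor_def Let_def)

lemma PA_id: "x \<in> Obj X \<Longrightarrow> PA (idn X x) = idn B (PO x)"
  using proj by (auto simp: is_functor_def Let_def)

lemma PA_comp: "u \<in> hom X x y \<Longrightarrow> v \<in> hom X y z \<Longrightarrow> PA (v \<cdot>\<^bsub>X\<^esub> u) = PA v \<cdot>\<^bsub>B\<^esub> PA u"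
  using proj by (auto simp: is_functor_def Let_def hom_def)

lemma P_prod:
  assumes "x \<in> Obj X" "y \<in> Obj X"
  shows "PO (prd K x y) = prd L (PO x) (PO y)" "PA (pr1 K x y) = pr1 L (PO x) (PO y)"
    "PA (pr2 K x y) = pr2 L (PO x) (PO y)"
  using cmo assms by (auto simp: cartesian_monoidal_opfibration_def Let_def)

lemma P_one: "PO (one K) = one L"
  using cmo by (auto simp: cartesian_monoidal_opfibration_def Let_def)

lemma lift:
  assumes "f \<in> hom B A C" "x \<in> Obj X" "PO x = A"
  shows "cocartesian (proj E) (lift E f x)" "lift E f x \<in> hom X x (push E f x)"
    "PA (lift E f x) = f" "PO (push E f x) = C" "push E f x \<in> Obj X"
proof -
  show a: "cocartesian (proj E) (lift E f x)" and c: "PA (lift E f x) = f"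
    and b: "lift E f x \<in> hom X x (push E f x)"
    using cmo assms proj
    by (auto simp: cartesian_monoidal_opfibration_def Let_def cloven_opfibration_def hom_def
        push_def cocartesian_def)
  show "PO (push E f x) = C" using PA_hom[OF b] c assms(1) by (auto simp: hom_def)
  show "push E f x \<in> Obj X" using category_ids[OF catX b] by simp
qed

lemma cocart_UP:
  assumes "cocartesian (proj E) c" "c \<in> hom X x y" "g \<in> hom X x z" "v \<in> hom B (PO y) (PO z)"
    "PA g = v \<cdot>\<^bsub>B\<^esub> PA c"
  shows "\<exists>!h. h \<in> hom X y z \<and> PA h = v \<and> h \<cdot>\<^bsub>X\<^esub> c = g"
proof -
  have d: "g \<in> Arr X" "Cod X c = y" "Dom X c = x" "Cod X g = z" "Dom X g = x"
    using assms by (auto simp: hom_def)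
  have "\<forall>g \<in> Arr X. \<forall>v \<in> hom B (PO (Cod X c)) (PO (Cod X g)).
        Dom X g = Dom X c \<longrightarrow> PA g = v \<cdot>\<^bsub>B\<^esub> PA c \<longrightarrow>
        (\<exists>!h. h \<in> hom X (Cod X c) (Cod X g) \<and> PA h = v \<and> h \<cdot>\<^bsub>X\<^esub> c = g)"
    using assms(1) by (simp add: cocartesian_def Let_def proj)
  from this[rule_format, of g v] show ?thesis using assms(4,5) d by simp
qed

lemma cocart_cancel:
  assumes c: "cocartesian (proj E) c" "c \<in> hom X x y" and w: "w \<in> hom X y z" "w' \<in> hom X y z"
    and "PA w = PA w'" "w \<cdot>\<^bsub>X\<^esub> c = w' \<cdot>\<^bsub>X\<^esub> c"
  shows "w = w'"
proof -
  have g: "w \<cdot>\<^bsub>X\<^esub> c \<in> hom X x z" by (rule category_homI[OF catX c(2) w(1)])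
  show ?thesis
    using cocart_UP[OF c g PA_hom[OF w(1)] PA_comp[OF c(2) w(1)]] assms by metis
qed

lemma vfactor:
  assumes c: "cocartesian (proj E) c" "c \<in> hom X x y" and g: "g \<in> hom X x z" "PA g = PA c"
  shows "vfactor E c g \<in> hom X y z" "PA (vfactor E c g) = idn B (PO z)"
    "vfactor E c g \<cdot>\<^bsub>X\<^esub> c = g" "PO y = PO z"
proof -
  show e: "PO y = PO z" using PA_hom[OF c(2)] PA_hom[OF g(1)] g(2) by (auto simp: hom_def)
  have i: "idn B (PO z) \<in> hom B (PO y) (PO z)" "PA g = idn B (PO z) \<cdot>\<^bsub>B\<^esub> PA c"
    using category_ids[OF catB PA_hom[OF g(1)]] e g(2) by auto
  have cd: "Cod X c = y" "Cod X g = z" using c g by (auto simp: hom_def)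
  have ex: "\<exists>!h. h \<in> hom X y z \<and> PA h = idn B (PO z) \<and> h \<cdot>\<^bsub>X\<^esub> c = g"
    by (rule cocart_UP[OF c g(1) i])
  have "vfactor E c g \<in> hom X y z \<and> PA (vfactor E c g) = idn B (PO z) \<and> vfactor E c g \<cdot>\<^bsub>X\<^esub> c = g"
    unfolding vfactor_def cd by (rule theI'[OF ex])
  then show "vfactor E c g \<in> hom X y z" "PA (vfactor E c g) = idn B (PO z)"
    "vfactor E c g \<cdot>\<^bsub>X\<^esub> c = g" by auto
qed

lemma fib_Obj: "x \<in> Obj (fibre E A) \<longleftrightarrow> x \<in> Obj X \<and> PO x = A"
  by (simp add: fibre_def)

lemma fib_hom: "u \<in> hom (fibre E A) x y \<longleftrightarrow>
    u \<in> hom X x y \<and> PO x = A \<and> PO y = A \<and> PA u = idn B A"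
  by (auto simp: fibre_def hom_def)

lemma fib_Arr: "u \<in> Arr (fibre E A) \<longleftrightarrow> u \<in> hom (fibre E A) (Dom X u) (Cod X u)"
  by (auto simp: fibre_def hom_def)

lemma fib_simps [simp]: "Dom (fibre E A) = Dom X" "Cod (fibre E A) = Cod X"
    "idn (fibre E A) = idn X" "Comp (fibre E A) = Comp X"
  by (auto simp: fibre_def)

lemma cat_fibre: "category (fibre E A)"
proof -
  have 1: "v \<cdot>\<^bsub>X\<^esub> u \<in> hom (fibre E A) x z" if "u \<in> hom (fibre E A) x y" "v \<in> hom (fibre E A) y z"
    for u v x y z
  proof -
    have "idn B A \<cdot>\<^bsub>B\<^esub> idn B A = idn B A"
      using that PA_hom[of u x y] category_ids[OF catB, of "PA u" A A] by (auto simp: fib_hom)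
    then show ?thesis
      using that PA_comp[of u x y v z] category_homI[OF catX, of u x y v z] by (auto simp: fib_hom)
  qed
  show ?thesis
    unfolding category_def fib_simps
  proof (intro conjI ballI impI)
    fix f assume f: "f \<in> Arr (fibre E A)"
    then have h: "f \<in> hom (fibre E A) (Dom X f) (Cod X f)" by (simp add: fib_Arr)
    then have hX: "f \<in> hom X (Dom X f) (Cod X f)" by (simp add: fib_hom)
    show "Dom X f \<in> Obj (fibre E A)" "Cod X f \<in> Obj (fibre E A)"
      "f \<cdot>\<^bsub>X\<^esub> idn X (Dom X f) = f" "idn X (Cod X f) \<cdot>\<^bsub>X\<^esub> f = f"
      using h category_ids[OF catX hX] by (auto simp: fib_hom fib_Obj)
    fix g assume g: "g \<in> Arr (fibre E A)" and gf: "Dom X g = Cod X f"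
    then have hg: "g \<in> hom (fibre E A) (Cod X f) (Cod X g)" by (simp add: fib_Arr)
    show "g \<cdot>\<^bsub>X\<^esub> f \<in> hom (fibre E A) (Dom X f) (Cod X g)" by (rule 1[OF h hg])
    fix k assume k: "k \<in> Arr (fibre E A)" and kg: "Dom X k = Cod X g"
    then have hk: "k \<in> hom (fibre E A) (Cod X g) (Cod X k)" by (simp add: fib_Arr)
    show "k \<cdot>\<^bsub>X\<^esub> (g \<cdot>\<^bsub>X\<^esub> f) = (k \<cdot>\<^bsub>X\<^esub> g) \<cdot>\<^bsub>X\<^esub> f"
      using category_assoc[OF catX, of f "Dom X f" "Cod X f" g "Cod X g" k "Cod X k"] h hg hk
      by (simp add: fib_hom)
  next
    fix x assume x: "x \<in> Obj (fibre E A)"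
    then have "idn X x \<in> hom X x x" using category_idI[OF catX] by (simp add: fib_Obj)
    then show "idn X x \<in> hom (fibre E A) x x"
      using x PA_id[of x] by (auto simp: fib_hom fib_Obj)
  qed
qed

lemma chg_arr:
  assumes f: "f \<in> hom B A C" and u: "u \<in> hom (fibre E A) x y"
  shows "fA (change_base E f) u \<in> hom (fibre E C) (push E f x) (push E f y)"
    "fA (change_base E f) u \<cdot>\<^bsub>X\<^esub> lift E f x = lift E f y \<cdot>\<^bsub>X\<^esub> u"
proof -
  have u': "u \<in> hom X x y" "PO x = A" "PO y = A" "PA u = idn B A" using u by (auto simp: fib_hom)
  have o: "x \<in> Obj X" "y \<in> Obj X" using category_ids[OF catX u'(1)] by auto
  note lx = lift[OF f o(1) u'(2)] and ly = lift[OF f o(2) u'(3)]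
  have d: "Dom X u = x" "Cod X u = y" using u' by (auto simp: hom_def)
  have g: "lift E f y \<cdot>\<^bsub>X\<^esub> u \<in> hom X x (push E f y)" by (rule category_homI[OF catX u'(1) ly(2)])
  have pg: "PA (lift E f y \<cdot>\<^bsub>X\<^esub> u) = PA (lift E f x)"
    using PA_comp[OF u'(1) ly(2)] ly(3) lx(3) u'(4) category_ids[OF catB f] by simp
  have a: "u \<in> Arr (fibre E (Dom B f))" using u f d by (auto simp: hom_def)
  have e: "fA (change_base E f) u = vfactor E (lift E f x) (lift E f y \<cdot>\<^bsub>X\<^esub> u)"
    using a d by (simp add: change_base_def Let_def)
  show "fA (change_base E f) u \<in> hom (fibre E C) (push E f x) (push E f y)"
    "fA (change_base E f) u \<cdot>\<^bsub>X\<^esub> lift E f x = lift E f y \<cdot>\<^bsub>X\<^esub> u"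
    unfolding e using vfactor[OF lx(1,2) g pg] lx(4) ly(4) by (auto simp: fib_hom)
qed

lemma chg_simps:
  assumes f: "f \<in> hom B A C"
  shows "fsrc (change_base E f) = fibre E A" "ftrg (change_base E f) = fibre E C"
    "x \<in> Obj (fibre E A) \<Longrightarrow> fO (change_base E f) x = push E f x"
  using f by (auto simp: change_base_def Let_def hom_def)

lemma functor_chg:
  assumes f: "f \<in> hom B A C"
  shows "is_functor (change_base E f)"
  unfolding is_functor_def Let_def chg_simps(1,2)[OF f] fib_simps
proof (intro conjI ballI impI cat_fibre)
  show "fO (change_base E f) \<in> extensional (Obj (fibre E A))"
    "fA (change_base E f) \<in> extensional (Arr (fibre E A))"
    using f by (auto simp: change_base_def Let_def hom_def)
next
  fix x assume x: "x \<in> Obj (fibre E A)"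
  then have x': "x \<in> Obj X" "PO x = A" by (auto simp: fib_Obj)
  note l = lift[OF f x']
  show "fO (change_base E f) x \<in> Obj (fibre E C)"
    using l by (simp add: chg_simps(3)[OF f x] fib_Obj)
  have i: "idn X x \<in> hom (fibre E A) x x"
    using category_idI[OF cat_fibre x] by simp
  note c = chg_arr[OF f i]
  have ip: "idn X (push E f x) \<in> hom X (push E f x) (push E f x)"
    using category_ids[OF catX l(2)] by simp
  have "fA (change_base E f) (idn X x) = idn X (push E f x)"
  proof (rule cocart_cancel[OF l(1,2) _ ip])
    show "fA (change_base E f) (idn X x) \<in> hom X (push E f x) (push E f x)"
      using c(1) by (simp add: fib_hom)
    show "PA (fA (change_base E f) (idn X x)) = PA (idn X (push E f x))"
      using c(1) PA_id[OF l(5)] l(4) by (simp add: fib_hom)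
    show "fA (change_base E f) (idn X x) \<cdot>\<^bsub>X\<^esub> lift E f x = idn X (push E f x) \<cdot>\<^bsub>X\<^esub> lift E f x"
      using c(2) category_ids[OF catX l(2)] by simp
  qed
  then show "fA (change_base E f) (idn X x) = idn X (fO (change_base E f) x)"
    by (simp add: chg_simps[OF f] x)
next
  fix u assume "u \<in> Arr (fibre E A)"
  then have u: "u \<in> hom (fibre E A) (Dom X u) (Cod X u)" by (simp add: fib_Arr)
  have o: "Dom X u \<in> Obj (fibre E A)" "Cod X u \<in> Obj (fibre E A)"
    using category_ids[OF cat_fibre u] by auto
  show "fA (change_base E f) u
      \<in> hom (fibre E C) (fO (change_base E f) (Dom X u)) (fO (change_base E f) (Cod X u))"
    using chg_arr(1)[OF f u] by (simp add: chg_simps[OF f] o)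
  fix v assume "v \<in> Arr (fibre E A)" and "Dom X v = Cod X u"
  then have v: "v \<in> hom (fibre E A) (Cod X u) (Cod X v)" by (simp add: fib_Arr)
  define x y z where xyz: "x = Dom X u" "y = Cod X u" "z = Cod X v"
  have u: "u \<in> hom (fibre E A) x y" and v: "v \<in> hom (fibre E A) y z" using u v xyz by auto
  have vu: "v \<cdot>\<^bsub>X\<^esub> u \<in> hom (fibre E A) x z" using category_homI[OF cat_fibre u v] by simp
  have o: "x \<in> Obj X" "PO x = A" "y \<in> Obj X" "PO y = A" "z \<in> Obj X" "PO z = A"
    using category_ids[OF cat_fibre u] category_ids[OF cat_fibre v] by (auto simp: fib_Obj)
  note lx = lift[OF f o(1,2)] and ly = lift[OF f o(3,4)] and lz = lift[OF f o(5,6)]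
  note cu = chg_arr[OF f u] and cv = chg_arr[OF f v] and cvu = chg_arr[OF f vu]
  have comp: "fA (change_base E f) v \<cdot>\<^bsub>X\<^esub> fA (change_base E f) u
      \<in> hom (fibre E C) (push E f x) (push E f z)"
    using category_homI[OF cat_fibre cu(1) cv(1)] by simp
  have X: "u \<in> hom X x y" "v \<in> hom X y z"
    "fA (change_base E f) u \<in> hom X (push E f x) (push E f y)"
    "fA (change_base E f) v \<in> hom X (push E f y) (push E f z)"
    using u v cu cv by (auto simp: fib_hom)
  show "fA (change_base E f) (v \<cdot>\<^bsub>X\<^esub> u) = fA (change_base E f) v \<cdot>\<^bsub>X\<^esub> fA (change_base E f) u"
  proof (rule cocart_cancel[OF lx(1,2)])
    show "fA (change_base E f) (v \<cdot>\<^bsub>X\<^esub> u) \<in> hom X (push E f x) (push E f z)"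
      "fA (change_base E f) v \<cdot>\<^bsub>X\<^esub> fA (change_base E f) u \<in> hom X (push E f x) (push E f z)"
      "PA (fA (change_base E f) (v \<cdot>\<^bsub>X\<^esub> u)) =
        PA (fA (change_base E f) v \<cdot>\<^bsub>X\<^esub> fA (change_base E f) u)"
      using cvu(1) comp by (auto simp: fib_hom)
    show "fA (change_base E f) (v \<cdot>\<^bsub>X\<^esub> u) \<cdot>\<^bsub>X\<^esub> lift E f x =
      (fA (change_base E f) v \<cdot>\<^bsub>X\<^esub> fA (change_base E f) u) \<cdot>\<^bsub>X\<^esub> lift E f x"
      using category_assoc[OF catX lx(2) X(3) X(4)] cu(2) cv(2) cvu(2)
        category_assoc[OF catX X(1) ly(2) X(4)] category_assoc[OF catX X(1) X(2) lz(2)]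
      by simp
  qed
qed

lemma cocartI:
  assumes "c \<in> hom X x y"
    and "\<And>z g v. g \<in> hom X x z \<Longrightarrow> v \<in> hom B (PO y) (PO z) \<Longrightarrow> PA g = v \<cdot>\<^bsub>B\<^esub> PA c \<Longrightarrow>
      \<exists>!h. h \<in> hom X y z \<and> PA h = v \<and> h \<cdot>\<^bsub>X\<^esub> c = g"
  shows "cocartesian (proj E) c"
  unfolding cocartesian_def Let_def proj
proof (intro conjI ballI impI)
  show "c \<in> Arr X" using assms(1) by (simp add: hom_def)
  fix g v assume "g \<in> Arr X" "v \<in> hom B (PO (Cod X c)) (PO (Cod X g))" "Dom X g = Dom X c"
    "PA g = v \<cdot>\<^bsub>B\<^esub> PA c"
  then show "\<exists>!h. h \<in> hom X (Cod X c) (Cod X g) \<and> PA h = v \<and> h \<cdot>\<^bsub>X\<^esub> c = g"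
    using assms(2)[of g "Cod X g" v] assms(1) by (simp add: hom_def)
qed

lemma cocart_comp:
  assumes c: "cocartesian (proj E) c" "c \<in> hom X x y" and d: "cocartesian (proj E) d" "d \<in> hom X y z"
  shows "cocartesian (proj E) (d \<cdot>\<^bsub>X\<^esub> c)" "d \<cdot>\<^bsub>X\<^esub> c \<in> hom X x z"
proof -
  show dc: "d \<cdot>\<^bsub>X\<^esub> c \<in> hom X x z" by (rule category_homI[OF catX c(2) d(2)])
  show "cocartesian (proj E) (d \<cdot>\<^bsub>X\<^esub> c)"
  proof (rule cocartI[OF dc])
    fix w g v
    assume g: "g \<in> hom X x w" and v: "v \<in> hom B (PO z) (PO w)"
      and e: "PA g = v \<cdot>\<^bsub>B\<^esub> PA (d \<cdot>\<^bsub>X\<^esub> c)"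
    have vd: "v \<cdot>\<^bsub>B\<^esub> PA d \<in> hom B (PO y) (PO w)" by (rule category_homI[OF catB PA_hom[OF d(2)] v])
    have e': "PA g = (v \<cdot>\<^bsub>B\<^esub> PA d) \<cdot>\<^bsub>B\<^esub> PA c"
      using e PA_comp[OF c(2) d(2)] category_assoc[OF catB PA_hom[OF c(2)] PA_hom[OF d(2)] v] by simp
    from cocart_UP[OF c g vd e'] obtain k where k: "k \<in> hom X y w" "PA k = v \<cdot>\<^bsub>B\<^esub> PA d" "k \<cdot>\<^bsub>X\<^esub> c = g"
      by blast
    from cocart_UP[OF d k(1) v k(2)] obtain h where h: "h \<in> hom X z w" "PA h = v" "h \<cdot>\<^bsub>X\<^esub> d = k"
      by blast
    show "\<exists>!h. h \<in> hom X z w \<and> PA h = v \<and> h \<cdot>\<^bsub>X\<^esub> (d \<cdot>\<^bsub>X\<^esub> c) = g"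
    proof (rule ex1I[of _ h])
      show "h \<in> hom X z w \<and> PA h = v \<and> h \<cdot>\<^bsub>X\<^esub> (d \<cdot>\<^bsub>X\<^esub> c) = g"
        using h k category_assoc[OF catX c(2) d(2) h(1)] by simp
      fix h' assume h': "h' \<in> hom X z w \<and> PA h' = v \<and> h' \<cdot>\<^bsub>X\<^esub> (d \<cdot>\<^bsub>X\<^esub> c) = g"
      then have a: "h' \<in> hom X z w" by simp
      have "h' \<cdot>\<^bsub>X\<^esub> d = k"
        by (rule cocart_cancel[OF c category_homI[OF catX d(2) a] k(1)])
          (use h' k category_assoc[OF catX c(2) d(2) a] PA_comp[OF d(2) a] in simp_all)
      then show "h' = h"
        using cocart_cancel[OF d a h(1)] h' h by simp
    qed
  qed
qed

lemma cocart_id: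
  assumes "x \<in> Obj X"
  shows "cocartesian (proj E) (idn X x)"
proof (rule cocartI[OF category_idI[OF catX assms]])
  fix z g v assume g: "g \<in> hom X x z" and v: "v \<in> hom B (PO x) (PO z)" "PA g = v \<cdot>\<^bsub>B\<^esub> PA (idn X x)"
  have "PA g = v" using v PA_id[OF assms] category_ids(5)[OF catB v(1)] by simp
  then show "\<exists>!h. h \<in> hom X x z \<and> PA h = v \<and> h \<cdot>\<^bsub>X\<^esub> idn X x = g"
    using g category_ids(5)[OF catX] by metis
qed

lemma vfactor_iso:
  assumes c: "cocartesian (proj E) c" "c \<in> hom X x y" and d: "cocartesian (proj E) d" "d \<in> hom X x z"
    and e: "PA d = PA c"
  shows "iso (fibre E (PO y)) (vfactor E c d)"
proof -
  note v = vfactor[OF c d(2) e] and w = vfactor[OF d c(2) e[symmetric]]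
  have vf: "vfactor E c d \<in> hom (fibre E (PO y)) y z" and wf: "vfactor E d c \<in> hom (fibre E (PO y)) z y"
    using v w(1-3) by (simp_all add: fib_hom)
  have o: "y \<in> Obj X" "z \<in> Obj X" using category_ids[OF catX v(1)] by auto
  have 1: "vfactor E d c \<cdot>\<^bsub>X\<^esub> vfactor E c d = idn X y"
  proof (rule cocart_cancel[OF c category_homI[OF catX v(1) w(1)] category_idI[OF catX o(1)]])
    show "PA (vfactor E d c \<cdot>\<^bsub>X\<^esub> vfactor E c d) = PA (idn X y)"
      using category_homI[OF cat_fibre vf wf] PA_id[OF o(1)] by (simp add: fib_hom)
    show "(vfactor E d c \<cdot>\<^bsub>X\<^esub> vfactor E c d) \<cdot>\<^bsub>X\<^esub> c = idn X y \<cdot>\<^bsub>X\<^esub> c"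
      using category_assoc[OF catX c(2) v(1) w(1)] v(3) w(3) category_ids(6)[OF catX c(2)] by simp
  qed
  have 2: "vfactor E c d \<cdot>\<^bsub>X\<^esub> vfactor E d c = idn X z"
  proof (rule cocart_cancel[OF d category_homI[OF catX w(1) v(1)] category_idI[OF catX o(2)]])
    show "PA (vfactor E c d \<cdot>\<^bsub>X\<^esub> vfactor E d c) = PA (idn X z)"
      using category_homI[OF cat_fibre wf vf] PA_id[OF o(2)] v(4) by (simp add: fib_hom)
    show "(vfactor E c d \<cdot>\<^bsub>X\<^esub> vfactor E d c) \<cdot>\<^bsub>X\<^esub> d = idn X z \<cdot>\<^bsub>X\<^esub> d"
      using category_assoc[OF catX d(2) w(1) v(1)] v(3) w(3) category_ids(6)[OF catX d(2)] by simp
  qed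
  have "Dom X (vfactor E c d) = y" "Cod X (vfactor E c d) = z" using v by (auto simp: hom_def)
  moreover have "vfactor E c d \<in> Arr (fibre E (PO y))" using vf by (simp add: hom_def)
  ultimately show ?thesis using wf 1 2 unfolding iso_def fib_simps by auto
qed

lemma fcomp_fid:
  assumes "is_functor F"
  shows "F \<bullet> fid (fsrc F) = F" "fid (ftrg F) \<bullet> F = F"
  using assms by (cases F; auto simp: fcomp_def fid_def is_functor_def Let_def hom_def
      extensional_def fun_eq_iff)+

lemma fcomp_assoc:
  assumes "is_functor F" "ftrg F = fsrc G"
  shows "(H \<bullet> G) \<bullet> F = H \<bullet> (G \<bullet> F)"
  using assms by (auto simp: fcomp_def is_functor_def Let_def hom_def fun_eq_iff)

lemma niso_inv_cell:
  assumes t: "is_niso t"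
  shows "inv_cell2 CAT (nsrc t) (ntrg t) t"
proof -
  let ?F = "nsrc t" and ?G = "ntrg t"
  let ?C = "fsrc ?F" and ?D = "ftrg ?F"
  have n: "is_ntrans t" and i: "\<And>x. x \<in> Obj ?C \<Longrightarrow> iso ?D (nc t x)"
    using t by (auto simp: is_niso_def)
  have F: "is_functor ?F" "is_functor ?G" "fsrc ?G = ?C" "ftrg ?G = ?D"
    and ext: "nc t \<in> extensional (Obj ?C)"
    and h: "\<And>x. x \<in> Obj ?C \<Longrightarrow> nc t x \<in> hom ?D (fO ?F x) (fO ?G x)"
    and nat: "\<And>f. f \<in> Arr ?C \<Longrightarrow> nc t (Cod ?C f) \<cdot>\<^bsub>?D\<^esub> fA ?F f = fA ?G f \<cdot>\<^bsub>?D\<^esub> nc t (Dom ?C f)"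
    using n by (simp_all add: is_ntrans_def Let_def)
  have C: "category ?C" and D: "category ?D" using F by (auto simp: is_functor_def Let_def)
  have Fh: "\<And>f. f \<in> Arr ?C \<Longrightarrow> fA ?F f \<in> hom ?D (fO ?F (Dom ?C f)) (fO ?F (Cod ?C f))"
    and Gh: "\<And>f. f \<in> Arr ?C \<Longrightarrow> fA ?G f \<in> hom ?D (fO ?G (Dom ?C f)) (fO ?G (Cod ?C f))"
    using F by (auto simp: is_functor_def Let_def)
  have dc: "\<And>f. f \<in> Arr ?C \<Longrightarrow> Dom ?C f \<in> Obj ?C" "\<And>f. f \<in> Arr ?C \<Longrightarrow> Cod ?C f \<in> Obj ?C"
    using C by (auto simp: category_def)
  have "\<exists>g. g \<in> hom ?D (fO ?G x) (fO ?F x) \<and> g \<cdot>\<^bsub>?D\<^esub> nc t x = idn ?D (fO ?F x) \<and>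
      nc t x \<cdot>\<^bsub>?D\<^esub> g = idn ?D (fO ?G x)" if "x \<in> Obj ?C" for x
    using i[OF that] h[OF that] by (auto simp: iso_def hom_def)
  then obtain r where r: "\<And>x. x \<in> Obj ?C \<Longrightarrow> r x \<in> hom ?D (fO ?G x) (fO ?F x)"
      "\<And>x. x \<in> Obj ?C \<Longrightarrow> r x \<cdot>\<^bsub>?D\<^esub> nc t x = idn ?D (fO ?F x)"
      "\<And>x. x \<in> Obj ?C \<Longrightarrow> nc t x \<cdot>\<^bsub>?D\<^esub> r x = idn ?D (fO ?G x)"
    by metis
  define s where "s = \<lparr>nsrc = ?G, ntrg = ?F, nc = (\<lambda>x \<in> Obj ?C. r x)\<rparr>"
  have "r (Cod ?C f) \<cdot>\<^bsub>?D\<^esub> fA ?G f = fA ?F f \<cdot>\<^bsub>?D\<^esub> r (Dom ?C f)" if f: "f \<in> Arr ?C" for f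
  proof -
    note d = dc(1)[OF f] and c = dc(2)[OF f]
    have "r (Cod ?C f) \<cdot>\<^bsub>?D\<^esub> fA ?G f = r (Cod ?C f) \<cdot>\<^bsub>?D\<^esub> (fA ?G f \<cdot>\<^bsub>?D\<^esub> (nc t (Dom ?C f) \<cdot>\<^bsub>?D\<^esub> r (Dom ?C f)))"
      using r(3)[OF d] category_ids(5)[OF D Gh[OF f]] by simp
    also have "\<dots> = r (Cod ?C f) \<cdot>\<^bsub>?D\<^esub> ((nc t (Cod ?C f) \<cdot>\<^bsub>?D\<^esub> fA ?F f) \<cdot>\<^bsub>?D\<^esub> r (Dom ?C f))"
      using category_assoc[OF D r(1)[OF d] h[OF d] Gh[OF f]] nat[OF f] by simp
    also have "\<dots> = r (Cod ?C f) \<cdot>\<^bsub>?D\<^esub> (nc t (Cod ?C f) \<cdot>\<^bsub>?D\<^esub> (fA ?F f \<cdot>\<^bsub>?D\<^esub> r (Dom ?C f)))"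
      using category_assoc[OF D r(1)[OF d] Fh[OF f] h[OF c]] by simp
    also have "\<dots> = (r (Cod ?C f) \<cdot>\<^bsub>?D\<^esub> nc t (Cod ?C f)) \<cdot>\<^bsub>?D\<^esub> (fA ?F f \<cdot>\<^bsub>?D\<^esub> r (Dom ?C f))"
      using category_assoc[OF D category_homI[OF D r(1)[OF d] Fh[OF f]] h[OF c] r(1)[OF c]] by simp
    also have "\<dots> = fA ?F f \<cdot>\<^bsub>?D\<^esub> r (Dom ?C f)"
      using r(2)[OF c] category_ids(6)[OF D category_homI[OF D r(1)[OF d] Fh[OF f]]] by simp
    finally show ?thesis .
  qed
  then have sn: "is_ntrans s"
    using F r(1) dc by (simp add: is_ntrans_def Let_def s_def)
  have "nvcomp s t = nid ?F" "nvcomp t s = nid ?G"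
    using r F by (auto simp: nvcomp_def nid_def s_def fun_eq_iff)
  then show ?thesis
    using n sn by (auto simp: inv_cell2_def CAT_def s_def intro!: bexI[of _ s])
qed

lemma unitor:
  assumes A: "A \<in> Obj B"
  shows "is_niso (psI (assoc_pseudofunctor E) A)"
proof -
  let ?i = "idn B A"
  have i: "?i \<in> hom B A A" by (rule category_idI[OF catB A])
  have t: "nsrc (psI (assoc_pseudofunctor E) A) = fid (fibre E A)"
    "ntrg (psI (assoc_pseudofunctor E) A) = change_base E ?i"
    "nc (psI (assoc_pseudofunctor E) A) = (\<lambda>x \<in> Obj (fibre E A). lift E ?i x)"
    by (simp_all add: assoc_pseudofunctor_def)
  have fs: "fsrc (fid c) = c" "ftrg (fid c) = c" for c :: "('x, 'u) cat" by (simp_all add: fid_def)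
  have l: "lift E ?i x \<in> hom (fibre E A) x (push E ?i x) \<and> iso (fibre E A) (lift E ?i x)"
    if "x \<in> Obj (fibre E A)" for x
  proof -
    have x: "x \<in> Obj X" "PO x = A" using that by (auto simp: fib_Obj)
    note l = lift[OF i x]
    have c: "idn X x \<in> hom X x x" by (rule category_idI[OF catX x(1)])
    have e: "PA (lift E ?i x) = PA (idn X x)" using l(3) PA_id[OF x(1)] x(2) by simp
    note v = vfactor[OF cocart_id[OF x(1)] c l(2) e]
    have "vfactor E (idn X x) (lift E ?i x) = lift E ?i x"
      using category_ids(5)[OF catX v(1)] v(3) by simp
    then show ?thesis
      using vfactor_iso[OF cocart_id[OF x(1)] c l(1,2) e] l x by (simp add: fib_hom)
  qed
  show ?thesis
    unfolding is_niso_def is_ntrans_def Let_def t fs fib_simps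
  proof (intro conjI ballI functor_chg[OF i] chg_simps(1,2)[OF i] is_functor_fid cat_fibre)
    show "(\<lambda>x \<in> Obj (fibre E A). lift E ?i x) \<in> extensional (Obj (fibre E A))" by simp
  next
    fix x assume x: "x \<in> Obj (fibre E A)"
    show "iso (fibre E A) ((\<lambda>x \<in> Obj (fibre E A). lift E ?i x) x)"
      "(\<lambda>x \<in> Obj (fibre E A). lift E ?i x) x
        \<in> hom (fibre E A) (fO (fid (fibre E A)) x) (fO (change_base E ?i) x)"
      using l[OF x] x chg_simps(3)[OF i x] by (simp_all add: fid_def)
  next
    fix u assume a: "u \<in> Arr (fibre E A)"
    then have u: "u \<in> hom (fibre E A) (Dom X u) (Cod X u)" by (simp add: fib_Arr)
    show "(\<lambda>x \<in> Obj (fibre E A). lift E ?i x) (Cod X u) \<cdot>\<^bsub>X\<^esub> fA (fid (fibre E A)) u =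
       fA (change_base E ?i) u \<cdot>\<^bsub>X\<^esub> (\<lambda>x \<in> Obj (fibre E A). lift E ?i x) (Dom X u)"
      using chg_arr(2)[OF i u] category_ids(1,2)[OF cat_fibre u] a by (simp add: fid_def)
  qed
qed

lemma compositor_arr:
  assumes f: "f \<in> hom B A C" and g: "g \<in> hom B C D" and x: "x \<in> Obj (fibre E A)"
  shows "nc (psC (assoc_pseudofunctor E) g f) x
      \<in> hom (fibre E D) (push E g (push E f x)) (push E (g \<cdot>\<^bsub>B\<^esub> f) x)"
    "nc (psC (assoc_pseudofunctor E) g f) x \<cdot>\<^bsub>X\<^esub> (lift E g (push E f x) \<cdot>\<^bsub>X\<^esub> lift E f x) =
      lift E (g \<cdot>\<^bsub>B\<^esub> f) x"
    "iso (fibre E D) (nc (psC (assoc_pseudofunctor E) g f) x)"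
    "cocartesian (proj E) (lift E g (push E f x) \<cdot>\<^bsub>X\<^esub> lift E f x)"
    "lift E g (push E f x) \<cdot>\<^bsub>X\<^esub> lift E f x \<in> hom X x (push E g (push E f x))"
    "push E f x \<in> Obj (fibre E C)"
proof -
  have x': "x \<in> Obj X" "PO x = A" using x by (auto simp: fib_Obj)
  have gf: "g \<cdot>\<^bsub>B\<^esub> f \<in> hom B A D" by (rule category_homI[OF catB f g])
  note lf = lift[OF f x'] and lgf = lift[OF gf x']
  note lg = lift[OF g lf(5,4)]
  note c = cocart_comp[OF lf(1,2) lg(1,2)]
  have e: "PA (lift E (g \<cdot>\<^bsub>B\<^esub> f) x) = PA (lift E g (push E f x) \<cdot>\<^bsub>X\<^esub> lift E f x)"
    using lgf(3) lg(3) lf(3) PA_comp[OF lf(2) lg(2)] by simp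
  note v = vfactor[OF c lgf(2) e]
  have n: "nc (psC (assoc_pseudofunctor E) g f) x =
      vfactor E (lift E g (push E f x) \<cdot>\<^bsub>X\<^esub> lift E f x) (lift E (g \<cdot>\<^bsub>B\<^esub> f) x)"
    using x f by (simp add: assoc_pseudofunctor_def hom_def)
  show "nc (psC (assoc_pseudofunctor E) g f) x
      \<in> hom (fibre E D) (push E g (push E f x)) (push E (g \<cdot>\<^bsub>B\<^esub> f) x)"
    "nc (psC (assoc_pseudofunctor E) g f) x \<cdot>\<^bsub>X\<^esub> (lift E g (push E f x) \<cdot>\<^bsub>X\<^esub> lift E f x) =
      lift E (g \<cdot>\<^bsub>B\<^esub> f) x"
    unfolding n using v(1-3) lg(4) lgf(4) by (simp_all add: fib_hom)
  show "iso (fibre E D) (nc (psC (assoc_pseudofunctor E) g f) x)"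
    unfolding n using vfactor_iso[OF c lgf(1,2) e] lg(4) by simp
  show "cocartesian (proj E) (lift E g (push E f x) \<cdot>\<^bsub>X\<^esub> lift E f x)"
    "lift E g (push E f x) \<cdot>\<^bsub>X\<^esub> lift E f x \<in> hom X x (push E g (push E f x))" by (fact c)+
  show "push E f x \<in> Obj (fibre E C)" using lf by (simp add: fib_Obj)
qed

lemma compositor:
  assumes f: "f \<in> hom B A C" and g: "g \<in> hom B C D"
  shows "is_niso (psC (assoc_pseudofunctor E) g f)"
proof -
  let ?t = "psC (assoc_pseudofunctor E) g f"
  have gf: "g \<cdot>\<^bsub>B\<^esub> f \<in> hom B A D" by (rule category_homI[OF catB f g])
  have t: "nsrc ?t = change_base E g \<bullet> change_base E f" "ntrg ?t = change_base E (g \<cdot>\<^bsub>B\<^esub> f)"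
    by (simp_all add: assoc_pseudofunctor_def)
  have s: "fsrc (change_base E g \<bullet> change_base E f) = fibre E A"
    "ftrg (change_base E g \<bullet> change_base E f) = fibre E D"
    by (simp_all add: fcomp_def chg_simps(1,2)[OF f] chg_simps(1,2)[OF g])
  show ?thesis
    unfolding is_niso_def is_ntrans_def Let_def t s fib_simps
  proof (intro conjI ballI functor_chg[OF gf] chg_simps(1,2)[OF gf])
    show "is_functor (change_base E g \<bullet> change_base E f)"
      by (rule is_functor_fcomp[OF functor_chg[OF f] functor_chg[OF g]])
        (simp add: chg_simps(1,2)[OF f] chg_simps(1,2)[OF g])
    show "nc ?t \<in> extensional (Obj (fibre E A))"
      using f by (simp add: assoc_pseudofunctor_def hom_def)
  next
    fix x assume x: "x \<in> Obj (fibre E A)"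
    note c = compositor_arr[OF f g x]
    show "iso (fibre E D) (nc ?t x)" by (fact c(3))
    show "nc ?t x \<in> hom (fibre E D) (fO (change_base E g \<bullet> change_base E f) x)
        (fO (change_base E (g \<cdot>\<^bsub>B\<^esub> f)) x)"
      using c(1) chg_simps(3)[OF gf x] chg_simps(3)[OF g c(6)] chg_simps(3)[OF f x] x
      by (simp add: fcomp_def chg_simps(1)[OF f])
  next
    fix u assume a: "u \<in> Arr (fibre E A)"
    define x y where xy: "x = Dom X u" "y = Cod X u"
    have u: "u \<in> hom (fibre E A) x y" using a xy by (simp add: fib_Arr)
    then have uX: "u \<in> hom X x y" by (simp add: fib_hom)
    note o = category_ids(1,2)[OF cat_fibre u]
    note cx = compositor_arr[OF f g o(1)] and cy = compositor_arr[OF f g o(2)]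
    have o': "x \<in> Obj X" "PO x = A" "y \<in> Obj X" "PO y = A" "push E f x \<in> Obj X" "PO (push E f x) = C"
      "push E f y \<in> Obj X" "PO (push E f y) = C"
      using o cx(6) cy(6) by (auto simp: fib_Obj)
    note lx = lift[OF f o'(1,2)] and ly = lift[OF f o'(3,4)]
      and lgx = lift[OF g o'(5,6)] and lgy = lift[OF g o'(7,8)]
      and lx' = lift[OF gf o'(1,2)]
    note fu = chg_arr[OF f u] note gfu = chg_arr[OF g fu(1)] and cu = chg_arr[OF gf u]
    let ?fu = "fA (change_base E f) u" let ?gfu = "fA (change_base E g) ?fu"
    have X: "?fu \<in> hom X (push E f x) (push E f y)"
      "?gfu \<in> hom X (push E g (push E f x)) (push E g (push E f y))"
      "fA (change_base E (g \<cdot>\<^bsub>B\<^esub> f)) u \<in> hom X (push E (g \<cdot>\<^bsub>B\<^esub> f) x) (push E (g \<cdot>\<^bsub>B\<^esub> f) y)"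
      "nc ?t x \<in> hom X (push E g (push E f x)) (push E (g \<cdot>\<^bsub>B\<^esub> f) x)"
      "nc ?t y \<in> hom X (push E g (push E f y)) (push E (g \<cdot>\<^bsub>B\<^esub> f) y)"
      using fu gfu cu cx cy by (auto simp: fib_hom)
    have "nc ?t y \<cdot>\<^bsub>X\<^esub> ?gfu = fA (change_base E (g \<cdot>\<^bsub>B\<^esub> f)) u \<cdot>\<^bsub>X\<^esub> nc ?t x"
    proof (rule cocart_cancel[OF cx(4,5) category_homI[OF catX X(2,5)] category_homI[OF catX X(4,3)]])
      show "PA (nc ?t y \<cdot>\<^bsub>X\<^esub> ?gfu) = PA (fA (change_base E (g \<cdot>\<^bsub>B\<^esub> f)) u \<cdot>\<^bsub>X\<^esub> nc ?t x)"
        using category_homI[OF cat_fibre gfu(1) cy(1)] category_homI[OF cat_fibre cx(1) cu(1)]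
        by (simp add: fib_hom)
      have "(nc ?t y \<cdot>\<^bsub>X\<^esub> ?gfu) \<cdot>\<^bsub>X\<^esub> (lift E g (push E f x) \<cdot>\<^bsub>X\<^esub> lift E f x)
          = nc ?t y \<cdot>\<^bsub>X\<^esub> (?gfu \<cdot>\<^bsub>X\<^esub> (lift E g (push E f x) \<cdot>\<^bsub>X\<^esub> lift E f x))"
        by (rule category_assoc[OF catX cx(5) X(2) X(5)])
      also have "?gfu \<cdot>\<^bsub>X\<^esub> (lift E g (push E f x) \<cdot>\<^bsub>X\<^esub> lift E f x)
          = (?gfu \<cdot>\<^bsub>X\<^esub> lift E g (push E f x)) \<cdot>\<^bsub>X\<^esub> lift E f x"
        by (rule category_assoc[OF catX lx(2) lgx(2) X(2), symmetric])
      also have "\<dots> = lift E g (push E f y) \<cdot>\<^bsub>X\<^esub> (?fu \<cdot>\<^bsub>X\<^esub> lift E f x)"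
        unfolding gfu(2) by (rule category_assoc[OF catX lx(2) X(1) lgy(2)])
      also have "\<dots> = (lift E g (push E f y) \<cdot>\<^bsub>X\<^esub> lift E f y) \<cdot>\<^bsub>X\<^esub> u"
        unfolding fu(2) by (rule category_assoc[OF catX uX ly(2) lgy(2), symmetric])
      also have "nc ?t y \<cdot>\<^bsub>X\<^esub> \<dots> = lift E (g \<cdot>\<^bsub>B\<^esub> f) y \<cdot>\<^bsub>X\<^esub> u"
        using category_assoc[OF catX uX cy(5) X(5)] cy(2) by simp
      also have "\<dots> = fA (change_base E (g \<cdot>\<^bsub>B\<^esub> f)) u \<cdot>\<^bsub>X\<^esub> lift E (g \<cdot>\<^bsub>B\<^esub> f) x"
        by (rule cu(2)[symmetric])
      also have "\<dots> = (fA (change_base E (g \<cdot>\<^bsub>B\<^esub> f)) u \<cdot>\<^bsub>X\<^esub> nc ?t x) \<cdot>\<^bsub>X\<^esub>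
          (lift E g (push E f x) \<cdot>\<^bsub>X\<^esub> lift E f x)"
        using category_assoc[OF catX cx(5) X(4) X(3)] cx(2) by simp
      finally show "(nc ?t y \<cdot>\<^bsub>X\<^esub> ?gfu) \<cdot>\<^bsub>X\<^esub> (lift E g (push E f x) \<cdot>\<^bsub>X\<^esub> lift E f x) =
          (fA (change_base E (g \<cdot>\<^bsub>B\<^esub> f)) u \<cdot>\<^bsub>X\<^esub> nc ?t x) \<cdot>\<^bsub>X\<^esub>
          (lift E g (push E f x) \<cdot>\<^bsub>X\<^esub> lift E f x)" .
    qed
    then show "nc ?t (Cod X u) \<cdot>\<^bsub>X\<^esub> fA (change_base E g \<bullet> change_base E f) u =
        fA (change_base E (g \<cdot>\<^bsub>B\<^esub> f)) u \<cdot>\<^bsub>X\<^esub> nc ?t (Dom X u)"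
      using a xy by (simp add: fcomp_def chg_simps(1)[OF f])
  qed
qed

lemma compositor_assoc:
  assumes f: "f \<in> hom B A C" and g: "g \<in> hom B C D" and h: "h \<in> hom B D G"
    and x: "x \<in> Obj (fibre E A)"
  defines "t \<equiv> psC (assoc_pseudofunctor E)"
  shows "nc (t h (g \<cdot>\<^bsub>B\<^esub> f)) x \<cdot>\<^bsub>X\<^esub> fA (change_base E h) (nc (t g f) x) =
    nc (t (h \<cdot>\<^bsub>B\<^esub> g) f) x \<cdot>\<^bsub>X\<^esub> nc (t h g) (push E f x)"
proof -
  have gf: "g \<cdot>\<^bsub>B\<^esub> f \<in> hom B A D" and hg: "h \<cdot>\<^bsub>B\<^esub> g \<in> hom B C G"
    using category_homI[OF catB f g] category_homI[OF catB g h] by auto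
  have as: "(h \<cdot>\<^bsub>B\<^esub> g) \<cdot>\<^bsub>B\<^esub> f = h \<cdot>\<^bsub>B\<^esub> (g \<cdot>\<^bsub>B\<^esub> f)" by (rule category_assoc[OF catB f g h])
  note a = compositor_arr[OF f g x, folded t_def]
  note b = compositor_arr[OF gf h x, folded t_def]
  note c = compositor_arr[OF g h a(6), folded t_def]
  note d = compositor_arr[OF f hg x, folded t_def]
  note e = chg_arr[OF h a(1)]
  have x': "x \<in> Obj X" "PO x = A" using x by (auto simp: fib_Obj)
  note lf = lift[OF f x']
  note lg = lift[OF g lf(5,4)] and lgf = lift[OF gf x'] and lhg = lift[OF hg lf(5,4)]
  note lh = lift[OF h lg(5,4)] and lh' = lift[OF h lgf(5,4)]
  note k = cocart_comp[OF a(4,5) lh(1,2)]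
  have X: "nc (t g f) x \<in> hom X (push E g (push E f x)) (push E (g \<cdot>\<^bsub>B\<^esub> f) x)"
    "nc (t h (g \<cdot>\<^bsub>B\<^esub> f)) x \<in> hom X (push E h (push E (g \<cdot>\<^bsub>B\<^esub> f) x)) (push E (h \<cdot>\<^bsub>B\<^esub> (g \<cdot>\<^bsub>B\<^esub> f)) x)"
    "nc (t h g) (push E f x) \<in> hom X (push E h (push E g (push E f x))) (push E (h \<cdot>\<^bsub>B\<^esub> g) (push E f x))"
    "nc (t (h \<cdot>\<^bsub>B\<^esub> g) f) x \<in> hom X (push E (h \<cdot>\<^bsub>B\<^esub> g) (push E f x)) (push E (h \<cdot>\<^bsub>B\<^esub> (g \<cdot>\<^bsub>B\<^esub> f)) x)"
    "fA (change_base E h) (nc (t g f) x)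
      \<in> hom X (push E h (push E g (push E f x))) (push E h (push E (g \<cdot>\<^bsub>B\<^esub> f) x))"
    using a b c d e as by (simp_all add: fib_hom)
  show ?thesis
  proof (rule cocart_cancel[OF k category_homI[OF catX X(5,2)] category_homI[OF catX X(3,4)]])
    show "PA (nc (t h (g \<cdot>\<^bsub>B\<^esub> f)) x \<cdot>\<^bsub>X\<^esub> fA (change_base E h) (nc (t g f) x)) =
      PA (nc (t (h \<cdot>\<^bsub>B\<^esub> g) f) x \<cdot>\<^bsub>X\<^esub> nc (t h g) (push E f x))"
      using category_homI[OF cat_fibre e(1) b(1)] category_homI[OF cat_fibre c(1) d(1)]
      by (simp add: fib_hom)
    let ?l = "lift E h (push E g (push E f x)) \<cdot>\<^bsub>X\<^esub> lift E g (push E f x) \<cdot>\<^bsub>X\<^esub> lift E f x"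
    have "(nc (t h (g \<cdot>\<^bsub>B\<^esub> f)) x \<cdot>\<^bsub>X\<^esub> fA (change_base E h) (nc (t g f) x)) \<cdot>\<^bsub>X\<^esub> ?l
        = nc (t h (g \<cdot>\<^bsub>B\<^esub> f)) x \<cdot>\<^bsub>X\<^esub> fA (change_base E h) (nc (t g f) x) \<cdot>\<^bsub>X\<^esub> ?l"
      by (rule category_assoc[OF catX k(2) X(5,2)])
    also have "fA (change_base E h) (nc (t g f) x) \<cdot>\<^bsub>X\<^esub> ?l =
        (fA (change_base E h) (nc (t g f) x) \<cdot>\<^bsub>X\<^esub> lift E h (push E g (push E f x))) \<cdot>\<^bsub>X\<^esub>
          lift E g (push E f x) \<cdot>\<^bsub>X\<^esub> lift E f x"
      by (rule category_assoc[OF catX a(5) lh(2) X(5), symmetric])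
    also have "\<dots> = lift E h (push E (g \<cdot>\<^bsub>B\<^esub> f) x) \<cdot>\<^bsub>X\<^esub> lift E (g \<cdot>\<^bsub>B\<^esub> f) x"
      unfolding e(2) using category_assoc[OF catX a(5) X(1) lh'(2)] a(2) by simp
    also have "nc (t h (g \<cdot>\<^bsub>B\<^esub> f)) x \<cdot>\<^bsub>X\<^esub> \<dots> = lift E (h \<cdot>\<^bsub>B\<^esub> g \<cdot>\<^bsub>B\<^esub> f) x"
      by (rule b(2))
    finally have 1: "(nc (t h (g \<cdot>\<^bsub>B\<^esub> f)) x \<cdot>\<^bsub>X\<^esub> fA (change_base E h) (nc (t g f) x)) \<cdot>\<^bsub>X\<^esub> ?l
        = lift E (h \<cdot>\<^bsub>B\<^esub> g \<cdot>\<^bsub>B\<^esub> f) x" .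
    have "(nc (t (h \<cdot>\<^bsub>B\<^esub> g) f) x \<cdot>\<^bsub>X\<^esub> nc (t h g) (push E f x)) \<cdot>\<^bsub>X\<^esub> ?l
        = nc (t (h \<cdot>\<^bsub>B\<^esub> g) f) x \<cdot>\<^bsub>X\<^esub> nc (t h g) (push E f x) \<cdot>\<^bsub>X\<^esub>
          (lift E h (push E g (push E f x)) \<cdot>\<^bsub>X\<^esub> lift E g (push E f x)) \<cdot>\<^bsub>X\<^esub> lift E f x"
      unfolding category_assoc[OF catX lf(2) lg(2) lh(2)]
      by (rule category_assoc[OF catX k(2) X(3,4)])
    also have "nc (t h g) (push E f x) \<cdot>\<^bsub>X\<^esub>
        (lift E h (push E g (push E f x)) \<cdot>\<^bsub>X\<^esub> lift E g (push E f x)) \<cdot>\<^bsub>X\<^esub> lift E f x = lift E (h \<cdot>\<^bsub>B\<^esub> g) (push E f x) \<cdot>\<^bsub>X\<^esub> lift E f x"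
      using category_assoc[OF catX lf(2) c(5) X(3)] c(2) by simp
    also have "nc (t (h \<cdot>\<^bsub>B\<^esub> g) f) x \<cdot>\<^bsub>X\<^esub> \<dots> = lift E (h \<cdot>\<^bsub>B\<^esub> g \<cdot>\<^bsub>B\<^esub> f) x"
      using d(2) as by simp
    finally show "(nc (t h (g \<cdot>\<^bsub>B\<^esub> f)) x \<cdot>\<^bsub>X\<^esub> fA (change_base E h) (nc (t g f) x)) \<cdot>\<^bsub>X\<^esub> ?l =
      (nc (t (h \<cdot>\<^bsub>B\<^esub> g) f) x \<cdot>\<^bsub>X\<^esub> nc (t h g) (push E f x)) \<cdot>\<^bsub>X\<^esub> ?l" using 1 by simp
  qed
qed

lemma compositor_unit:
  assumes f: "f \<in> hom B A C" and x: "x \<in> Obj (fibre E A)"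
  defines "t \<equiv> psC (assoc_pseudofunctor E)"
  shows "nc (t f (idn B A)) x \<cdot>\<^bsub>X\<^esub> fA (change_base E f) (lift E (idn B A) x) = idn X (push E f x)"
    "nc (t (idn B C) f) x \<cdot>\<^bsub>X\<^esub> lift E (idn B C) (push E f x) = idn X (push E f x)"
proof -
  note i = category_ids[OF catB f]
  have x': "x \<in> Obj X" "PO x = A" using x by (auto simp: fib_Obj)
  note lf = lift[OF f x']
  note li = lift[OF i(3) x'] and li' = lift[OF i(4) lf(5,4)]
  have liv: "lift E (idn B A) x \<in> hom (fibre E A) x (push E (idn B A) x)"
    and liv': "lift E (idn B C) (push E f x) \<in> hom (fibre E C) (push E f x) (push E (idn B C) (push E f x))"
    using li li' x' lf by (simp_all add: fib_hom)
  note a = compositor_arr[OF i(3) f x, folded t_def, unfolded i(5)]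
    and b = compositor_arr[OF f i(4) x, folded t_def, unfolded i(6)]
  note c = chg_arr[OF f liv]
  note lfi = lift[OF f li(5,4)]
  have X: "nc (t f (idn B A)) x \<in> hom X (push E f (push E (idn B A) x)) (push E f x)"
    "nc (t (idn B C) f) x \<in> hom X (push E (idn B C) (push E f x)) (push E f x)"
    "fA (change_base E f) (lift E (idn B A) x) \<in> hom X (push E f x) (push E f (push E (idn B A) x))"
    using a b c by (simp_all add: fib_hom)
  note ix = category_idI[OF catX lf(5)] and ifx = category_ids(6)[OF catX lf(2)]
  show "nc (t f (idn B A)) x \<cdot>\<^bsub>X\<^esub> fA (change_base E f) (lift E (idn B A) x) = idn X (push E f x)"
  proof (rule cocart_cancel[OF lf(1,2) category_homI[OF catX X(3,1)] ix])
    show "PA (nc (t f (idn B A)) x \<cdot>\<^bsub>X\<^esub> fA (change_base E f) (lift E (idn B A) x)) = PA (idn X (push E f x))"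
      using category_homI[OF cat_fibre c(1) a(1)] PA_id[OF lf(5)] lf(4) by (simp add: fib_hom)
    show "(nc (t f (idn B A)) x \<cdot>\<^bsub>X\<^esub> fA (change_base E f) (lift E (idn B A) x)) \<cdot>\<^bsub>X\<^esub> lift E f x
        = idn X (push E f x) \<cdot>\<^bsub>X\<^esub> lift E f x"
      using category_assoc[OF catX lf(2) X(3,1)] c(2) a(2) ifx by simp
  qed
  show "nc (t (idn B C) f) x \<cdot>\<^bsub>X\<^esub> lift E (idn B C) (push E f x) = idn X (push E f x)"
  proof (rule cocart_cancel[OF lf(1,2) category_homI[OF catX li'(2) X(2)] ix])
    show "PA (nc (t (idn B C) f) x \<cdot>\<^bsub>X\<^esub> lift E (idn B C) (push E f x)) = PA (idn X (push E f x))"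
      using category_homI[OF cat_fibre liv' b(1)] PA_id[OF lf(5)] lf(4) by (simp add: fib_hom)
    show "(nc (t (idn B C) f) x \<cdot>\<^bsub>X\<^esub> lift E (idn B C) (push E f x)) \<cdot>\<^bsub>X\<^esub> lift E f x
        = idn X (push E f x) \<cdot>\<^bsub>X\<^esub> lift E f x"
      using category_assoc[OF catX lf(2) li'(2) X(2)] b(2) ifx by simp
  qed
qed

lemma pseudofunctor_assoc: "pseudofunctor B CAT (assoc_pseudofunctor E)"
proof -
  let ?F = "assoc_pseudofunctor E"
  have sO: "psO ?F = fibre E" and sA: "psA ?F = change_base E"
    and sC: "\<And>g f. nsrc (psC ?F g f) = change_base E g \<bullet> change_base E f"
      "\<And>g f. ntrg (psC ?F g f) = change_base E (g \<cdot>\<^bsub>B\<^esub> f)"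
    and sI: "\<And>A. nsrc (psI ?F A) = fid (fibre E A)" "\<And>A. ntrg (psI ?F A) = change_base E (idn B A)"
      "\<And>A x. x \<in> Obj (fibre E A) \<Longrightarrow> nc (psI ?F A) x = lift E (idn B A) x"
    by (simp_all add: assoc_pseudofunctor_def)
  have C: "comp1 CAT = fcomp" "vcomp2 CAT = nvcomp" "lwhisker2 CAT = nlwhisker"
    "rwhisker2 CAT = nrwhisker" "one1 CAT = fid" "one2 CAT = nid" "obj2 CAT = {C. category C}"
    "mor2 CAT C D = {F. is_functor F \<and> fsrc F = C \<and> ftrg F = D}"
    for C D :: "('x, 'u) cat"
    by (simp_all add: CAT_def)
  have hom: "f \<in> hom B (Dom B f) (Cod B f)" if "f \<in> Arr B" for f using that by (simp add: hom_def)
  show ?thesis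
    unfolding pseudofunctor_def sO sA C
  proof (intro conjI ballI impI catB)
    show "fibre E A \<in> {C. category C}" for A by (simp add: cat_fibre)
    show "inv_cell2 CAT (fid (fibre E A)) (change_base E (idn B A)) (psI ?F A)" if "A \<in> Obj B" for A
      using niso_inv_cell[OF unitor[OF that]] sI by simp
  next
    fix f assume fA: "f \<in> Arr B"
    note f = hom[OF fA]
    show "change_base E f \<in> {F. is_functor F \<and> fsrc F = fibre E (Dom B f) \<and> ftrg F = fibre E (Cod B f)}"
      using functor_chg[OF f] chg_simps(1,2)[OF f] by simp
    note ci = fcomp_fid[OF functor_chg[OF f], unfolded chg_simps(1,2)[OF f]]
    note i = category_ids[OF catB f]
    show "nvcomp (psC ?F f (idn B (Dom B f))) (nlwhisker (change_base E f) (psI ?F (Dom B f)))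
        = nid (change_base E f)"
      using compositor_unit(1)[OF f] ci i(5) chg_simps(3)[OF f]
      by (auto simp: nvcomp_def nlwhisker_def nid_def sC sI fun_eq_iff chg_simps(1,2)[OF f] fcomp_def fid_def)
    show "nvcomp (psC ?F (idn B (Cod B f)) f) (nrwhisker (psI ?F (Cod B f)) (change_base E f))
        = nid (change_base E f)"
      using compositor_unit(2)[OF f] ci i(6) chg_simps(3)[OF f] compositor_arr(6)[OF f i(4)]
      by (auto simp: nvcomp_def nrwhisker_def nid_def sC sI fun_eq_iff chg_simps(1,2)[OF f] fcomp_def fid_def)
    fix g assume gA: "g \<in> Arr B" and gf: "Dom B g = Cod B f"
    have g: "g \<in> hom B (Cod B f) (Cod B g)" using hom[OF gA] gf by simp
    show "inv_cell2 CAT (change_base E g \<bullet> change_base E f) (change_base E (g \<cdot>\<^bsub>B\<^esub> f)) (psC ?F g f)"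
      using niso_inv_cell[OF compositor[OF f g]] sC by simp
    fix h assume hA: "h \<in> Arr B" and hg: "Dom B h = Cod B g"
    have h: "h \<in> hom B (Cod B g) (Cod B h)" using hom[OF hA] hg by simp
    have fa: "(change_base E h \<bullet> change_base E g) \<bullet> change_base E f =
        change_base E h \<bullet> (change_base E g \<bullet> change_base E f)"
      by (rule fcomp_assoc[OF functor_chg[OF f]]) (simp add: chg_simps(1,2)[OF f] chg_simps(1,2)[OF g])
    have ba: "(h \<cdot>\<^bsub>B\<^esub> g) \<cdot>\<^bsub>B\<^esub> f = h \<cdot>\<^bsub>B\<^esub> (g \<cdot>\<^bsub>B\<^esub> f)" by (rule category_assoc[OF catB f g h])
    have s: "fsrc (change_base E a \<bullet> change_base E f) = fibre E (Dom B f)"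
      "ftrg (change_base E a \<bullet> F) = ftrg (change_base E a)" for a and F :: "('x, 'u, 'x, 'u) ftor"
      by (simp_all add: fcomp_def chg_simps(1)[OF f])
    show "nvcomp (psC ?F h (g \<cdot>\<^bsub>B\<^esub> f)) (nlwhisker (change_base E h) (psC ?F g f)) =
        nvcomp (psC ?F (h \<cdot>\<^bsub>B\<^esub> g) f) (nrwhisker (psC ?F h g) (change_base E f))"
      using compositor_assoc[OF f g h] chg_simps(3)[OF f] fa ba
      by (auto simp: nvcomp_def nlwhisker_def nrwhisker_def sC fun_eq_iff chg_simps(1,2)[OF f]
          chg_simps(1,2)[OF h] fcomp_def)
  qed
qed

lemma prodmap_fibre:
  assumes u: "u \<in> hom (fibre E A) x x'" and v: "v \<in> hom (fibre E C) y y'"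
  shows "prodmap K u v \<in> hom (fibre E (prd L A C)) (prd K x y) (prd K x' y')"
proof -
  have uX: "u \<in> hom X x x'" "PO x = A" "PO x' = A" "PA u = idn B A"
    and vX: "v \<in> hom X y y'" "PO y = C" "PO y' = C" "PA v = idn B C"
    using u v by (auto simp: fib_hom)
  have o: "x \<in> Obj X" "x' \<in> Obj X" "y \<in> Obj X" "y' \<in> Obj X"
    using category_ids[OF catX uX(1)] category_ids[OF catX vX(1)] by auto
  have ab: "A \<in> Obj B" "C \<in> Obj B" using PO_Obj o uX vX by auto
  note pm = prodmap[OF fpK uX(1) vX(1)]
  note q = prd_in[OF fpL ab] and p = prd_in[OF fpK o(1,3)] and p' = prd_in[OF fpK o(2,4)]
  have h: "PA (prodmap K u v) \<in> hom B (prd L A C) (prd L A C)"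
    using PA_hom[OF pm(1)] P_prod o uX vX by simp
  have "PA (prodmap K u v) = idn B (prd L A C)"
  proof (rule prd_ext[OF fpL ab h])
    show "idn B (prd L A C) \<in> hom B (prd L A C) (prd L A C)" using category_ids[OF catB q(2)] by simp
    show "pr1 L A C \<cdot>\<^bsub>B\<^esub> PA (prodmap K u v) = pr1 L A C \<cdot>\<^bsub>B\<^esub> idn B (prd L A C)"
      using PA_comp[OF pm(1) p'(2)] PA_comp[OF p(2) uX(1)] pm(2) P_prod o uX vX
        category_ids[OF catB q(2)] by simp
    show "pr2 L A C \<cdot>\<^bsub>B\<^esub> PA (prodmap K u v) = pr2 L A C \<cdot>\<^bsub>B\<^esub> idn B (prd L A C)"
      using PA_comp[OF pm(1) p'(3)] PA_comp[OF p(3) vX(1)] pm(3) P_prod o uX vX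
        category_ids[OF catB q(3)] by simp
  qed
  then show ?thesis using pm(1) P_prod o uX vX by (simp add: fib_hom)
qed

lemma RR_simps:
  "fsrc (RR E A C) = prod_cat (fibre E A) (fibre E C)" "ftrg (RR E A C) = fibre E (prd L A C)"
  "x \<in> Obj (fibre E A) \<Longrightarrow> y \<in> Obj (fibre E C) \<Longrightarrow> fO (RR E A C) (x, y) = prd K x y"
  "u \<in> Arr (fibre E A) \<Longrightarrow> v \<in> Arr (fibre E C) \<Longrightarrow> fA (RR E A C) (u, v) = prodmap K u v"
  by (simp_all add: RR_def Let_def prod_cat_def)

lemma prodmap_id:
  assumes "x \<in> Obj X" "y \<in> Obj X"
  shows "prodmap K (idn X x) (idn X y) = idn X (prd K x y)"
proof -
  have i: "idn X x \<in> hom X x x" "idn X y \<in> hom X y y"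
    using category_idI[OF catX] assms by blast+
  note p = prd_in[OF fpK assms] and pm = prodmap[OF fpK i]
  show ?thesis
    by (rule prd_ext[OF fpK assms pm(1) category_ids(3)[OF catX p(2)]])
      (simp_all add: pm category_ids(5,6)[OF catX p(2)] category_ids(5,6)[OF catX p(3)])
qed

lemma prodmap_comp:
  assumes "u \<in> hom X x x'" "u' \<in> hom X x' x''" "v \<in> hom X y y'" "v' \<in> hom X y' y''"
  shows "prodmap K (u' \<cdot>\<^bsub>X\<^esub> u) (v' \<cdot>\<^bsub>X\<^esub> v) = prodmap K u' v' \<cdot>\<^bsub>X\<^esub> prodmap K u v"
proof -
  note i = category_homI[OF catX assms(1,2)] category_homI[OF catX assms(3,4)]
  note pm = prodmap[OF fpK assms(1,3)] and pm' = prodmap[OF fpK assms(2,4)] and pc = prodmap[OF fpK i]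
  note o = category_ids(1,2)[OF catX assms(1)] category_ids(1,2)[OF catX assms(2)]
    category_ids(1,2)[OF catX assms(3)] category_ids(1,2)[OF catX assms(4)]
  note p = prd_in[OF fpK o(1) o(5)] and p' = prd_in[OF fpK o(2) o(6)] and p'' = prd_in[OF fpK o(4) o(8)]
  show ?thesis
  proof (rule prd_ext[OF fpK o(4) o(8) pc(1) category_homI[OF catX pm(1) pm'(1)]])
    show "pr1 K x'' y'' \<cdot>\<^bsub>X\<^esub> prodmap K (u' \<cdot>\<^bsub>X\<^esub> u) (v' \<cdot>\<^bsub>X\<^esub> v)
      = pr1 K x'' y'' \<cdot>\<^bsub>X\<^esub> prodmap K u' v' \<cdot>\<^bsub>X\<^esub> prodmap K u v"
      using category_assoc[OF catX pm(1) pm'(1) p''(2)] category_assoc[OF catX pm(1) p'(2) assms(2)]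
        category_assoc[OF catX p(2) assms(1,2)] pm pm' pc by simp
    show "pr2 K x'' y'' \<cdot>\<^bsub>X\<^esub> prodmap K (u' \<cdot>\<^bsub>X\<^esub> u) (v' \<cdot>\<^bsub>X\<^esub> v)
      = pr2 K x'' y'' \<cdot>\<^bsub>X\<^esub> prodmap K u' v' \<cdot>\<^bsub>X\<^esub> prodmap K u v"
      using category_assoc[OF catX pm(1) pm'(1) p''(3)] category_assoc[OF catX pm(1) p'(3) assms(4)]
        category_assoc[OF catX p(3) assms(3,4)] pm pm' pc by simp
  qed
qed

lemma functor_RR: "is_functor (RR E A C)"
  unfolding is_functor_def Let_def RR_simps(1,2)
proof (intro conjI ballI impI cat_fibre category_prod_cat)
  show "fO (RR E A C) \<in> extensional (Obj (prod_cat (fibre E A) (fibre E C)))"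
    "fA (RR E A C) \<in> extensional (Arr (prod_cat (fibre E A) (fibre E C)))"
    by (auto simp: RR_def Let_def)
next
  fix z assume "z \<in> Obj (prod_cat (fibre E A) (fibre E C))"
  then obtain x y where z: "z = (x, y)" "x \<in> Obj (fibre E A)" "y \<in> Obj (fibre E C)"
    by (auto simp: prod_cat_def)
  then have o: "x \<in> Obj X" "y \<in> Obj X" "PO x = A" "PO y = C" by (auto simp: fib_Obj)
  show "fO (RR E A C) z \<in> Obj (fibre E (prd L A C))"
    using z o prd_in[OF fpK o(1,2)] P_prod[OF o(1,2)] by (simp add: RR_simps fib_Obj)
  have "idn X x \<in> Arr (fibre E A)" "idn X y \<in> Arr (fibre E C)"
    using category_idI[OF cat_fibre z(2)] category_idI[OF cat_fibre z(3)] by (auto simp: hom_def)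
  then show "fA (RR E A C) (idn (prod_cat (fibre E A) (fibre E C)) z)
      = idn (fibre E (prd L A C)) (fO (RR E A C) z)"
    using z o prodmap_id[OF o(1,2)] by (simp add: RR_simps prod_cat_def)
next
  fix w assume "w \<in> Arr (prod_cat (fibre E A) (fibre E C))"
  then obtain u v where w: "w = (u, v)" "u \<in> Arr (fibre E A)" "v \<in> Arr (fibre E C)"
    by (auto simp: prod_cat_def)
  then have u: "u \<in> hom (fibre E A) (Dom X u) (Cod X u)"
    and v: "v \<in> hom (fibre E C) (Dom X v) (Cod X v)" by (auto simp: fib_Arr)
  have o: "Dom X u \<in> Obj (fibre E A)" "Cod X u \<in> Obj (fibre E A)" "Dom X v \<in> Obj (fibre E C)"
    "Cod X v \<in> Obj (fibre E C)"
    using category_ids[OF cat_fibre u] category_ids[OF cat_fibre v] by auto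
  show "fA (RR E A C) w \<in> hom (fibre E (prd L A C))
       (fO (RR E A C) (Dom (prod_cat (fibre E A) (fibre E C)) w))
       (fO (RR E A C) (Cod (prod_cat (fibre E A) (fibre E C)) w))"
    using prodmap_fibre[OF u v] w o by (simp add: RR_simps prod_cat_def)
  fix w' assume "w' \<in> Arr (prod_cat (fibre E A) (fibre E C))"
    and d: "Dom (prod_cat (fibre E A) (fibre E C)) w' = Cod (prod_cat (fibre E A) (fibre E C)) w"
  then obtain u' v' where w': "w' = (u', v')" "u' \<in> Arr (fibre E A)" "v' \<in> Arr (fibre E C)"
    by (auto simp: prod_cat_def)
  then have u': "u' \<in> hom (fibre E A) (Cod X u) (Cod X u')"
    and v': "v' \<in> hom (fibre E C) (Cod X v) (Cod X v')"
    using d w by (auto simp: fib_Arr prod_cat_def)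
  have a: "u' \<cdot>\<^bsub>X\<^esub> u \<in> Arr (fibre E A)" "v' \<cdot>\<^bsub>X\<^esub> v \<in> Arr (fibre E C)"
    using category_homI[OF cat_fibre u u'] category_homI[OF cat_fibre v v'] by (auto simp: hom_def)
  show "fA (RR E A C) (w' \<cdot>\<^bsub>prod_cat (fibre E A) (fibre E C)\<^esub> w)
      = fA (RR E A C) w' \<cdot>\<^bsub>fibre E (prd L A C)\<^esub> fA (RR E A C) w"
    using w w' a prodmap_comp[of u "Dom X u" "Cod X u" u' "Cod X u'" v "Dom X v" "Cod X v" v' "Cod X v'"]
      u u' v v' by (simp add: RR_simps prod_cat_def fib_hom)
qed

lemma functor_LL:
  assumes "A \<in> Obj B" "C \<in> Obj B"
  shows "is_functor (LL E A C)" "fsrc (LL E A C) = fibre E (prd L A C)"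
    "ftrg (LL E A C) = prod_cat (fibre E A) (fibre E C)"
    "z \<in> Obj (fibre E (prd L A C)) \<Longrightarrow> fO (LL E A C) z = (push E (pr1 L A C) z, push E (pr2 L A C) z)"
    "u \<in> Arr (fibre E (prd L A C)) \<Longrightarrow>
      fA (LL E A C) u = (fA (change_base E (pr1 L A C)) u, fA (change_base E (pr2 L A C)) u)"
proof -
  note q = prd_in[OF fpL assms]
  show "is_functor (LL E A C)" unfolding LL_def
    by (rule is_functor_fpair[OF functor_chg[OF q(2)] functor_chg[OF q(3)]])
      (simp add: chg_simps[OF q(2)] chg_simps[OF q(3)])
  show "fsrc (LL E A C) = fibre E (prd L A C)"
    "ftrg (LL E A C) = prod_cat (fibre E A) (fibre E C)"
    "z \<in> Obj (fibre E (prd L A C)) \<Longrightarrow> fO (LL E A C) z = (push E (pr1 L A C) z, push E (pr2 L A C) z)"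
    "u \<in> Arr (fibre E (prd L A C)) \<Longrightarrow>
      fA (LL E A C) u = (fA (change_base E (pr1 L A C)) u, fA (change_base E (pr2 L A C)) u)"
    by (simp_all add: LL_def fpair_def chg_simps[OF q(2)] chg_simps[OF q(3)])
qed

lemma eta_arr:
  assumes ab: "A \<in> Obj B" "C \<in> Obj B" and z: "z \<in> Obj (fibre E (prd L A C))"
  defines "x \<equiv> push E (pr1 L A C) z" and "y \<equiv> push E (pr2 L A C) z"
  shows "nc (eta E A C) z \<in> hom (fibre E (prd L A C)) z (prd K x y)"
    "pr1 K x y \<cdot>\<^bsub>X\<^esub> nc (eta E A C) z = lift E (pr1 L A C) z"
    "pr2 K x y \<cdot>\<^bsub>X\<^esub> nc (eta E A C) z = lift E (pr2 L A C) z"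
    "x \<in> Obj (fibre E A)" "y \<in> Obj (fibre E C)"
proof -
  note q = prd_in[OF fpL ab]
  have z': "z \<in> Obj X" "PO z = prd L A C" using z by (auto simp: fib_Obj)
  note l1 = lift[OF q(2) z', folded x_def] and l2 = lift[OF q(3) z', folded y_def]
  have e: "nc (eta E A C) z = pairing K (lift E (pr1 L A C) z) (lift E (pr2 L A C) z)"
    using z by (simp add: eta_def Let_def)
  note p = pairing(1-3)[OF fpK l1(2) l2(2), folded e]
  show "pr1 K x y \<cdot>\<^bsub>X\<^esub> nc (eta E A C) z = lift E (pr1 L A C) z"
    "pr2 K x y \<cdot>\<^bsub>X\<^esub> nc (eta E A C) z = lift E (pr2 L A C) z"
    "x \<in> Obj (fibre E A)" "y \<in> Obj (fibre E C)"
    using p l1 l2 by (auto simp: fib_Obj)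
  note r = prd_in[OF fpK l1(5) l2(5)] and pp = P_prod[OF l1(5) l2(5)]
  have h: "PA (nc (eta E A C) z) \<in> hom B (prd L A C) (prd L A C)"
    using PA_hom[OF p(1)] pp l1 l2 z' by simp
  have "PA (nc (eta E A C) z) = idn B (prd L A C)"
    by (rule prd_ext[OF fpL ab h category_ids(3)[OF catB q(2)]])
      (use PA_comp[OF p(1) r(2)] PA_comp[OF p(1) r(3)] p(2,3) pp l1(3,4) l2(3,4)
        category_ids(5)[OF catB q(2)] category_ids(5)[OF catB q(3)] in simp_all)
  then show "nc (eta E A C) z \<in> hom (fibre E (prd L A C)) z (prd K x y)"
    using p pp l1 l2 z' by (simp add: fib_hom)
qed

lemma eps_arr:
  assumes ab: "A \<in> Obj B" "C \<in> Obj B" and x: "x \<in> Obj (fibre E A)" and y: "y \<in> Obj (fibre E C)"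
  shows "fst (nc (eps E A C) (x, y)) \<in> hom (fibre E A) (push E (pr1 L A C) (prd K x y)) x"
    "fst (nc (eps E A C) (x, y)) \<cdot>\<^bsub>X\<^esub> lift E (pr1 L A C) (prd K x y) = pr1 K x y"
    "snd (nc (eps E A C) (x, y)) \<in> hom (fibre E C) (push E (pr2 L A C) (prd K x y)) y"
    "snd (nc (eps E A C) (x, y)) \<cdot>\<^bsub>X\<^esub> lift E (pr2 L A C) (prd K x y) = pr2 K x y"
    "prd K x y \<in> Obj (fibre E (prd L A C))"
proof -
  note q = prd_in[OF fpL ab]
  have o: "x \<in> Obj X" "PO x = A" "y \<in> Obj X" "PO y = C" using x y by (auto simp: fib_Obj)
  note r = prd_in[OF fpK o(1,3)] and pp = P_prod[OF o(1,3)]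
  have z: "prd K x y \<in> Obj X" "PO (prd K x y) = prd L A C" using r pp o by auto
  note l1 = lift[OF q(2) z] and l2 = lift[OF q(3) z]
  have e: "nc (eps E A C) (x, y) = (vfactor E (lift E (pr1 L A C) (prd K x y)) (pr1 K x y),
         vfactor E (lift E (pr2 L A C) (prd K x y)) (pr2 K x y))"
    using x y by (simp add: eps_def Let_def prod_cat_def)
  note v1 = vfactor[OF l1(1,2) r(2)] and v2 = vfactor[OF l2(1,2) r(3)]
  show "fst (nc (eps E A C) (x, y)) \<in> hom (fibre E A) (push E (pr1 L A C) (prd K x y)) x"
    "fst (nc (eps E A C) (x, y)) \<cdot>\<^bsub>X\<^esub> lift E (pr1 L A C) (prd K x y) = pr1 K x y"
    "snd (nc (eps E A C) (x, y)) \<in> hom (fibre E C) (push E (pr2 L A C) (prd K x y)) y"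
    "snd (nc (eps E A C) (x, y)) \<cdot>\<^bsub>X\<^esub> lift E (pr2 L A C) (prd K x y) = pr2 K x y"
    "prd K x y \<in> Obj (fibre E (prd L A C))"
    using v1 v2 l1 l2 pp o z by (auto simp: e fib_hom fib_Obj)
qed

lemma eta_ntrans:
  assumes ab: "A \<in> Obj B" "C \<in> Obj B"
  shows "is_ntrans (eta E A C)"
proof -
  note fl = functor_LL[OF ab]
  have s: "nsrc (eta E A C) = fid (fibre E (prd L A C))" "ntrg (eta E A C) = RR E A C \<bullet> LL E A C"
    by (simp_all add: eta_def Let_def)
  have fs: "fsrc (fid c) = c" "ftrg (fid c) = c" for c :: "('x, 'u) cat" by (simp_all add: fid_def)
  note q = prd_in[OF fpL ab]
  show ?thesis
    unfolding is_ntrans_def Let_def s fs fib_simps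
  proof (intro conjI ballI)
    show "is_functor (fid (fibre E (prd L A C)))" by (rule is_functor_fid[OF cat_fibre])
    show "is_functor (RR E A C \<bullet> LL E A C)"
      by (rule is_functor_fcomp[OF fl(1) functor_RR]) (simp add: fl RR_simps)
    show "fsrc (RR E A C \<bullet> LL E A C) = fibre E (prd L A C)"
      "ftrg (RR E A C \<bullet> LL E A C) = fibre E (prd L A C)"
      by (simp_all add: fcomp_def fl RR_simps)
    show "nc (eta E A C) \<in> extensional (Obj (fibre E (prd L A C)))" by (simp add: eta_def Let_def)
  next
    fix z assume z: "z \<in> Obj (fibre E (prd L A C))"
    show "nc (eta E A C) z \<in> hom (fibre E (prd L A C)) (fO (fid (fibre E (prd L A C))) z)
        (fO (RR E A C \<bullet> LL E A C) z)"
      using eta_arr[OF ab z] z by (simp add: fid_def fcomp_def fl RR_simps)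
  next
    fix u assume a: "u \<in> Arr (fibre E (prd L A C))"
    define z w where zw: "z = Dom X u" "w = Cod X u"
    have u: "u \<in> hom (fibre E (prd L A C)) z w" using a zw by (simp add: fib_Arr)
    have o: "z \<in> Obj (fibre E (prd L A C))" "w \<in> Obj (fibre E (prd L A C))"
      using category_ids[OF cat_fibre u] by auto
    then have o': "z \<in> Obj X" "PO z = prd L A C" "w \<in> Obj X" "PO w = prd L A C"
      by (auto simp: fib_Obj)
    note c1 = chg_arr[OF q(2) u] and c2 = chg_arr[OF q(3) u]
    note ez = eta_arr[OF ab o(1)] and ew = eta_arr[OF ab o(2)]
    let ?u1 = "fA (change_base E (pr1 L A C)) u" and ?u2 = "fA (change_base E (pr2 L A C)) u"
    have c: "?u1 \<in> hom X (push E (pr1 L A C) z) (push E (pr1 L A C) w)"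
      "?u2 \<in> hom X (push E (pr2 L A C) z) (push E (pr2 L A C) w)"
      "nc (eta E A C) z \<in> hom X z (prd K (push E (pr1 L A C) z) (push E (pr2 L A C) z))"
      "nc (eta E A C) w \<in> hom X w (prd K (push E (pr1 L A C) w) (push E (pr2 L A C) w))"
      "u \<in> hom X z w"
      using c1 c2 ez ew u by (auto simp: fib_hom)
    note pm = prodmap[OF fpK c(1,2)]
    have oo: "push E (pr1 L A C) w \<in> Obj X" "push E (pr2 L A C) w \<in> Obj X"
      "push E (pr1 L A C) z \<in> Obj X" "push E (pr2 L A C) z \<in> Obj X"
      using ez ew by (auto simp: fib_Obj)
    note rz = prd_in[OF fpK oo(3,4)] and rw = prd_in[OF fpK oo(1,2)]
    have eq: "nc (eta E A C) w \<cdot>\<^bsub>X\<^esub> u = prodmap K ?u1 ?u2 \<cdot>\<^bsub>X\<^esub> nc (eta E A C) z"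
    proof (rule prd_ext[OF fpK oo(1,2) category_homI[OF catX c(5,4)] category_homI[OF catX c(3) pm(1)]])
      show "pr1 K (push E (pr1 L A C) w) (push E (pr2 L A C) w) \<cdot>\<^bsub>X\<^esub> nc (eta E A C) w \<cdot>\<^bsub>X\<^esub> u =
        pr1 K (push E (pr1 L A C) w) (push E (pr2 L A C) w) \<cdot>\<^bsub>X\<^esub> prodmap K ?u1 ?u2 \<cdot>\<^bsub>X\<^esub> nc (eta E A C) z"
        using category_assoc[OF catX c(5,4) rw(2)] category_assoc[OF catX c(3) pm(1) rw(2)]
          category_assoc[OF catX c(3) rz(2) c(1)] pm ez(2,3) ew(2,3) c1(2) by simp
      show "pr2 K (push E (pr1 L A C) w) (push E (pr2 L A C) w) \<cdot>\<^bsub>X\<^esub> nc (eta E A C) w \<cdot>\<^bsub>X\<^esub> u =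
        pr2 K (push E (pr1 L A C) w) (push E (pr2 L A C) w) \<cdot>\<^bsub>X\<^esub> prodmap K ?u1 ?u2 \<cdot>\<^bsub>X\<^esub> nc (eta E A C) z"
        using category_assoc[OF catX c(5,4) rw(3)] category_assoc[OF catX c(3) pm(1) rw(3)]
          category_assoc[OF catX c(3) rz(3) c(2)] pm ez(2,3) ew(2,3) c2(2) by simp
    qed
    have "?u1 \<in> Arr (fibre E A)" "?u2 \<in> Arr (fibre E C)" using c1 c2 by (auto simp: hom_def)
    then have "fA (RR E A C \<bullet> LL E A C) u = prodmap K ?u1 ?u2"
      using a by (simp add: fcomp_def fl RR_simps)
    then show "nc (eta E A C) (Cod X u) \<cdot>\<^bsub>X\<^esub> fA (fid (fibre E (prd L A C))) u =
       fA (RR E A C \<bullet> LL E A C) u \<cdot>\<^bsub>X\<^esub> nc (eta E A C) (Dom X u)"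
      using eq a by (simp add: fid_def zw)
  qed
qed

lemma eps_ntrans:
  assumes ab: "A \<in> Obj B" "C \<in> Obj B"
  shows "is_ntrans (eps E A C)"
proof -
  let ?S = "prod_cat (fibre E A) (fibre E C)"
  note fl = functor_LL[OF ab]
  have s: "nsrc (eps E A C) = LL E A C \<bullet> RR E A C" "ntrg (eps E A C) = fid ?S"
    by (simp_all add: eps_def Let_def)
  have ss: "fsrc (LL E A C \<bullet> RR E A C) = ?S" "ftrg (LL E A C \<bullet> RR E A C) = ?S"
    by (simp_all add: fcomp_def fl RR_simps)
  note q = prd_in[OF fpL ab]
  show ?thesis
    unfolding is_ntrans_def Let_def s ss
  proof (intro conjI ballI)
    show "is_functor (fid ?S)" by (intro is_functor_fid category_prod_cat cat_fibre)
    show "is_functor (LL E A C \<bullet> RR E A C)"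
      by (rule is_functor_fcomp[OF functor_RR fl(1)]) (simp add: fl RR_simps)
    show "fsrc (fid ?S) = ?S" "ftrg (fid ?S) = ?S" by (simp_all add: fid_def)
    show "nc (eps E A C) \<in> extensional (Obj ?S)" by (simp add: eps_def Let_def)
  next
    fix p assume "p \<in> Obj ?S"
    then obtain x y where p: "p = (x, y)" "x \<in> Obj (fibre E A)" "y \<in> Obj (fibre E C)"
      by (auto simp: prod_cat_def)
    note e = eps_arr[OF ab p(2,3)]
    show "nc (eps E A C) p \<in> hom ?S (fO (LL E A C \<bullet> RR E A C) p) (fO (fid ?S) p)"
      using e p by (auto simp: fid_def fcomp_def fl RR_simps prod_cat_def hom_def split: prod.splits)
  next
    fix p assume p: "p \<in> Arr ?S"
    then obtain u v where uv: "p = (u, v)" "u \<in> Arr (fibre E A)" "v \<in> Arr (fibre E C)"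
      by (auto simp: prod_cat_def)
    define x x' y y' where d: "x = Dom X u" "x' = Cod X u" "y = Dom X v" "y' = Cod X v"
    have u: "u \<in> hom (fibre E A) x x'" and v: "v \<in> hom (fibre E C) y y'"
      using uv d by (auto simp: fib_Arr)
    have o: "x \<in> Obj (fibre E A)" "x' \<in> Obj (fibre E A)" "y \<in> Obj (fibre E C)" "y' \<in> Obj (fibre E C)"
      using category_ids[OF cat_fibre u] category_ids[OF cat_fibre v] by auto
    have oX: "x \<in> Obj X" "x' \<in> Obj X" "y \<in> Obj X" "y' \<in> Obj X" using o by (auto simp: fib_Obj)
    have X: "u \<in> hom X x x'" "v \<in> hom X y y'" using u v by (auto simp: fib_hom)
    note e = eps_arr[OF ab o(1,3)] and e' = eps_arr[OF ab o(2,4)]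
    note pm = prodmap[OF fpK X] and pf = prodmap_fibre[OF u v]
    note c1 = chg_arr[OF q(2) pf] and c2 = chg_arr[OF q(3) pf]
    have zo: "prd K x y \<in> Obj X" "PO (prd K x y) = prd L A C" "prd K x' y' \<in> Obj X"
      "PO (prd K x' y') = prd L A C" using e(5) e'(5) by (auto simp: fib_Obj)
    note l1 = lift[OF q(2) zo(1,2)] and l2 = lift[OF q(3) zo(1,2)]
      and l1' = lift[OF q(2) zo(3,4)] and l2' = lift[OF q(3) zo(3,4)]
    note r = prd_in[OF fpK oX(1,3)]
    have eX: "fst (nc (eps E A C) (x, y)) \<in> hom X (push E (pr1 L A C) (prd K x y)) x"
      "snd (nc (eps E A C) (x, y)) \<in> hom X (push E (pr2 L A C) (prd K x y)) y"
      "fst (nc (eps E A C) (x', y')) \<in> hom X (push E (pr1 L A C) (prd K x' y')) x'"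
      "snd (nc (eps E A C) (x', y')) \<in> hom X (push E (pr2 L A C) (prd K x' y')) y'"
      "fA (change_base E (pr1 L A C)) (prodmap K u v) \<in>
        hom X (push E (pr1 L A C) (prd K x y)) (push E (pr1 L A C) (prd K x' y'))"
      "fA (change_base E (pr2 L A C)) (prodmap K u v) \<in>
        hom X (push E (pr2 L A C) (prd K x y)) (push E (pr2 L A C) (prd K x' y'))"
      using e e' c1 c2 by (auto simp: fib_hom)
    have n1: "fst (nc (eps E A C) (x', y')) \<cdot>\<^bsub>X\<^esub> fA (change_base E (pr1 L A C)) (prodmap K u v)
        = u \<cdot>\<^bsub>X\<^esub> fst (nc (eps E A C) (x, y))"
    proof (rule cocart_cancel[OF l1(1,2) category_homI[OF catX eX(5,3)] category_homI[OF catX eX(1) X(1)]])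
      show "PA (fst (nc (eps E A C) (x', y')) \<cdot>\<^bsub>X\<^esub> fA (change_base E (pr1 L A C)) (prodmap K u v))
        = PA (u \<cdot>\<^bsub>X\<^esub> fst (nc (eps E A C) (x, y)))"
        using category_homI[OF cat_fibre c1(1) e'(1)] category_homI[OF cat_fibre e(1) u]
        by (simp add: fib_hom)
      show "(fst (nc (eps E A C) (x', y')) \<cdot>\<^bsub>X\<^esub> fA (change_base E (pr1 L A C)) (prodmap K u v)) \<cdot>\<^bsub>X\<^esub>
          lift E (pr1 L A C) (prd K x y) =
        (u \<cdot>\<^bsub>X\<^esub> fst (nc (eps E A C) (x, y))) \<cdot>\<^bsub>X\<^esub> lift E (pr1 L A C) (prd K x y)"
        using category_assoc[OF catX l1(2) eX(5) eX(3)] category_assoc[OF catX l1(2) eX(1) X(1)]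
          category_assoc[OF catX pm(1) l1'(2) eX(3)] c1(2) e(2) e'(2) pm(2) by simp
    qed
    have n2: "snd (nc (eps E A C) (x', y')) \<cdot>\<^bsub>X\<^esub> fA (change_base E (pr2 L A C)) (prodmap K u v)
        = v \<cdot>\<^bsub>X\<^esub> snd (nc (eps E A C) (x, y))"
    proof (rule cocart_cancel[OF l2(1,2) category_homI[OF catX eX(6,4)] category_homI[OF catX eX(2) X(2)]])
      show "PA (snd (nc (eps E A C) (x', y')) \<cdot>\<^bsub>X\<^esub> fA (change_base E (pr2 L A C)) (prodmap K u v))
        = PA (v \<cdot>\<^bsub>X\<^esub> snd (nc (eps E A C) (x, y)))"
        using category_homI[OF cat_fibre c2(1) e'(3)] category_homI[OF cat_fibre e(3) v]
        by (simp add: fib_hom)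
      show "(snd (nc (eps E A C) (x', y')) \<cdot>\<^bsub>X\<^esub> fA (change_base E (pr2 L A C)) (prodmap K u v)) \<cdot>\<^bsub>X\<^esub>
          lift E (pr2 L A C) (prd K x y) =
        (v \<cdot>\<^bsub>X\<^esub> snd (nc (eps E A C) (x, y))) \<cdot>\<^bsub>X\<^esub> lift E (pr2 L A C) (prd K x y)"
        using category_assoc[OF catX l2(2) eX(6) eX(4)] category_assoc[OF catX l2(2) eX(2) X(2)]
          category_assoc[OF catX pm(1) l2'(2) eX(4)] c2(2) e(4) e'(4) pm(3) by simp
    qed
    have "prodmap K u v \<in> Arr (fibre E (prd L A C))" using pf by (auto simp: hom_def)
    then have f: "fA (LL E A C \<bullet> RR E A C) p =
      (fA (change_base E (pr1 L A C)) (prodmap K u v), fA (change_base E (pr2 L A C)) (prodmap K u v))"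
      using uv p by (simp add: fcomp_def fl RR_simps)
    have cc: "Cod ?S p = (x', y')" "Dom ?S p = (x, y)" "fA (fid ?S) p = (u, v)"
      using uv d p by (simp_all add: prod_cat_def fid_def)
    have cp: "(a, b) \<cdot>\<^bsub>?S\<^esub> (a', b') = (a \<cdot>\<^bsub>X\<^esub> a', b \<cdot>\<^bsub>X\<^esub> b')" for a b a' b'
      by (simp add: prod_cat_def)
    show "nc (eps E A C) (Cod ?S p) \<cdot>\<^bsub>?S\<^esub> fA (LL E A C \<bullet> RR E A C) p =
      fA (fid ?S) p \<cdot>\<^bsub>?S\<^esub> nc (eps E A C) (Dom ?S p)"
      unfolding f cc using n1 n2
      by (cases "nc (eps E A C) (x', y')"; cases "nc (eps E A C) (x, y)") (simp add: cp)
  qed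
qed

lemma adjunction_LR:
  assumes ab: "A \<in> Obj B" "C \<in> Obj B"
  shows "adjunction (LL E A C) (RR E A C) (eta E A C) (eps E A C)"
proof -
  let ?S = "prod_cat (fibre E A) (fibre E C)"
  note fl = functor_LL[OF ab] and q = prd_in[OF fpL ab]
  have cp: "(a, b) \<cdot>\<^bsub>?S\<^esub> (a', b') = (a \<cdot>\<^bsub>X\<^esub> a', b \<cdot>\<^bsub>X\<^esub> b')" for a b a' b'
    by (simp add: prod_cat_def)
  show ?thesis
    unfolding adjunction_def fl(2,3)
  proof (intro conjI ballI fl(1) functor_RR RR_simps(1,2) eta_ntrans eps_ntrans ab)
    show "nsrc (eta E A C) = fid (fibre E (prd L A C))" "ntrg (eta E A C) = RR E A C \<bullet> LL E A C"
      "nsrc (eps E A C) = LL E A C \<bullet> RR E A C" "ntrg (eps E A C) = fid ?S"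
      by (simp_all add: eta_def eps_def Let_def)
  next
    fix z assume z: "z \<in> Obj (fibre E (prd L A C))"
    let ?x = "push E (pr1 L A C) z" and ?y = "push E (pr2 L A C) z"
    have z': "z \<in> Obj X" "PO z = prd L A C" using z by (auto simp: fib_Obj)
    note l1 = lift[OF q(2) z'] and l2 = lift[OF q(3) z']
    note n = eta_arr[OF ab z]
    note e = eps_arr[OF ab n(4,5)]
    have p': "prd K ?x ?y \<in> Obj X" "PO (prd K ?x ?y) = prd L A C" using e(5) by (auto simp: fib_Obj)
    note m1 = lift[OF q(2) p'] and m2 = lift[OF q(3) p']
    note c1 = chg_arr[OF q(2) n(1)] and c2 = chg_arr[OF q(3) n(1)]
    note f1 = category_homI[OF cat_fibre c1(1) e(1), simplified]
      and f2 = category_homI[OF cat_fibre c2(1) e(3), simplified]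
    have hX: "nc (eta E A C) z \<in> hom X z (prd K ?x ?y)"
      "fA (change_base E (pr1 L A C)) (nc (eta E A C) z) \<in> hom X ?x (push E (pr1 L A C) (prd K ?x ?y))"
      "fA (change_base E (pr2 L A C)) (nc (eta E A C) z) \<in> hom X ?y (push E (pr2 L A C) (prd K ?x ?y))"
      "fst (nc (eps E A C) (?x, ?y)) \<in> hom X (push E (pr1 L A C) (prd K ?x ?y)) ?x"
      "snd (nc (eps E A C) (?x, ?y)) \<in> hom X (push E (pr2 L A C) (prd K ?x ?y)) ?y"
      using n c1 c2 e by (auto simp: fib_hom)
    have 1: "fst (nc (eps E A C) (?x, ?y)) \<cdot>\<^bsub>X\<^esub> fA (change_base E (pr1 L A C)) (nc (eta E A C) z)
        = idn X ?x"
    proof (rule cocart_cancel[OF l1(1,2)])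
      show "(fst (nc (eps E A C) (?x, ?y)) \<cdot>\<^bsub>X\<^esub> fA (change_base E (pr1 L A C)) (nc (eta E A C) z)) \<cdot>\<^bsub>X\<^esub>
          lift E (pr1 L A C) z = idn X ?x \<cdot>\<^bsub>X\<^esub> lift E (pr1 L A C) z"
        using category_assoc[OF catX l1(2) hX(2,4)] category_assoc[OF catX hX(1) m1(2) hX(4)]
          c1(2) e(2) n(2) category_ids[OF catX l1(2)] by simp
    qed (use f1 PA_id[OF l1(5)] l1(4) category_ids[OF catX l1(2)] in \<open>auto simp: fib_hom\<close>)
    have 2: "snd (nc (eps E A C) (?x, ?y)) \<cdot>\<^bsub>X\<^esub> fA (change_base E (pr2 L A C)) (nc (eta E A C) z)
        = idn X ?y"
    proof (rule cocart_cancel[OF l2(1,2)])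
      show "(snd (nc (eps E A C) (?x, ?y)) \<cdot>\<^bsub>X\<^esub> fA (change_base E (pr2 L A C)) (nc (eta E A C) z)) \<cdot>\<^bsub>X\<^esub>
          lift E (pr2 L A C) z = idn X ?y \<cdot>\<^bsub>X\<^esub> lift E (pr2 L A C) z"
        using category_assoc[OF catX l2(2) hX(3,5)] category_assoc[OF catX hX(1) m2(2) hX(5)]
          c2(2) e(4) n(3) category_ids[OF catX l2(2)] by simp
    qed (use f2 PA_id[OF l2(5)] l2(4) category_ids[OF catX l2(2)] in \<open>auto simp: fib_hom\<close>)
    have a: "nc (eta E A C) z \<in> Arr (fibre E (prd L A C))" using n(1) by (auto simp: hom_def)
    show "nc (eps E A C) (fO (LL E A C) z) \<cdot>\<^bsub>?S\<^esub> fA (LL E A C) (nc (eta E A C) z)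
        = idn ?S (fO (LL E A C) z)"
      unfolding fl(4)[OF z] fl(5)[OF a] using 1 2
      by (cases "nc (eps E A C) (?x, ?y)") (simp add: cp, simp add: prod_cat_def)
  next
    fix p assume "p \<in> Obj ?S"
    then obtain x y where p: "p = (x, y)" "x \<in> Obj (fibre E A)" "y \<in> Obj (fibre E C)"
      by (auto simp: prod_cat_def)
    note e = eps_arr[OF ab p(2,3)]
    note n = eta_arr[OF ab e(5)]
    let ?z = "prd K x y"
    have o: "x \<in> Obj X" "y \<in> Obj X" "push E (pr1 L A C) ?z \<in> Obj X" "push E (pr2 L A C) ?z \<in> Obj X"
      using p n by (auto simp: fib_Obj)
    have hX: "fst (nc (eps E A C) (x, y)) \<in> hom X (push E (pr1 L A C) ?z) x"
      "snd (nc (eps E A C) (x, y)) \<in> hom X (push E (pr2 L A C) ?z) y"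
      "nc (eta E A C) ?z \<in> hom X ?z (prd K (push E (pr1 L A C) ?z) (push E (pr2 L A C) ?z))"
      using e n by (auto simp: fib_hom)
    note pm = prodmap[OF fpK hX(1,2)]
    note r = prd_in[OF fpK o(1,2)] and r' = prd_in[OF fpK o(3,4)]
    have eq: "prodmap K (fst (nc (eps E A C) (x, y))) (snd (nc (eps E A C) (x, y))) \<cdot>\<^bsub>X\<^esub> nc (eta E A C) ?z
        = idn X ?z"
    proof (rule prd_ext[OF fpK o(1,2) category_homI[OF catX hX(3) pm(1)] category_ids(3)[OF catX r(2)]])
      show "pr1 K x y \<cdot>\<^bsub>X\<^esub> prodmap K (fst (nc (eps E A C) (x, y))) (snd (nc (eps E A C) (x, y)))
          \<cdot>\<^bsub>X\<^esub> nc (eta E A C) ?z = pr1 K x y \<cdot>\<^bsub>X\<^esub> idn X ?z"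
        using category_assoc[OF catX hX(3) pm(1) r(2)] category_assoc[OF catX hX(3) r'(2) hX(1)]
          pm e n(2) category_ids[OF catX r(2)] by simp
      show "pr2 K x y \<cdot>\<^bsub>X\<^esub> prodmap K (fst (nc (eps E A C) (x, y))) (snd (nc (eps E A C) (x, y)))
          \<cdot>\<^bsub>X\<^esub> nc (eta E A C) ?z = pr2 K x y \<cdot>\<^bsub>X\<^esub> idn X ?z"
        using category_assoc[OF catX hX(3) pm(1) r(3)] category_assoc[OF catX hX(3) r'(3) hX(2)]
          pm e n(3) category_ids[OF catX r(3)] by simp
    qed
    have "fst (nc (eps E A C) (x, y)) \<in> Arr (fibre E A)" "snd (nc (eps E A C) (x, y)) \<in> Arr (fibre E C)"
      using e by (auto simp: hom_def)
    then have "fA (RR E A C) (nc (eps E A C) p) =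
        prodmap K (fst (nc (eps E A C) (x, y))) (snd (nc (eps E A C) (x, y)))"
      using RR_simps(4) p by (metis prod.collapse)
    then show "fA (RR E A C) (nc (eps E A C) p) \<cdot>\<^bsub>fibre E (prd L A C)\<^esub> nc (eta E A C) (fO (RR E A C) p)
        = idn (fibre E (prd L A C)) (fO (RR E A C) p)"
      using eq p by (simp add: RR_simps)
  qed
qed

lemma adjunction_LR1: "adjunction (L1 E) (R1 E) (eta1 E) (eps1 E)"
proof -
  let ?S = "fibre E (one L)"
  have o: "one K \<in> Obj X" using fpK by (simp add: finite_products_def Let_def)
  have oL: "one L \<in> Obj B" using fpL by (simp add: finite_products_def Let_def)
  have oS: "one K \<in> Obj ?S" using o P_one by (simp add: fib_Obj)
  have iS: "idn X (one K) \<in> hom ?S (one K) (one K)"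
    using category_idI[OF cat_fibre oS] by simp
  have iL: "idn B (one L) \<in> hom B (one L) (one L)" by (rule category_idI[OF catB oL])
  have ii: "idn X (one K) \<cdot>\<^bsub>X\<^esub> idn X (one K) = idn X (one K)"
    using category_ids[OF cat_fibre iS] by simp
  have fL: "is_functor (L1 E)"
    using cat_fibre[of "one L"] category_terminal_cat
    by (auto simp: is_functor_def L1_def Let_def terminal_cat_def hom_def)
  have fR: "is_functor (R1 E)"
    using cat_fibre[of "one L"] category_terminal_cat oS iS ii
    by (auto simp: is_functor_def R1_def Let_def terminal_cat_def extensional_def)
  have s: "fsrc (L1 E) = ?S" "ftrg (L1 E) = terminal_cat" "fsrc (R1 E) = terminal_cat"
    "ftrg (R1 E) = ?S" "\<And>t. fO (R1 E) t = one K" "\<And>t. fA (R1 E) t = idn X (one K)"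
    by (auto simp: L1_def R1_def Let_def)
  have t: "term_map K x \<in> hom ?S x (one K)" if "x \<in> Obj ?S" for x
  proof -
    have x: "x \<in> Obj X" "PO x = one L" using that by (auto simp: fib_Obj)
    note tm = term_map(1)[OF fpK x(1)]
    have "PA (term_map K x) \<in> hom B (one L) (one L)" using PA_hom[OF tm] x P_one by simp
    then have "PA (term_map K x) = idn B (one L)" using term_map(2)[OF fpL oL] iL by metis
    then show ?thesis using tm x P_one by (simp add: fib_hom)
  qed
  have nt: "is_ntrans (eta1 E)"
  proof -
    have "is_functor (R1 E \<bullet> L1 E)" by (rule is_functor_fcomp[OF fL fR]) (simp add: s)
    moreover have "term_map K (Cod X u) \<cdot>\<^bsub>X\<^esub> u = idn X (one K) \<cdot>\<^bsub>X\<^esub> term_map K (Dom X u)"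
      if "u \<in> Arr ?S" for u
    proof -
      have u: "u \<in> hom ?S (Dom X u) (Cod X u)" using that by (simp add: fib_Arr)
      note ob = category_ids(1,2)[OF cat_fibre u]
      note a = category_homI[OF cat_fibre u t[OF ob(2)], simplified]
      then have "term_map K (Cod X u) \<cdot>\<^bsub>X\<^esub> u = term_map K (Dom X u)"
        using term_map(2)[OF fpK] ob by (simp add: fib_hom fib_Obj)
      then show ?thesis using category_ids(6)[OF cat_fibre t[OF ob(1)]] by simp
    qed
    moreover have "Dom X u \<in> Obj ?S \<and> Cod X u \<in> Obj ?S" if "u \<in> Arr ?S" for u
      using cat_fibre[of "one L"] that by (simp add: category_def)
    ultimately show ?thesis
      using is_functor_fid[OF cat_fibre[of "one L"]] t
      by (auto simp: is_ntrans_def eta1_def Let_def fid_def fcomp_def s)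
  qed
  have ne: "is_ntrans (eps1 E)"
    using is_functor_fcomp[OF fR fL] is_functor_fid[OF category_terminal_cat]
    by (auto simp: is_ntrans_def eps1_def Let_def fid_def fcomp_def s terminal_cat_def hom_def
        extensional_def)
  have to: "term_map K (one K) = idn X (one K)"
    using term_map(2)[OF fpK o, of "idn X (one K)"] iS by (simp add: fib_hom)
  show ?thesis
    unfolding adjunction_def using fL fR nt ne
    by (simp add: s eta1_def eps1_def Let_def oS to ii)
qed

end

end

theory Submission
  imports Defs
begin

text \<open>
  The terminal object and the square \<open>A \<times> A\<close> of a group \<open>A\<close> are internal groups. If \<open>F\<close> is groupal,
  their fibres are groupoids, and the components of the units \<open>\<eta>\<^sup>1\<close> and \<open>\<eta>\<^sup>A\<^sup>,\<^sup>A\<close> are arrows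
  of these fibres, so they are invertible.

  Conversely, if these units are invertible, then terminal maps, and hence projections, are
  cocartesian, and so is the diagonal \<open>x \<rightarrow> x \<times> x\<close> of every object over a group. Thus
  \<open>x \<rightarrow> x \<times> i\<^sub>*x \<rightarrow> x \<otimes> i\<^sub>*x\<close> and \<open>x \<rightarrow> I \<rightarrow> e\<^sub>*I\<close> are cocartesian
  over the same arrow, which gives weak inverses, and vertical arrows are inverted by means of the
  operation \<open>a b\<^sup>-\<^sup>1 c\<close>. The coherence axioms hold without any hypothesis on the units. They are
  equations between vertical arrows, so they can be tested by precomposing with cocartesian
  arrows. On generalized elements, the associativity constraint is the map \<open>(a b) c \<mapsto> a (b c)\<close>, and
  similarly for the other structure maps, which makes every coherence axiom a direct computation.
\<close>

section \<open>Calculus of finite products and internal groups\<close>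

text \<open>The obstacle to inverting a vertical arrow \<open>u : x \<rightarrow> y\<close> is that
  the operations of the group lead out of the given objects: a product of objects over
  \<open>A\<close> lies over \<open>A \<times> A\<close>, and its pushforward along an operation is
  a new object over \<open>A\<close>, neither \<open>x\<close> nor \<open>y\<close>. The two Mal'cev
  identities of \<open>k a b c\<close> lead back. Because \<open>k b b a = a\<close>, the
  pushforward of \<open>(y \<times> y) \<times> x\<close> along \<open>k\<close> receives a
  cocartesian arrow from \<open>y \<times> x\<close> over the second projection, as soon as the
  diagonal of \<open>y\<close> is cocartesian; it therefore has a vertical map to \<open>x\<close>
  itself. Because \<open>k b a a = b\<close>, the candidate inverse lies over the first projection
  and can be descended to \<open>y\<close>. This gives one-sided inverses only, but for all vertical
  arrows at once, which is enough.

  Testing coherence on elements works because products of cocartesian arrows are cocartesian: an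
  iterated tensor product is the target of a cocartesian arrow out of the product bracketed in the
  same way, so its elements may be taken to be formal products of elements of the factors.\<close>

declare hom_def [simp]

lemma iso_iff_inverse: "iso C f \<longleftrightarrow> f \<in> Arr C \<and> (\<exists>g. g \<in> Arr C \<and> Dom C g = Cod C f \<and> Cod C g = Dom C f \<and>
   g \<cdot>\<^bsub>C\<^esub> f = idn C (Dom C f) \<and> f \<cdot>\<^bsub>C\<^esub> g = idn C (Cod C f))"
  by (auto simp: iso_def)

lemma iso_inverse:
  assumes "iso C f"
  obtains g where "iso C g" "Dom C g = Cod C f" "Cod C g = Dom C f" "g \<cdot>\<^bsub>C\<^esub> f = idn C (Dom C f)"
  using assms unfolding iso_iff_inverse by metis

locale cat_calc =
  fixes C :: "('o, 'a) cat"
  assumes cat: "category C"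
begin

text \<open>The last rule makes right-nested composites the normal form. Later evaluation rules
  therefore carry a trailing arrow, so that they apply in the middle of a composite.\<close>

lemma arr_simps [simp]:
  "f \<in> Arr C \<Longrightarrow> Dom C f \<in> Obj C" "f \<in> Arr C \<Longrightarrow> Cod C f \<in> Obj C"
  "x \<in> Obj C \<Longrightarrow> idn C x \<in> Arr C" "x \<in> Obj C \<Longrightarrow> Dom C (idn C x) = x" "x \<in> Obj C \<Longrightarrow> Cod C (idn C x) = x"
  "f \<in> Arr C \<Longrightarrow> g \<in> Arr C \<Longrightarrow> Dom C g = Cod C f \<Longrightarrow> g \<cdot>\<^bsub>C\<^esub> f \<in> Arr C"
  "f \<in> Arr C \<Longrightarrow> g \<in> Arr C \<Longrightarrow> Dom C g = Cod C f \<Longrightarrow> Dom C (g \<cdot>\<^bsub>C\<^esub> f) = Dom C f"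
  "f \<in> Arr C \<Longrightarrow> g \<in> Arr C \<Longrightarrow> Dom C g = Cod C f \<Longrightarrow> Cod C (g \<cdot>\<^bsub>C\<^esub> f) = Cod C g"
  "f \<in> Arr C \<Longrightarrow> Dom C f = x \<Longrightarrow> f \<cdot>\<^bsub>C\<^esub> idn C x = f"
  "f \<in> Arr C \<Longrightarrow> Cod C f = x \<Longrightarrow> idn C x \<cdot>\<^bsub>C\<^esub> f = f"
  "f \<in> Arr C \<Longrightarrow> g \<in> Arr C \<Longrightarrow> h \<in> Arr C \<Longrightarrow> Dom C g = Cod C f \<Longrightarrow> Dom C h = Cod C g \<Longrightarrow>
    (h \<cdot>\<^bsub>C\<^esub> g) \<cdot>\<^bsub>C\<^esub> f = h \<cdot>\<^bsub>C\<^esub> (g \<cdot>\<^bsub>C\<^esub> f)"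
  using cat unfolding category_def by auto

end

locale fprod =
  fixes K :: "('o, 'a) cart"
  assumes fp: "finite_products K"
begin

abbreviation "\<C> \<equiv> ccat K"

sublocale cat_calc "ccat K"
  using fp by unfold_locales (simp add: finite_products_def Let_def)

lemma one_simps [simp]: "one K \<in> Obj \<C>"
  "x \<in> Obj \<C> \<Longrightarrow> term_map K x \<in> Arr \<C>" "x \<in> Obj \<C> \<Longrightarrow> Dom \<C> (term_map K x) = x"
  "x \<in> Obj \<C> \<Longrightarrow> Cod \<C> (term_map K x) = one K"
  using fp term_map(1)[OF fp, of x] by (auto simp: finite_products_def Let_def)

lemma to_one: "f \<in> Arr \<C> \<Longrightarrow> Cod \<C> f = one K \<Longrightarrow> f = term_map K (Dom \<C> f)"
  using term_map(2)[OF fp] by simp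

lemma term_comp [simp]: "f \<in> Arr \<C> \<Longrightarrow> Cod \<C> f = x \<Longrightarrow> term_map K x \<cdot>\<^bsub>\<C>\<^esub> f = term_map K (Dom \<C> f)"
  using to_one[of "term_map K x \<cdot>\<^bsub>\<C>\<^esub> f"] by auto

lemma prd_simps [simp]:
  assumes "x \<in> Obj \<C>" "y \<in> Obj \<C>"
  shows "prd K x y \<in> Obj \<C>" "pr1 K x y \<in> Arr \<C>" "Dom \<C> (pr1 K x y) = prd K x y" "Cod \<C> (pr1 K x y) = x"
    "pr2 K x y \<in> Arr \<C>" "Dom \<C> (pr2 K x y) = prd K x y" "Cod \<C> (pr2 K x y) = y"
  using prd_in[OF fp assms] by auto

lemma pairing_simps [simp]:
  assumes "f \<in> Arr \<C>" "g \<in> Arr \<C>" "Dom \<C> f = Dom \<C> g"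
  shows "pairing K f g \<in> Arr \<C>" "Dom \<C> (pairing K f g) = Dom \<C> g"
    "Cod \<C> (pairing K f g) = prd K (Cod \<C> f) (Cod \<C> g)"
    "x = Cod \<C> f \<Longrightarrow> y = Cod \<C> g \<Longrightarrow> pr1 K x y \<cdot>\<^bsub>\<C>\<^esub> pairing K f g = f"
    "x = Cod \<C> f \<Longrightarrow> y = Cod \<C> g \<Longrightarrow> pr2 K x y \<cdot>\<^bsub>\<C>\<^esub> pairing K f g = g"
  using pairing(1-3)[OF fp, of f "Dom \<C> g" "Cod \<C> f" g "Cod \<C> g"] assms by auto

lemma pairing_eta [simp]:
  assumes "h \<in> Arr \<C>" "x \<in> Obj \<C>" "y \<in> Obj \<C>" "Cod \<C> h = prd K x y"
  shows "pairing K (pr1 K x y \<cdot>\<^bsub>\<C>\<^esub> h) (pr2 K x y \<cdot>\<^bsub>\<C>\<^esub> h) = h"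
  by (rule pairing(4)[OF fp, symmetric, where z = "Dom \<C> h" and x = x and y = y]) (use assms in auto)

lemma pairing_eta_id [simp]:
  assumes "x \<in> Obj \<C>" "y \<in> Obj \<C>"
  shows "pairing K (pr1 K x y) (pr2 K x y) = idn \<C> (prd K x y)"
  using pairing_eta[of "idn \<C> (prd K x y)" x y] assms by simp

text \<open>Together with the projection laws this turns every arrow into an iterated product into a
  tuple of generalized elements.\<close>

lemma pairing_comp [simp]:
  assumes "f \<in> Arr \<C>" "g \<in> Arr \<C>" "Dom \<C> f = Dom \<C> g" "t \<in> Arr \<C>" "Cod \<C> t = Dom \<C> g"
  shows "pairing K f g \<cdot>\<^bsub>\<C>\<^esub> t = pairing K (f \<cdot>\<^bsub>\<C>\<^esub> t) (g \<cdot>\<^bsub>\<C>\<^esub> t)"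
proof (rule pairing(4)[OF fp, where z = "Dom \<C> t" and x = "Cod \<C> f" and y = "Cod \<C> g"])
  \<comment> \<open>Bracketed to the left, the projection meets the pairing and cancels; the
    right-nested normal form hides this redex.\<close>
  have "pr1 K (Cod \<C> f) (Cod \<C> g) \<cdot>\<^bsub>\<C>\<^esub> pairing K f g \<cdot>\<^bsub>\<C>\<^esub> t =
      (pr1 K (Cod \<C> f) (Cod \<C> g) \<cdot>\<^bsub>\<C>\<^esub> pairing K f g) \<cdot>\<^bsub>\<C>\<^esub> t"
    using assms by (subst arr_simps(11)) auto
  then show "pr1 K (Cod \<C> f) (Cod \<C> g) \<cdot>\<^bsub>\<C>\<^esub> pairing K f g \<cdot>\<^bsub>\<C>\<^esub> t = f \<cdot>\<^bsub>\<C>\<^esub> t"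
    using assms by simp
  have "pr2 K (Cod \<C> f) (Cod \<C> g) \<cdot>\<^bsub>\<C>\<^esub> pairing K f g \<cdot>\<^bsub>\<C>\<^esub> t =
      (pr2 K (Cod \<C> f) (Cod \<C> g) \<cdot>\<^bsub>\<C>\<^esub> pairing K f g) \<cdot>\<^bsub>\<C>\<^esub> t"
    using assms by (subst arr_simps(11)) auto
  then show "pr2 K (Cod \<C> f) (Cod \<C> g) \<cdot>\<^bsub>\<C>\<^esub> pairing K f g \<cdot>\<^bsub>\<C>\<^esub> t = g \<cdot>\<^bsub>\<C>\<^esub> t"
    using assms by simp
qed (use assms in auto)

lemma prodmap_eq:
  "f \<in> Arr \<C> \<Longrightarrow> g \<in> Arr \<C> \<Longrightarrow> prodmap K f g =
    pairing K (f \<cdot>\<^bsub>\<C>\<^esub> pr1 K (Dom \<C> f) (Dom \<C> g)) (g \<cdot>\<^bsub>\<C>\<^esub> pr2 K (Dom \<C> f) (Dom \<C> g))"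
  by (simp add: prodmap_def Let_def)

lemma prodmap_simps [simp]:
  assumes "f \<in> Arr \<C>" "g \<in> Arr \<C>"
  shows "prodmap K f g \<in> Arr \<C>" "Dom \<C> (prodmap K f g) = prd K (Dom \<C> f) (Dom \<C> g)"
    "Cod \<C> (prodmap K f g) = prd K (Cod \<C> f) (Cod \<C> g)"
  using assms by (simp_all add: prodmap_eq)

lemma prodmap_pairing [simp]:
  assumes "f \<in> Arr \<C>" "g \<in> Arr \<C>" "a \<in> Arr \<C>" "b \<in> Arr \<C>" "Dom \<C> a = Dom \<C> b"
    "Cod \<C> a = Dom \<C> f" "Cod \<C> b = Dom \<C> g"
  shows "prodmap K f g \<cdot>\<^bsub>\<C>\<^esub> pairing K a b = pairing K (f \<cdot>\<^bsub>\<C>\<^esub> a) (g \<cdot>\<^bsub>\<C>\<^esub> b)"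
  using assms by (simp add: prodmap_eq)

lemma prod_assoc_simps [simp]:
  assumes "x \<in> Obj \<C>" "y \<in> Obj \<C>" "z \<in> Obj \<C>"
  shows "prod_assoc K x y z \<in> Arr \<C>" "Dom \<C> (prod_assoc K x y z) = prd K (prd K x y) z"
    "Cod \<C> (prod_assoc K x y z) = prd K x (prd K y z)"
  using assms by (simp_all add: prod_assoc_def Let_def)

lemma prod_assoc_pairing [simp]:
  assumes "a \<in> Arr \<C>" "b \<in> Arr \<C>" "c \<in> Arr \<C>" "Dom \<C> a = Dom \<C> c" "Dom \<C> b = Dom \<C> c"
    "Cod \<C> a = x" "Cod \<C> b = y" "Cod \<C> c = z"
  shows "prod_assoc K x y z \<cdot>\<^bsub>\<C>\<^esub> pairing K (pairing K a b) c = pairing K a (pairing K b c)"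
  using assms by (auto simp add: prod_assoc_def Let_def)

lemma iso_prod_assoc:
  assumes "x \<in> Obj \<C>" "y \<in> Obj \<C>" "z \<in> Obj \<C>"
  shows "iso \<C> (prod_assoc K x y z)"
proof -
  define h where "h = pairing K (pairing K (pr1 K x (prd K y z)) (pr1 K y z \<cdot>\<^bsub>\<C>\<^esub> pr2 K x (prd K y z)))
     (pr2 K y z \<cdot>\<^bsub>\<C>\<^esub> pr2 K x (prd K y z))"
  have [simp]: "h \<in> Arr \<C>" "Dom \<C> h = prd K x (prd K y z)" "Cod \<C> h = prd K (prd K x y) z"
    using assms by (simp_all add: h_def)
  have 1: "prod_assoc K x y z \<cdot>\<^bsub>\<C>\<^esub> h = idn \<C> (prd K x (prd K y z))"
    using assms by (simp add: h_def)
  have 2: "h \<cdot>\<^bsub>\<C>\<^esub> prod_assoc K x y z = idn \<C> (prd K (prd K x y) z)"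
    using assms by (simp add: h_def prod_assoc_def Let_def)
  show ?thesis unfolding iso_iff_inverse using assms 1 2 by (auto intro!: exI[of _ h])
qed

lemma iso_pr_one:
  assumes "x \<in> Obj \<C>"
  shows "iso \<C> (pr1 K x (one K))" "iso \<C> (pr2 K (one K) x)"
proof -
  have "term_map K (prd K x (one K)) = pr2 K x (one K)" "term_map K (prd K (one K) x) = pr1 K (one K) x"
    using assms to_one[of "pr2 K x (one K)"] to_one[of "pr1 K (one K) x"] by simp_all
  note t = this
  show "iso \<C> (pr1 K x (one K))"
    unfolding iso_iff_inverse using assms t(1)
        by (auto intro!: exI[of _ "pairing K (idn \<C> x) (term_map K x)"])
  show "iso \<C> (pr2 K (one K) x)"
    unfolding iso_iff_inverse using assms t(2)
        by (auto intro!: exI[of _ "pairing K (term_map K x) (idn \<C> x)"])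
qed

end

section \<open>Monoid and group objects computed on generalized elements\<close>

locale monoid_obj = fprod K for K :: "('o, 'a) cart" +
  fixes A :: 'o and m e :: 'a
  assumes mon: "monoid_object K A m e"
begin

lemma m_simps [simp]:
  "A \<in> Obj \<C>" "m \<in> Arr \<C>" "Dom \<C> m = prd K A A" "Cod \<C> m = A"
  "e \<in> Arr \<C>" "Dom \<C> e = one K" "Cod \<C> e = A"
  using mon by (auto simp: monoid_object_def Let_def)

lemma m_laws:
  "m \<cdot>\<^bsub>\<C>\<^esub> prodmap K m (idn \<C> A) = m \<cdot>\<^bsub>\<C>\<^esub> prodmap K (idn \<C> A) m \<cdot>\<^bsub>\<C>\<^esub> prod_assoc K A A A"
  "m \<cdot>\<^bsub>\<C>\<^esub> prodmap K e (idn \<C> A) = pr2 K (one K) A"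
  "m \<cdot>\<^bsub>\<C>\<^esub> prodmap K (idn \<C> A) e = pr1 K A (one K)"
  using mon by (auto simp: monoid_object_def Let_def)

text \<open>Precomposing the axiom with the tuple \<open>((a, b), c)\<close> gives the law for
  arbitrary elements of \<open>A\<close>.\<close>

lemma mul_assoc:
  assumes "a \<in> Arr \<C>" "b \<in> Arr \<C>" "c \<in> Arr \<C>" "Dom \<C> a = Dom \<C> c" "Dom \<C> b = Dom \<C> c"
    "Cod \<C> a = A" "Cod \<C> b = A" "Cod \<C> c = A"
  shows "m \<cdot>\<^bsub>\<C>\<^esub> pairing K (m \<cdot>\<^bsub>\<C>\<^esub> pairing K a b) c = m \<cdot>\<^bsub>\<C>\<^esub> pairing K a (m \<cdot>\<^bsub>\<C>\<^esub> pairing K b c)"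
  using arg_cong[OF m_laws(1), of "\<lambda>f. f \<cdot>\<^bsub>\<C>\<^esub> pairing K (pairing K a b) c"] assms by simp

lemma mul_unit:
  assumes "a \<in> Arr \<C>" "Cod \<C> a = A" "Dom \<C> a = t"
  shows "m \<cdot>\<^bsub>\<C>\<^esub> pairing K (e \<cdot>\<^bsub>\<C>\<^esub> term_map K t) a = a"
    "m \<cdot>\<^bsub>\<C>\<^esub> pairing K a (e \<cdot>\<^bsub>\<C>\<^esub> term_map K t) = a"
  using arg_cong[OF m_laws(2), of "\<lambda>f. f \<cdot>\<^bsub>\<C>\<^esub> pairing K (term_map K (Dom \<C> a)) a"]
    arg_cong[OF m_laws(3), of "\<lambda>f. f \<cdot>\<^bsub>\<C>\<^esub> pairing K a (term_map K (Dom \<C> a))"] assms by auto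

end

locale group_obj = monoid_obj K A m e for K :: "('o, 'a) cart" and A m e +
  fixes i :: 'a
  assumes i_simps [simp]: "i \<in> Arr \<C>" "Dom \<C> i = A" "Cod \<C> i = A"
    and inv_law: "m \<cdot>\<^bsub>\<C>\<^esub> pairing K (idn \<C> A) i = e \<cdot>\<^bsub>\<C>\<^esub> term_map K A"
begin

lemma inv_right:
  assumes "a \<in> Arr \<C>" "Cod \<C> a = A"
  shows "m \<cdot>\<^bsub>\<C>\<^esub> pairing K a (i \<cdot>\<^bsub>\<C>\<^esub> a) = e \<cdot>\<^bsub>\<C>\<^esub> term_map K (Dom \<C> a)"
  using arg_cong[OF inv_law, of "\<lambda>f. f \<cdot>\<^bsub>\<C>\<^esub> a"] assms by simp

text \<open>A group object postulates right inverses only. With \<open>b\<close> the right inverse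
  of \<open>a\<close> and \<open>ib\<close> that of \<open>b\<close>, one has
  \<open>a = a (b ib) = (a b) ib = ib\<close>, hence \<open>b a = b ib = 1\<close>.\<close>

lemma inv_left:
  assumes a: "a \<in> Arr \<C>" "Cod \<C> a = A"
  shows "m \<cdot>\<^bsub>\<C>\<^esub> pairing K (i \<cdot>\<^bsub>\<C>\<^esub> a) a = e \<cdot>\<^bsub>\<C>\<^esub> term_map K (Dom \<C> a)"
proof -
  define b where "b = i \<cdot>\<^bsub>\<C>\<^esub> a"
  define u where "u = e \<cdot>\<^bsub>\<C>\<^esub> term_map K (Dom \<C> a)"
  define ib where "ib = i \<cdot>\<^bsub>\<C>\<^esub> b"
  have b: "b \<in> Arr \<C>" "Cod \<C> b = A" "Dom \<C> b = Dom \<C> a" using a by (auto simp: b_def)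
  have ib: "ib \<in> Arr \<C>" "Cod \<C> ib = A" "Dom \<C> ib = Dom \<C> a" using b by (auto simp: ib_def)
  have bb: "m \<cdot>\<^bsub>\<C>\<^esub> pairing K b ib = u" using inv_right[OF b(1,2)] b by (simp add: u_def ib_def)
  have ab: "m \<cdot>\<^bsub>\<C>\<^esub> pairing K a b = u" using inv_right[OF a] by (simp add: u_def b_def)
  have "m \<cdot>\<^bsub>\<C>\<^esub> pairing K b a = m \<cdot>\<^bsub>\<C>\<^esub> pairing K (m \<cdot>\<^bsub>\<C>\<^esub> pairing K b a) u"
    unfolding u_def by (rule mul_unit(2)[symmetric]) (use a b in auto)
  also have "\<dots> = m \<cdot>\<^bsub>\<C>\<^esub> pairing K b (m \<cdot>\<^bsub>\<C>\<^esub> pairing K a u)"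
    by (rule mul_assoc) (use a b in \<open>auto simp: u_def\<close>)
  also have "m \<cdot>\<^bsub>\<C>\<^esub> pairing K a u = m \<cdot>\<^bsub>\<C>\<^esub> pairing K (m \<cdot>\<^bsub>\<C>\<^esub> pairing K a b) ib"
    unfolding bb[symmetric] by (rule mul_assoc[symmetric]) (use a b ib in auto)
  also have "\<dots> = ib" unfolding ab unfolding u_def by (rule mul_unit) (use a ib in auto)
  finally show ?thesis using bb unfolding b_def u_def by simp
qed

end

lemma (in fprod) group_objI: "group_object K G \<Longrightarrow> group_obj K (gcar G) (gmul G) (gunit G) (ginv G)"
  by unfold_locales (auto simp: group_object_def Let_def monoid_object_def)

lemma (in fprod) trivial_group:
  "group_object K \<lparr>gcar = one K, gmul = term_map K (prd K (one K) (one K)), gunit =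
      idn \<C> (one K), ginv = idn \<C> (one K)\<rparr>"
proof -
  have "pr2 K (one K) (one K) = term_map K (prd K (one K) (one K))"
     "pr1 K (one K) (one K) = term_map K (prd K (one K) (one K))"
    using to_one[of "pr2 K (one K) (one K)"] to_one[of "pr1 K (one K) (one K)"] by simp_all
  then show ?thesis by (simp add: group_object_def monoid_object_def Let_def prodmap_eq)
qed

text \<open>All operations are componentwise. They stay existentially quantified because only the
  carrier, hence the fibre over it, matters later.\<close>

lemma (in group_obj) square_group:
  "\<exists>n u j. group_object K \<lparr>gcar = prd K A A, gmul = n, gunit = u, ginv = j\<rparr>"
proof -
  let ?P = "prd K A A"
  define n where "n = pairing K (m \<cdot>\<^bsub>\<C>\<^esub> pairing K (pr1 K A A \<cdot>\<^bsub>\<C>\<^esub> pr1 K ?P ?P) (pr1 K A A \<cdot>\<^bsub>\<C>\<^esub> pr2 K ?P ?P))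
     (m \<cdot>\<^bsub>\<C>\<^esub> pairing K (pr2 K A A \<cdot>\<^bsub>\<C>\<^esub> pr1 K ?P ?P) (pr2 K A A \<cdot>\<^bsub>\<C>\<^esub> pr2 K ?P ?P))"
  have [simp]: "n \<in> Arr \<C>" "Dom \<C> n = prd K ?P ?P" "Cod \<C> n = ?P" by (simp_all add: n_def)
  \<comment> \<open>With \<open>n\<close> kept folded, this rule evaluates the outer products first;
    the componentwise products are unfolded only afterwards.\<close>
  have n: "n \<cdot>\<^bsub>\<C>\<^esub> pairing K a b = pairing K (m \<cdot>\<^bsub>\<C>\<^esub> pairing K (pr1 K A A \<cdot>\<^bsub>\<C>\<^esub> a) (pr1 K A A \<cdot>\<^bsub>\<C>\<^esub> b))
      (m \<cdot>\<^bsub>\<C>\<^esub> pairing K (pr2 K A A \<cdot>\<^bsub>\<C>\<^esub> a) (pr2 K A A \<cdot>\<^bsub>\<C>\<^esub> b))"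
    if "a \<in> Arr \<C>" "b \<in> Arr \<C>" "Dom \<C> a = Dom \<C> b" "Cod \<C> a = ?P" "Cod \<C> b = ?P" for a b
    using that by (simp add: n_def)
  define u where "u = pairing K e e"
  define j where "j = prodmap K i i"
  have [simp]: "u \<in> Arr \<C>" "Dom \<C> u = one K" "Cod \<C> u = ?P" "j \<in> Arr \<C>" "Dom \<C> j = ?P" "Cod \<C> j = ?P"
    by (simp_all add: u_def j_def)
  have t: "pr1 K (one K) x = term_map K (prd K (one K) x)"
      "pr2 K x (one K) = term_map K (prd K x (one K))"
    if "x \<in> Obj \<C>" for x
    using to_one[of "pr1 K (one K) x"] to_one[of "pr2 K x (one K)"] that by simp_all
  have 1: "n \<cdot>\<^bsub>\<C>\<^esub> prodmap K n (idn \<C> ?P) = n \<cdot>\<^bsub>\<C>\<^esub> prodmap K (idn \<C> ?P) n \<cdot>\<^bsub>\<C>\<^esub> prod_assoc K ?P ?P ?P"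
    by (simp add: prodmap_eq prod_assoc_def Let_def n) (simp add: n_def mul_assoc)
  have 2: "n \<cdot>\<^bsub>\<C>\<^esub> prodmap K u (idn \<C> ?P) = pr2 K (one K) ?P"
    by (simp add: prodmap_eq n t) (simp add: u_def mul_unit)
  have 3: "n \<cdot>\<^bsub>\<C>\<^esub> prodmap K (idn \<C> ?P) u = pr1 K ?P (one K)"
    by (simp add: prodmap_eq n t) (simp add: u_def mul_unit)
  have 4: "n \<cdot>\<^bsub>\<C>\<^esub> pairing K (idn \<C> ?P) j = u \<cdot>\<^bsub>\<C>\<^esub> term_map K ?P"
    by (simp add: n) (simp add: u_def j_def prodmap_eq inv_right)
  have "group_object K \<lparr>gcar = ?P, gmul = n, gunit = u, ginv = j\<rparr>"
    by (simp add: group_object_def monoid_object_def Let_def 1 2 3 4)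
  then show ?thesis by blast
qed

section \<open>The category of internal groups\<close>

lemma (in fprod) group_cat_simps:
  "Obj (group_cat K) = {G. group_object K G}"
  "(G, f, H) \<in> Arr (group_cat K) \<longleftrightarrow> group_object K G \<and> group_object K H \<and> f \<in> Arr \<C> \<and> Dom \<C> f = gcar G \<and>
      Cod \<C> f = gcar H \<and>
    f \<cdot>\<^bsub>\<C>\<^esub> gmul G = gmul H \<cdot>\<^bsub>\<C>\<^esub> prodmap K f f \<and> f \<cdot>\<^bsub>\<C>\<^esub> gunit G = gunit H"
  "Dom (group_cat K) (G, f, H) = G" "Cod (group_cat K) (G, f, H) = H"
  "idn (group_cat K) G = (G, idn \<C> (gcar G), G)"
  "(G', g, H') \<cdot>\<^bsub>group_cat K\<^esub> (G, f, H) = (G, g \<cdot>\<^bsub>\<C>\<^esub> f, H')"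
  by (auto simp: group_cat_def Let_def)

lemma (in fprod) category_group_cat: "category (group_cat K)"
proof -
  have 1: "idn (group_cat K) G \<in> Arr (group_cat K)" if "group_object K G" for G
  proof -
    interpret group_obj K "gcar G" "gmul G" "gunit G" "ginv G" by (rule group_objI[OF that])
    show ?thesis using that by (simp add: group_cat_simps prodmap_eq)
  qed
  have 2: "(G, g \<cdot>\<^bsub>\<C>\<^esub> f, Q) \<in> Arr (group_cat K)" if f: "(G, f, H) \<in> Arr (group_cat K)"
      and g: "(H, g, Q) \<in> Arr (group_cat K)"
    for G f H g Q
  proof -
    have o: "group_object K G" "group_object K H" "group_object K Q" using f g
        by (auto simp: group_cat_simps)
    interpret G: group_obj K "gcar G" "gmul G" "gunit G" "ginv G" by (rule group_objI[OF o(1)])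
    interpret H: group_obj K "gcar H" "gmul H" "gunit H" "ginv H" by (rule group_objI[OF o(2)])
    interpret Q: group_obj K "gcar Q" "gmul Q" "gunit Q" "ginv Q" by (rule group_objI[OF o(3)])
    have f': "f \<in> Arr \<C>" "Dom \<C> f = gcar G" "Cod \<C> f = gcar H" "f \<cdot>\<^bsub>\<C>\<^esub> gmul G = gmul H \<cdot>\<^bsub>\<C>\<^esub> prodmap K f f"
        "f \<cdot>\<^bsub>\<C>\<^esub> gunit G = gunit H"
      and g': "g \<in> Arr \<C>" "Dom \<C> g = gcar H" "Cod \<C> g = gcar Q" "g \<cdot>\<^bsub>\<C>\<^esub> gmul H = gmul Q \<cdot>\<^bsub>\<C>\<^esub> prodmap K g g"
        "g \<cdot>\<^bsub>\<C>\<^esub> gunit H = gunit Q"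
      using f g by (auto simp: group_cat_simps)
    have "g \<cdot>\<^bsub>\<C>\<^esub> (gmul H \<cdot>\<^bsub>\<C>\<^esub> prodmap K f f) = (g \<cdot>\<^bsub>\<C>\<^esub> gmul H) \<cdot>\<^bsub>\<C>\<^esub> prodmap K f f"
      using f'(1-3) g'(1-3) by simp
    also have "\<dots> = gmul Q \<cdot>\<^bsub>\<C>\<^esub> prodmap K (g \<cdot>\<^bsub>\<C>\<^esub> f) (g \<cdot>\<^bsub>\<C>\<^esub> f)"
      unfolding g'(4) using f'(1-3) g'(1-3) by (simp add: prodmap_eq)
    finally show ?thesis using f' g' o by (simp add: group_cat_simps)
  qed
  show ?thesis
    unfolding category_def
  proof (intro conjI ballI impI)
    fix a assume a: "a \<in> Arr (group_cat K)"
    obtain G f H where [simp]: "a = (G, f, H)" by (cases a)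
    show "Dom (group_cat K) a \<in> Obj (group_cat K)" "Cod (group_cat K) a \<in> Obj (group_cat K)"
      "a \<cdot>\<^bsub>group_cat K\<^esub> idn (group_cat K) (Dom (group_cat K) a) = a"
      "idn (group_cat K) (Cod (group_cat K) a) \<cdot>\<^bsub>group_cat K\<^esub> a = a"
      using a by (auto simp: group_cat_simps)
    fix b assume b: "b \<in> Arr (group_cat K)" "Dom (group_cat K) b = Cod (group_cat K) a"
    obtain g Q where [simp]: "b = (H, g, Q)" using b by (cases b) (simp add: group_cat_simps)
    show "b \<cdot>\<^bsub>group_cat K\<^esub> a \<in> hom (group_cat K) (Dom (group_cat K) a) (Cod (group_cat K) b)"
      using 2[of G f H g Q] a b by (simp add: group_cat_simps(3-))
    fix c assume c: "c \<in> Arr (group_cat K)" "Dom (group_cat K) c = Cod (group_cat K) b"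
    obtain h R where [simp]: "c = (Q, h, R)" using c by (cases c) (simp add: group_cat_simps)
    show "c \<cdot>\<^bsub>group_cat K\<^esub> b \<cdot>\<^bsub>group_cat K\<^esub> a = (c \<cdot>\<^bsub>group_cat K\<^esub> b) \<cdot>\<^bsub>group_cat K\<^esub> a"
      using a b c by (simp add: group_cat_simps)
  next
    fix G assume "G \<in> Obj (group_cat K)"
    then show "idn (group_cat K) G \<in> hom (group_cat K) G G" using 1[of G]
        by (simp add: group_cat_simps(1,3-))
  qed
qed

section \<open>Cocartesian arrows and the monoidal structure on the fibres\<close>

context cmo begin

sublocale KK: fprod "tot E" by unfold_locales (rule fpK)
sublocale LB: fprod "base E" by unfold_locales (rule fpL)

lemma P_simps [simp]:
  "u \<in> Arr X \<Longrightarrow> PA u \<in> Arr B" "u \<in> Arr X \<Longrightarrow> Dom B (PA u) = PO (Dom X u)"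
  "u \<in> Arr X \<Longrightarrow> Cod B (PA u) = PO (Cod X u)"
  "x \<in> Obj X \<Longrightarrow> PO x \<in> Obj B" "x \<in> Obj X \<Longrightarrow> PA (idn X x) = idn B (PO x)"
  "u \<in> Arr X \<Longrightarrow> v \<in> Arr X \<Longrightarrow> Dom X v = Cod X u \<Longrightarrow> PA (v \<cdot>\<^bsub>X\<^esub> u) = PA v \<cdot>\<^bsub>B\<^esub> PA u"
  "x \<in> Obj X \<Longrightarrow> y \<in> Obj X \<Longrightarrow> PO (prd K x y) = prd L (PO x) (PO y)"
  "x \<in> Obj X \<Longrightarrow> y \<in> Obj X \<Longrightarrow> PA (pr1 K x y) = pr1 L (PO x) (PO y)"
  "x \<in> Obj X \<Longrightarrow> y \<in> Obj X \<Longrightarrow> PA (pr2 K x y) = pr2 L (PO x) (PO y)"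
  "PO (one K) = one L"
  using PA_hom[of u "Dom X u" "Cod X u"] PO_Obj PA_id PA_comp[of u "Dom X u"
      "Cod X u" v] P_prod P_one by auto

text \<open>Strict preservation of the projections forces this. It makes the base image of an
  expression in pairings the same expression in the base, so that equality of images becomes a
  computation there.\<close>

lemma PA_pairing [simp]:
  assumes "f \<in> Arr X" "g \<in> Arr X" "Dom X f = Dom X g"
  shows "PA (pairing K f g) = pairing L (PA f) (PA g)"
proof -
  have "pr1 L (PO (Cod X f)) (PO (Cod X g)) \<cdot>\<^bsub>B\<^esub> PA (pairing K f g) = PA f"
    using PA_comp[of "pairing K f g" "Dom X f" _ "pr1 K (Cod X f) (Cod X g)" "Cod X f"] assms by simp
  moreover have "pr2 L (PO (Cod X f)) (PO (Cod X g)) \<cdot>\<^bsub>B\<^esub> PA (pairing K f g) = PA g"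
    using PA_comp[of "pairing K f g" "Dom X f" _ "pr2 K (Cod X f) (Cod X g)" "Cod X g"] assms by simp
  ultimately show ?thesis
    using LB.pairing_eta[of "PA (pairing K f g)" "PO (Cod X f)" "PO (Cod X g)"] assms by simp
qed

lemma PA_prodmap [simp]: "f \<in> Arr X \<Longrightarrow> g \<in> Arr X \<Longrightarrow> PA (prodmap K f g) = prodmap L (PA f) (PA g)"
  by (simp add: KK.prodmap_eq LB.prodmap_eq)

lemma PA_prod_assoc [simp]:
  "x \<in> Obj X \<Longrightarrow> y \<in> Obj X \<Longrightarrow> z \<in> Obj X \<Longrightarrow> PA (prod_assoc K x y z) = prod_assoc L (PO x) (PO y) (PO z)"
  by (simp add: prod_assoc_def Let_def)

lemma PA_term_map [simp]: "x \<in> Obj X \<Longrightarrow> PA (term_map K x) = term_map L (PO x)"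
  using LB.to_one[of "PA (term_map K x)"] by simp

lemma lift_simps [simp]:
  assumes "f \<in> Arr B" "x \<in> Obj X" "PO x = Dom B f"
  shows "cocartesian (proj E) (lift E f x)" "lift E f x \<in> Arr X" "Dom X (lift E f x) = x"
    "Cod X (lift E f x) = push E f x" "PA (lift E f x) = f" "PO (push E f x) = Cod B f"
        "push E f x \<in> Obj X"
  using lift[of f "Dom B f" "Cod B f" x] assms by auto

lemma fib_Arr_iff: "u \<in> Arr (fibre E A) \<longleftrightarrow> u \<in> Arr X \<and> PO (Dom X u) = A \<and> PA u = idn B A"
proof -
  have "PO (Cod X u) = A" if "u \<in> Arr X" "PO (Dom X u) = A" "PA u = idn B A"
    using P_simps(3)[OF that(1)] P_simps(4)[of "Dom X u"] that by auto
  then show ?thesis by (auto simp: fibre_def)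
qed

lemma vert_Cod: "u \<in> Arr X \<Longrightarrow> PO (Dom X u) = A \<Longrightarrow> PA u = idn B A \<Longrightarrow> PO (Cod X u) = A"
  using fib_Arr_iff[of u A] by (auto simp: fibre_def)

lemma cocart_Arr: "cocartesian (proj E) c \<Longrightarrow> c \<in> Arr X"
  by (simp add: cocartesian_def Let_def proj)

lemma cocart_comp':
  assumes "cocartesian (proj E) c" "cocartesian (proj E) d" "Dom X d = Cod X c"
  shows "cocartesian (proj E) (d \<cdot>\<^bsub>X\<^esub> c)"
  using cocart_comp[of c "Dom X c" "Cod X c" d "Cod X d"] assms cocart_Arr by simp

lemma cocart_prod: "cocartesian (proj E) f \<Longrightarrow> cocartesian (proj E) g \<Longrightarrow>
    cocartesian (proj E) (prodmap K f g)"
  using cmo by (simp add: cartesian_monoidal_opfibration_def Let_def)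

text \<open>Needed so that the associativity and unit isomorphisms of products may occur inside
  cocartesian composites. The required factorization of \<open>h\<close> is \<open>h\<close> after
  the inverse of \<open>f\<close>.\<close>

lemma cocart_iso:
  assumes "iso X f"
  shows "cocartesian (proj E) f"
proof -
  obtain g where f: "f \<in> Arr X" and g: "g \<in> Arr X" "Dom X g = Cod X f" "Cod X g = Dom X f"
    "g \<cdot>\<^bsub>X\<^esub> f = idn X (Dom X f)" "f \<cdot>\<^bsub>X\<^esub> g = idn X (Cod X f)"
    using assms by (auto simp: iso_iff_inverse)
  show ?thesis
  proof (rule cocartI[of f "Dom X f" "Cod X f"])
    fix z h v
    assume h: "h \<in> hom X (Dom X f) z" and v: "v \<in> hom B (PO (Cod X f)) (PO z)" and e: "PA h = v \<cdot>\<^bsub>B\<^esub> PA f"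
    have Pfg: "PA f \<cdot>\<^bsub>B\<^esub> PA g = idn B (PO (Cod X f))"
      using P_simps(6)[of g f] f g by simp
    show "\<exists>!k. k \<in> hom X (Cod X f) z \<and> PA k = v \<and> k \<cdot>\<^bsub>X\<^esub> f = h"
    proof (rule ex1I[of _ "h \<cdot>\<^bsub>X\<^esub> g"])
      show "h \<cdot>\<^bsub>X\<^esub> g \<in> hom X (Cod X f) z \<and> PA (h \<cdot>\<^bsub>X\<^esub> g) = v \<and> (h \<cdot>\<^bsub>X\<^esub> g) \<cdot>\<^bsub>X\<^esub> f = h"
        using f g h v e Pfg by auto
      fix k assume k: "k \<in> hom X (Cod X f) z \<and> PA k = v \<and> k \<cdot>\<^bsub>X\<^esub> f = h"
      then have "h \<cdot>\<^bsub>X\<^esub> g = k \<cdot>\<^bsub>X\<^esub> (f \<cdot>\<^bsub>X\<^esub> g)" using f g(1,2,3) by auto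
      then show "k = h \<cdot>\<^bsub>X\<^esub> g" using k f g by auto
    qed
  qed (use f in simp)
qed

lemma iso_fibre: "iso (fibre E A) f \<Longrightarrow> iso X f"
  by (auto simp: iso_iff_inverse fib_Arr_iff)

lemma vfactor_simps [simp]:
  assumes "cocartesian (proj E) c" "g \<in> Arr X" "Dom X g = Dom X c" "PA g = PA c"
  shows "vfactor E c g \<in> Arr X" "Dom X (vfactor E c g) = Cod X c" "Cod X (vfactor E c g) = Cod X g"
    "PA (vfactor E c g) = idn B (PO (Cod X g))" "vfactor E c g \<cdot>\<^bsub>X\<^esub> c = g"
  using vfactor[of c "Dom X c" "Cod X c" g "Cod X g"] assms cocart_Arr[of c] by auto

lemma vfactor_PO:
  assumes "cocartesian (proj E) c" "g \<in> Arr X" "PA g = PA c"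
  shows "PO (Cod X c) = PO (Cod X g)"
  using P_simps(3)[of c] P_simps(3)[of g] assms cocart_Arr[of c] by simp

lemma vfactor_iso':
  assumes "cocartesian (proj E) c" "cocartesian (proj E) d" "Dom X c = Dom X d" "PA d = PA c"
      "PO (Cod X c) = A"
  shows "iso (fibre E A) (vfactor E c d)"
  using vfactor_iso[of c "Dom X c"
      "Cod X c" d "Cod X d"] assms cocart_Arr[of c] cocart_Arr[of d] by auto

lemma chg_simps' [simp]:
  assumes "f \<in> Arr B" "u \<in> Arr X" "PO (Dom X u) = Dom B f" "PA u = idn B (Dom B f)"
  shows "fA (change_base E f) u \<in> Arr X" "Dom X (fA (change_base E f) u) = push E f (Dom X u)"
    "Cod X (fA (change_base E f) u) = push E f (Cod X u)"
        "PA (fA (change_base E f) u) = idn B (Cod B f)"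
proof -
  have "PO (Cod X u) = Dom B f" using vert_Cod assms by blast
  then have "u \<in> hom (fibre E (Dom B f)) (Dom X u) (Cod X u)" using assms by (simp add: fib_Arr_iff)
  moreover have "f \<in> hom B (Dom B f) (Cod B f)" using assms by simp
  ultimately show "fA (change_base E f) u \<in> Arr X" "Dom X (fA (change_base E f) u) = push E f (Dom X u)"
    "Cod X (fA (change_base E f) u) = push E f (Cod X u)"
        "PA (fA (change_base E f) u) = idn B (Cod B f)"
    using chg_arr(1) by (fastforce simp: fib_Arr_iff)+
qed

lemma chgO [simp]:
  assumes "f \<in> Arr B" "x \<in> Obj X" "PO x = Dom B f"
  shows "fO (change_base E f) x = push E f x"
  using chg_simps(3)[of f "Dom B f" "Cod B f" x] assms by (simp add: fib_Obj)

text \<open>Naturality of the liftings, in the form in which a change of base is evaluated on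
  elements.\<close>

lemma chg_el [simp]:
  assumes "f \<in> Arr B" "u \<in> Arr X" "Dom X u = x" "PO x = Dom B f" "PA u = idn B (Dom B f)"
    "a \<in> Arr X" "Cod X a = x"
  shows "fA (change_base E f) u \<cdot>\<^bsub>X\<^esub> lift E f x \<cdot>\<^bsub>X\<^esub> a = lift E f (Cod X u) \<cdot>\<^bsub>X\<^esub> u \<cdot>\<^bsub>X\<^esub> a"
proof -
  have c: "PO (Cod X u) = Dom B f" "x \<in> Obj X" using vert_Cod[of u] assms by auto
  have u: "u \<in> hom (fibre E (Dom B f)) x (Cod X u)" using assms by (simp add: fib_Arr_iff)
  have h: "f \<in> hom B (Dom B f) (Cod B f)" using assms by simp
  have "fA (change_base E f) u \<cdot>\<^bsub>X\<^esub> lift E f x \<cdot>\<^bsub>X\<^esub> a = (fA (change_base E f) u \<cdot>\<^bsub>X\<^esub> lift E f x) \<cdot>\<^bsub>X\<^esub> a"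
    using assms c by simp
  also have "\<dots> = lift E f (Cod X u) \<cdot>\<^bsub>X\<^esub> u \<cdot>\<^bsub>X\<^esub> a"
    unfolding chg_arr(2)[OF h u] using assms c by simp
  finally show ?thesis .
qed

text \<open>A property of arrows into \<open>w\<close> is dense if it holds on all arrows factoring through some
  cocartesian arrow into \<open>w\<close>; parallel arrows out of \<open>w\<close> with the same image in the base are then
  equal as soon as they agree on the arrows with that property.\<close>

definition dense :: "'x \<Rightarrow> ('u \<Rightarrow> bool) \<Rightarrow> bool" where
  "dense w S \<longleftrightarrow> (\<exists>c. cocartesian (proj E) c \<and> Cod X c = w \<and>
     (\<forall>s \<in> Arr X. Cod X s = Dom X c \<longrightarrow> S (c \<cdot>\<^bsub>X\<^esub> s)))"

lemma dense_ext:
  assumes d: "dense w S" and h: "h \<in> Arr X" "h' \<in> Arr X" "Dom X h = w" "Dom X h' = w"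
      "Cod X h = Cod X h'"
    "PA h = PA h'"
    and S: "\<And>a. a \<in> Arr X \<Longrightarrow> Cod X a = w \<Longrightarrow> S a \<Longrightarrow> h \<cdot>\<^bsub>X\<^esub> a = h' \<cdot>\<^bsub>X\<^esub> a"
  shows "h = h'"
proof -
  obtain c where c: "cocartesian (proj E) c" "Cod X c = w"
     "\<And>s. s \<in> Arr X \<Longrightarrow> Cod X s = Dom X c \<Longrightarrow> S (c \<cdot>\<^bsub>X\<^esub> s)"
    using d by (auto simp: dense_def)
  note ca = cocart_Arr[OF c(1)]
  have "h \<cdot>\<^bsub>X\<^esub> c = h' \<cdot>\<^bsub>X\<^esub> c"
    \<comment> \<open>The covering arrow \<open>c\<close> itself has the property: it is its own
      composite with an identity.\<close>
    using S[of c] c(3)[of "idn X (Dom X c)"] ca c(2) by simp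
  then show ?thesis
    using cocart_cancel[OF c(1), of "Dom X c" w h "Cod X h" h'] h ca c(2) by simp
qed

lemma dense_top: "w \<in> Obj X \<Longrightarrow> dense w (\<lambda>_. True)"
  unfolding dense_def by (rule exI[of _ "idn X w"]) (simp add: cocart_id)

lemma dense_lift:
  assumes "dense w S" "f \<in> Arr B" "PO w = Dom B f" "w \<in> Obj X"
  shows "dense (push E f w) (\<lambda>s. \<exists>a. S a \<and> a \<in> Arr X \<and> Cod X a = w \<and> s = lift E f w \<cdot>\<^bsub>X\<^esub> a)"
proof -
  obtain c where c: "cocartesian (proj E) c" "Cod X c = w"
     "\<And>s. s \<in> Arr X \<Longrightarrow> Cod X s = Dom X c \<Longrightarrow> S (c \<cdot>\<^bsub>X\<^esub> s)"
    using assms(1) by (auto simp: dense_def)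
  note ca = cocart_Arr[OF c(1)]
  show ?thesis unfolding dense_def
  proof (rule exI[of _ "lift E f w \<cdot>\<^bsub>X\<^esub> c"], intro conjI ballI impI)
    show "cocartesian (proj E) (lift E f w \<cdot>\<^bsub>X\<^esub> c)" using assms c by (intro cocart_comp') auto
    show "Cod X (lift E f w \<cdot>\<^bsub>X\<^esub> c) = push E f w" using assms c ca by simp
    fix s assume "s \<in> Arr X" "Cod X s = Dom X (lift E f w \<cdot>\<^bsub>X\<^esub> c)"
    then show "\<exists>a. S a \<and> a \<in> Arr X \<and> Cod X a = w \<and> (lift E f w \<cdot>\<^bsub>X\<^esub> c) \<cdot>\<^bsub>X\<^esub> s = lift E f w \<cdot>\<^bsub>X\<^esub> a"
      using c assms ca by (intro exI[of _ "c \<cdot>\<^bsub>X\<^esub> s"]) simp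
  qed
qed

text \<open>For generalized elements \<open>a : t \<rightarrow> x\<close> and \<open>b : t \<rightarrow> y\<close> this is the element
  \<open>t \<rightarrow> x \<times> y \<rightarrow> x \<otimes> y\<close>, where \<open>x \<otimes> y\<close> is the pushforward of \<open>x \<times> y\<close> along \<open>m\<close>.\<close>

definition emul :: "'f \<Rightarrow> 'u \<Rightarrow> 'u \<Rightarrow> 'u" where
  "emul m a b = lift E m (prd K (Cod X a) (Cod X b)) \<cdot>\<^bsub>X\<^esub> pairing K a b"

end

section \<open>The monoidal category over a monoid object\<close>

locale cmo_monoid = cmo E + BM: monoid_obj "base E" M m e
  for E :: "('x, 'u, 'b, 'f) opfib" and M m e
begin

abbreviation "V \<equiv> monoid_moncat E M m e"

lemma emul_simps [simp]:
  assumes "a \<in> Arr X" "b \<in> Arr X" "Dom X a = Dom X b" "PO (Cod X a) = M" "PO (Cod X b) = M"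
  shows "emul m a b \<in> Arr X" "Dom X (emul m a b) = Dom X b"
      "Cod X (emul m a b) = push E m (prd K (Cod X a) (Cod X b))"
    "PA (emul m a b) = m \<cdot>\<^bsub>B\<^esub> pairing L (PA a) (PA b)"
    "t \<in> Arr X \<Longrightarrow> Cod X t = Dom X b \<Longrightarrow> emul m a b \<cdot>\<^bsub>X\<^esub> t = emul m (a \<cdot>\<^bsub>X\<^esub> t) (b \<cdot>\<^bsub>X\<^esub> t)"
  using assms by (auto simp: emul_def)

text \<open>The covering arrow is the product of those for the two factors, followed by the lifting
  of \<open>m\<close>. This is where products of cocartesian arrows have to be cocartesian.\<close>

lemma dense_emul:
  assumes "dense w S" "dense w' S'" "PO w = M" "PO w' = M"
  shows "dense (push E m (prd K w w')) (\<lambda>s. \<exists>a b. S a \<and> S' b \<and> a \<in> Arr X \<and> b \<in> Arr X \<and>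
      Dom X a = Dom X b \<and>
     Cod X a = w \<and> Cod X b = w' \<and> s = emul m a b)"
proof -
  obtain c where c: "cocartesian (proj E) c" "Cod X c = w"
     "\<And>s. s \<in> Arr X \<Longrightarrow> Cod X s = Dom X c \<Longrightarrow> S (c \<cdot>\<^bsub>X\<^esub> s)"
    using assms(1) by (auto simp: dense_def)
  obtain d where d: "cocartesian (proj E) d" "Cod X d = w'"
     "\<And>s. s \<in> Arr X \<Longrightarrow> Cod X s = Dom X d \<Longrightarrow> S' (d \<cdot>\<^bsub>X\<^esub> s)"
    using assms(2) by (auto simp: dense_def)
  note [simp] = cocart_Arr[OF c(1)] cocart_Arr[OF d(1)] assms(3,4)
  have [simp]: "w \<in> Obj X" "w' \<in> Obj X" using c(2) d(2) by auto
  let ?q = "lift E m (prd K w w') \<cdot>\<^bsub>X\<^esub> prodmap K c d"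
  show ?thesis unfolding dense_def
  proof (rule exI[of _ ?q], intro conjI ballI impI)
    show "cocartesian (proj E) ?q" using c d by (intro cocart_comp' cocart_prod) auto
    show "Cod X ?q = push E m (prd K w w')" using c d by simp
    fix s assume s: "s \<in> Arr X" "Cod X s = Dom X ?q"
    define a b where "a = pr1 K (Dom X c) (Dom X d) \<cdot>\<^bsub>X\<^esub> s" and "b = pr2 K (Dom X c) (Dom X d) \<cdot>\<^bsub>X\<^esub> s"
    have ab: "s = pairing K a b" "a \<in> Arr X" "b \<in> Arr X" "Dom X a = Dom X b" "Cod X a = Dom X c"
        "Cod X b = Dom X d"
      using s c d by (simp_all add: a_def b_def)
    show "\<exists>a b. S a \<and> S' b \<and> a \<in> Arr X \<and> b \<in> Arr X \<and> Dom X a = Dom X b \<and>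
     Cod X a = w \<and> Cod X b = w' \<and> ?q \<cdot>\<^bsub>X\<^esub> s = emul m a b"
      by (rule exI[of _ "c \<cdot>\<^bsub>X\<^esub> a"], rule exI[of _ "d \<cdot>\<^bsub>X\<^esub> b"]) (use ab c d in \<open>simp add: emul_def\<close>)
  qed
qed

lemma V_simps [simp]: "mcat V = fibre E M" "munit V = push E e (one K)"
  "x \<in> Obj X \<Longrightarrow> PO x = M \<Longrightarrow> y \<in> Obj X \<Longrightarrow> PO y = M \<Longrightarrow> tenO V x y = push E m (prd K x y)"
proof -
  have [simp]: "e \<in> hom B (one L) M" "m \<in> hom B (prd L M M) M" by auto
  show "mcat V = fibre E M" by (simp add: monoid_moncat_def Let_def)
  have "fO (R1 E) () = one K" "fsrc (R1 E) = terminal_cat" by (simp_all add: R1_def)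
  moreover have "one K \<in> Obj (fibre E (one L))" by (simp add: fib_Obj)
  ultimately show "munit V = push E e (one K)"
    by (simp add: monoid_moncat_def Let_def fcomp_def terminal_cat_def change_base_def)
  show "tenO V x y = push E m (prd K x y)" if "x \<in> Obj X" "PO x = M" "y \<in> Obj X" "PO y = M"
    using that by (simp add: monoid_moncat_def Let_def fcomp_def RR_simps change_base_def prod_cat_def
        fib_Obj)
qed

lemma tenA_simps [simp]:
  assumes "f \<in> Arr X" "PO (Dom X f) = M" "PA f = idn B M" "g \<in> Arr X" "PO (Dom X g) = M"
      "PA g = idn B M"
  shows "tenA V f g \<in> Arr X" "Dom X (tenA V f g) = push E m (prd K (Dom X f) (Dom X g))"
    "Cod X (tenA V f g) = push E m (prd K (Cod X f) (Cod X g))" "PA (tenA V f g) = idn B M"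
    "\<And>a b. a \<in> Arr X \<Longrightarrow> b \<in> Arr X \<Longrightarrow> Dom X a = Dom X b \<Longrightarrow> Cod X a = Dom X f \<Longrightarrow> Cod X b = Dom X g \<Longrightarrow>
      tenA V f g \<cdot>\<^bsub>X\<^esub> emul m a b = emul m (f \<cdot>\<^bsub>X\<^esub> a) (g \<cdot>\<^bsub>X\<^esub> b)"
proof -
  have [simp]: "PO (Cod X f) = M" "PO (Cod X g) = M" using assms vert_Cod by blast+
  have [simp]: "m \<in> hom B (prd L M M) M" by auto
  have e: "tenA V f g = fA (change_base E m) (prodmap K f g)"
    using assms by (simp add: monoid_moncat_def Let_def fcomp_def RR_simps prod_cat_def fib_Arr_iff)
  \<comment> \<open>The rules for changes of base expect the image of a vertical arrow as an
    identity, so \<open>PA_prodmap\<close> is switched off below.\<close>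
  have v: "PA (prodmap K f g) = idn B (prd L M M)" using assms by (simp add: LB.prodmap_eq)
  show "tenA V f g \<in> Arr X" "Dom X (tenA V f g) = push E m (prd K (Dom X f) (Dom X g))"
    "Cod X (tenA V f g) = push E m (prd K (Cod X f) (Cod X g))" "PA (tenA V f g) = idn B M"
    unfolding e using v assms by (simp_all del: PA_prodmap)
  fix a b assume ab: "a \<in> Arr X" "b \<in> Arr X" "Dom X a = Dom X b" "Cod X a = Dom X f" "Cod X b = Dom X g"
  show "tenA V f g \<cdot>\<^bsub>X\<^esub> emul m a b = emul m (f \<cdot>\<^bsub>X\<^esub> a) (g \<cdot>\<^bsub>X\<^esub> b)"
    unfolding e using chg_el[of m "prodmap K f g" _ "pairing K a b"] v ab assms
    by (simp add: emul_def del: PA_prodmap)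
qed

text \<open>\<open>c\<close> and \<open>d\<close> are cocartesian, and their images in the base
  agree by associativity of \<open>m\<close>; so the comparison between them is invertible. Applying
  it after \<open>c\<close> to the tuple of three elements gives the evaluation rule.\<close>

lemma massoc_simps [simp]:
  assumes "x \<in> Obj X" "PO x = M" "y \<in> Obj X" "PO y = M" "z \<in> Obj X" "PO z = M"
  shows "massoc V x y z \<in> Arr X"
    "Dom X (massoc V x y z) = push E m (prd K (push E m (prd K x y)) z)"
    "Cod X (massoc V x y z) = push E m (prd K x (push E m (prd K y z)))"
    "PA (massoc V x y z) = idn B M" "iso (fibre E M) (massoc V x y z)"
    "\<And>a b c. a \<in> Arr X \<Longrightarrow> b \<in> Arr X \<Longrightarrow> c \<in> Arr X \<Longrightarrow> Dom X a = Dom X c \<Longrightarrow> Dom X b = Dom X c \<Longrightarrow>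
      Cod X a = x \<Longrightarrow> Cod X b = y \<Longrightarrow> Cod X c = z \<Longrightarrow>
      massoc V x y z \<cdot>\<^bsub>X\<^esub> emul m (emul m a b) c = emul m a (emul m b c)"
proof -
  let ?xy = "push E m (prd K x y)" and ?yz = "push E m (prd K y z)"
  define c where "c = lift E m (prd K ?xy z) \<cdot>\<^bsub>X\<^esub> prodmap K (lift E m (prd K x y)) (idn X z)"
  define d where "d = lift E m (prd K x ?yz) \<cdot>\<^bsub>X\<^esub> prodmap K (idn X x) (lift E m (prd K y z)) \<cdot>\<^bsub>X\<^esub> prod_assoc
      K x y z"
  have e: "massoc V x y z = vfactor E c d" by (simp add: monoid_moncat_def Let_def c_def d_def)
  note [simp] = assms
  have c: "cocartesian (proj E) c" unfolding c_def by (intro cocart_comp' cocart_prod cocart_id) auto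
  have d: "cocartesian (proj E) d" unfolding d_def
    by (intro cocart_comp' cocart_prod cocart_id cocart_iso[OF KK.iso_prod_assoc]) auto
  have s [simp]: "Dom X c = prd K (prd K x y) z" "Dom X d = prd K (prd K x y) z"
    "Cod X c = push E m (prd K ?xy z)" "Cod X d = push E m (prd K x ?yz)"
    by (simp_all add: c_def d_def)
  have p: "PA d = PA c" by (simp add: c_def d_def BM.m_laws)
  note [simp] = cocart_Arr[OF c] cocart_Arr[OF d]
  show 1: "massoc V x y z \<in> Arr X" "Dom X (massoc V x y z) = push E m (prd K ?xy z)"
    "Cod X (massoc V x y z) = push E m (prd K x ?yz)"
    "PA (massoc V x y z) = idn B M"
    using c d p by (simp_all add: e)
  show "iso (fibre E M) (massoc V x y z)"
    unfolding e by (rule vfactor_iso'[OF c d _ p]) simp_all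
  fix a b g assume abg: "a \<in> Arr X" "b \<in> Arr X" "g \<in> Arr X" "Dom X a = Dom X g" "Dom X b = Dom X g"
     "Cod X a = x" "Cod X b = y" "Cod X g = z"
  let ?p = "pairing K (pairing K a b) g"
  have "emul m (emul m a b) g = c \<cdot>\<^bsub>X\<^esub> ?p" using abg by (simp add: emul_def c_def)
  then have "massoc V x y z \<cdot>\<^bsub>X\<^esub> emul m (emul m a b) g = (massoc V x y z \<cdot>\<^bsub>X\<^esub> c) \<cdot>\<^bsub>X\<^esub> ?p"
    using 1 abg by simp
  also have "massoc V x y z \<cdot>\<^bsub>X\<^esub> c = d" unfolding e using c p by simp
  also have "d \<cdot>\<^bsub>X\<^esub> ?p = emul m a (emul m b g)" using abg by (auto simp add: emul_def d_def)
  finally show "massoc V x y z \<cdot>\<^bsub>X\<^esub> emul m (emul m a b) g = emul m a (emul m b g)" .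
qed

lemma munitor_simps [simp]:
  assumes "x \<in> Obj X" "PO x = M"
  shows "mlunit V x \<in> Arr X" "Dom X (mlunit V x) = push E m (prd K (push E e (one K)) x)"
    "Cod X (mlunit V x) = x" "PA (mlunit V x) = idn B M" "iso (fibre E M) (mlunit V x)"
    "\<And>t a. t \<in> Arr X \<Longrightarrow> a \<in> Arr X \<Longrightarrow> Dom X t = Dom X a \<Longrightarrow> Cod X t = one K \<Longrightarrow> Cod X a = x \<Longrightarrow>
      mlunit V x \<cdot>\<^bsub>X\<^esub> emul m (lift E e (one K) \<cdot>\<^bsub>X\<^esub> t) a = a"
    "mrunit V x \<in> Arr X" "Dom X (mrunit V x) = push E m (prd K x (push E e (one K)))"
    "Cod X (mrunit V x) = x" "PA (mrunit V x) = idn B M" "iso (fibre E M) (mrunit V x)"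
    "\<And>t a. t \<in> Arr X \<Longrightarrow> a \<in> Arr X \<Longrightarrow> Dom X t = Dom X a \<Longrightarrow> Cod X t = one K \<Longrightarrow> Cod X a = x \<Longrightarrow>
      mrunit V x \<cdot>\<^bsub>X\<^esub> emul m a (lift E e (one K) \<cdot>\<^bsub>X\<^esub> t) = a"
proof -
  let ?I = "push E e (one K)"
  have I: "munit V = ?I" by (rule V_simps)
  have I': "fO (change_base E e \<bullet> R1 E) () = ?I" using I by (simp add: monoid_moncat_def Let_def)
  define c where "c = lift E m (prd K ?I x) \<cdot>\<^bsub>X\<^esub> prodmap K (lift E e (one K)) (idn X x)"
  define d where "d = lift E m (prd K x ?I) \<cdot>\<^bsub>X\<^esub> prodmap K (idn X x) (lift E e (one K))"
  have e: "mlunit V x = vfactor E c (pr2 K (one K) x)" "mrunit V x = vfactor E d (pr1 K x (one K))"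
    by (simp_all add: monoid_moncat_def Let_def c_def d_def I')
  note [simp] = assms
  have c: "cocartesian (proj E) c" "cocartesian (proj E) d"
    unfolding c_def d_def by (intro cocart_comp' cocart_prod cocart_id; simp)+
  \<comment> \<open>Projections away from the terminal object are isomorphisms, so this needs no
    assumption on terminal maps.\<close>
  have p: "cocartesian (proj E) (pr2 K (one K) x)" "cocartesian (proj E) (pr1 K x (one K))"
    by (intro cocart_iso KK.iso_pr_one; simp)+
  have s [simp]: "Dom X c = prd K (one K) x" "Dom X d = prd K x (one K)"
    "Cod X c = push E m (prd K ?I x)" "Cod X d = push E m (prd K x ?I)"
    by (simp_all add: c_def d_def)
  \<comment> \<open>The rules \<open>P_simps(8,9)\<close> would rewrite the left-hand sides and are
    removed wherever these equations serve as rewrite rules.\<close>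
  have q: "PA (pr2 K (one K) x) = PA c" "PA (pr1 K x (one K)) = PA d"
    using BM.m_laws by (simp_all add: c_def d_def)
  note [simp] = cocart_Arr[OF c(1)] cocart_Arr[OF c(2)]
  show 1: "mlunit V x \<in> Arr X" "Dom X (mlunit V x) = push E m (prd K (push E e (one K)) x)"
    "Cod X (mlunit V x) = x" "PA (mlunit V x) = idn B M" "mrunit V x \<in> Arr X"
        "Dom X (mrunit V x) = push E m (prd K x (push E e (one K)))"
    "Cod X (mrunit V x) = x" "PA (mrunit V x) = idn B M"
    using c q by (simp_all add: e del: P_simps(8,9))
  show "iso (fibre E M) (mlunit V x)" unfolding e by (rule vfactor_iso'[OF c(1) p(1) _ q(1)]) simp_all
  show "iso (fibre E M) (mrunit V x)" unfolding e by (rule vfactor_iso'[OF c(2) p(2) _ q(2)]) simp_all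
  fix t a assume ta: "t \<in> Arr X" "a \<in> Arr X" "Dom X t = Dom X a" "Cod X t = one K" "Cod X a = x"
  have "emul m (lift E e (one K) \<cdot>\<^bsub>X\<^esub> t) a = c \<cdot>\<^bsub>X\<^esub> pairing K t a" using ta by (simp add: emul_def c_def)
  then have "mlunit V x \<cdot>\<^bsub>X\<^esub> emul m (lift E e (one K) \<cdot>\<^bsub>X\<^esub> t) a = (mlunit V x \<cdot>\<^bsub>X\<^esub> c) \<cdot>\<^bsub>X\<^esub> pairing K t a"
    using 1 ta by simp
  also have "mlunit V x \<cdot>\<^bsub>X\<^esub> c = pr2 K (one K) x" unfolding e using c q by (simp del: P_simps(8,9))
  finally show "mlunit V x \<cdot>\<^bsub>X\<^esub> emul m (lift E e (one K) \<cdot>\<^bsub>X\<^esub> t) a = a" using ta by simp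
  have "emul m a (lift E e (one K) \<cdot>\<^bsub>X\<^esub> t) = d \<cdot>\<^bsub>X\<^esub> pairing K a t" using ta by (simp add: emul_def d_def)
  then have "mrunit V x \<cdot>\<^bsub>X\<^esub> emul m a (lift E e (one K) \<cdot>\<^bsub>X\<^esub> t) = (mrunit V x \<cdot>\<^bsub>X\<^esub> d) \<cdot>\<^bsub>X\<^esub> pairing K a t"
    using 1 ta by simp
  also have "mrunit V x \<cdot>\<^bsub>X\<^esub> d = pr1 K x (one K)" unfolding e using c q by (simp del: P_simps(8,9))
  finally show "mrunit V x \<cdot>\<^bsub>X\<^esub> emul m a (lift E e (one K) \<cdot>\<^bsub>X\<^esub> t) = a" using ta by simp
qed

lemma dense_unit: "dense (push E e (one K)) (\<lambda>s. \<exists>t. t \<in> Arr X \<and> Cod X t = one K \<and>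
    s = lift E e (one K) \<cdot>\<^bsub>X\<^esub> t)"
  using dense_lift[OF dense_top[of "one K"], of e] by simp

lemma mten_simps: "is_functor (mten V)" "fsrc (mten V) = prod_cat (fibre E M) (fibre E M)"
    "ftrg (mten V) = fibre E M"
proof -
  have m: "m \<in> hom B (prd L M M) M" by auto
  have e: "mten V = change_base E m \<bullet> RR E M M" by (simp add: monoid_moncat_def Let_def)
  show "is_functor (mten V)" unfolding e
    by (rule is_functor_fcomp[OF functor_RR functor_chg[OF m]]) (simp add: RR_simps chg_simps[OF m])
  show "fsrc (mten V) = prod_cat (fibre E M) (fibre E M)" "ftrg (mten V) = fibre E M"
    unfolding e by (simp_all add: fcomp_def RR_simps chg_simps[OF m])
qed

text \<open>In each use of \<open>dense_ext\<close> the nesting of \<open>dense_emul\<close> copies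
  the bracketing of the common domain. On formal products both sides then simplify to the same
  element: for the pentagon \<open>((a b) c) d\<close> goes to \<open>a (b (c d))\<close>, for the
  triangle \<open>(a 1) b\<close> goes to \<open>a b\<close>.\<close>

lemma monoidal_category_V: "monoidal_category V"
  unfolding monoidal_category_def Let_def V_simps(1,2) mten_simps fib_simps
proof (intro conjI ballI cat_fibre mten_simps refl)
  let ?I = "push E e (one K)"
  show "?I \<in> Obj (fibre E M)" by (simp add: fib_Obj)
  fix x assume "x \<in> Obj (fibre E M)"
  then have [simp]: "x \<in> Obj X" "PO x = M" by (simp_all add: fib_Obj)
  show "mlunit V x \<in> hom (fibre E M) (tenO V ?I x) x" "iso (fibre E M) (mlunit V x)"
    "mrunit V x \<in> hom (fibre E M) (tenO V x ?I) x" "iso (fibre E M) (mrunit V x)"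
    by (simp_all add: fib_Arr_iff)
  fix y assume "y \<in> Obj (fibre E M)"
  then have [simp]: "y \<in> Obj X" "PO y = M" by (simp_all add: fib_Obj)
  show "tenA V (idn X x) (mlunit V y) \<cdot>\<^bsub>X\<^esub> massoc V x ?I y = tenA V (mrunit V x) (idn X y)"
    by (rule dense_ext[OF dense_emul[OF dense_emul[OF dense_top dense_unit]
        dense_top], of x y]) ((elim exE conjE)?, simp)+
  fix z assume "z \<in> Obj (fibre E M)"
  then have [simp]: "z \<in> Obj X" "PO z = M" by (simp_all add: fib_Obj)
  show "massoc V x y z \<in> hom (fibre E M) (tenO V (tenO V x y) z) (tenO V x (tenO V y z))"
    "iso (fibre E M) (massoc V x y z)" by (simp_all add: fib_Arr_iff)
  fix w assume "w \<in> Obj (fibre E M)"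
  then have [simp]: "w \<in> Obj X" "PO w = M" by (simp_all add: fib_Obj)
  show "massoc V x y (tenO V z w) \<cdot>\<^bsub>X\<^esub> massoc V (tenO V x y) z w =
        tenA V (idn X x) (massoc V y z w) \<cdot>\<^bsub>X\<^esub> massoc V x (tenO V y z) w \<cdot>\<^bsub>X\<^esub> tenA V (massoc V x y z) (idn X
          w)"
    by (rule dense_ext[OF dense_emul[OF dense_emul[OF dense_emul[OF dense_top dense_top] dense_top]
        dense_top], of x y z w]) ((elim exE conjE)?, simp)+
next
  fix f assume "f \<in> Arr (fibre E M)"
  then have f [simp]: "f \<in> Arr X" "PO (Dom X f) = M" "PA f = idn B M" "PO (Cod X f) = M"
    using vert_Cod by (auto simp add: fib_Arr_iff)
  show "mlunit V (Cod X f) \<cdot>\<^bsub>X\<^esub> tenA V (idn X (push E e (one K))) f = f \<cdot>\<^bsub>X\<^esub> mlunit V (Dom X f)"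
    by (rule dense_ext[OF dense_emul[OF dense_unit dense_top], of "Dom X f"]) ((elim exE conjE)?, simp)+
  show "mrunit V (Cod X f) \<cdot>\<^bsub>X\<^esub> tenA V f (idn X (push E e (one K))) = f \<cdot>\<^bsub>X\<^esub> mrunit V (Dom X f)"
    by (rule dense_ext[OF dense_emul[OF dense_top dense_unit], of "Dom X f"]) ((elim exE conjE)?, simp)+
  fix g assume "g \<in> Arr (fibre E M)"
  then have g [simp]: "g \<in> Arr X" "PO (Dom X g) = M" "PA g = idn B M" "PO (Cod X g) = M"
    using vert_Cod by (auto simp add: fib_Arr_iff)
  fix h assume "h \<in> Arr (fibre E M)"
  then have h [simp]: "h \<in> Arr X" "PO (Dom X h) = M" "PA h = idn B M" "PO (Cod X h) = M"
    using vert_Cod by (auto simp add: fib_Arr_iff)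
  show "massoc V (Cod X f) (Cod X g) (Cod X h) \<cdot>\<^bsub>X\<^esub> tenA V (tenA V f g) h =
     tenA V f (tenA V g h) \<cdot>\<^bsub>X\<^esub> massoc V (Dom X f) (Dom X g) (Dom X h)"
    by (rule dense_ext[OF dense_emul[OF dense_emul[OF dense_top dense_top] dense_top], of "Dom X f"
        "Dom X g" "Dom X h"]) ((elim exE conjE)?, simp)+
qed

end

section \<open>Strong monoidal functors between the fibres\<close>

context cmo begin

text \<open>\<open>h\<close> and the comparison of \<open>c\<close> with \<open>d\<close> are
  vertical and agree after \<open>c\<close>, so they coincide; and a comparison of two cocartesian
  arrows over the same base arrow is invertible.\<close>

lemma vertical_iso:
  assumes "cocartesian (proj E) c" "cocartesian (proj E) d" "h \<in> Arr X" "Dom X h = Cod X c"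
      "PA h = idn B A"
    "PO (Cod X c) = A" "h \<cdot>\<^bsub>X\<^esub> c = d"
  shows "iso (fibre E A) h"
proof -
  note [simp] = cocart_Arr[OF assms(1)]
  have A: "A \<in> Obj B" using assms(6) by auto
  have p: "PA d = PA c" using assms A by auto
  have s: "Dom X d = Dom X c" "Cod X d = Cod X h" using assms by auto
  have "PO (Cod X h) = A" using vert_Cod[OF assms(3) _ assms(5)] assms(4,6) by simp
  note v = vfactor_simps[OF assms(1) cocart_Arr[OF assms(2)] s(1) p] and this
  then have "h = vfactor E c d"
    by (intro cocart_cancel[OF assms(1), of "Dom X c" "Cod X c" h "Cod X d" "vfactor E c d"])
      (simp_all only: assms s hom_def mem_Collect_eq cocart_Arr[OF assms(1)] simp_thms)
  then show ?thesis using vfactor_iso'[OF assms(1,2) _ p assms(6)] s by simp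
qed

end

text \<open>The strong monoidal functors that occur here come with a natural cocartesian arrow
  \<open>\<kappa> x : x \<rightarrow> F x\<close>, and their structure maps are determined by their values on elements of the form
  \<open>\<kappa> x \<cdot> a\<close>. Identities, changes of base and composites are all of this kind.\<close>

locale mfun = cmo E + G: cmo_monoid E M m e + H: cmo_monoid E N n u
  for E :: "('x, 'u, 'b, 'f) opfib" and M m e N n u +
  fixes S :: "('x, 'u) smfun" and \<kappa> :: "'x \<Rightarrow> 'u"
  assumes S_simps [simp]: "ssrc S = monoid_moncat E M m e" "strg S = monoid_moncat E N n u"
    "is_functor (sfun S)" "fsrc (sfun S) = fibre E M" "ftrg (sfun S) = fibre E N"
    "sphi S \<in> extensional (Obj (fibre E M) \<times> Obj (fibre E M))"
  and kappa [simp]: "\<And>x. x \<in> Obj X \<Longrightarrow> PO x = M \<Longrightarrow> cocartesian (proj E) (\<kappa> x)"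
    "\<And>x. x \<in> Obj X \<Longrightarrow> PO x = M \<Longrightarrow> Dom X (\<kappa> x) = x"
    "\<And>x. x \<in> Obj X \<Longrightarrow> PO x = M \<Longrightarrow> Cod X (\<kappa> x) = fO (sfun S) x"
  and F_el [simp]: "\<And>v x a. v \<in> Arr X \<Longrightarrow> Dom X v = x \<Longrightarrow> PO x = M \<Longrightarrow> PA v = idn B M \<Longrightarrow> a \<in> Arr X \<Longrightarrow>
      Cod X a = x \<Longrightarrow>
      fA (sfun S) v \<cdot>\<^bsub>X\<^esub> \<kappa> x \<cdot>\<^bsub>X\<^esub> a = \<kappa> (Cod X v) \<cdot>\<^bsub>X\<^esub> v \<cdot>\<^bsub>X\<^esub> a"
  and sphi_simps [simp]: "\<And>x y. x \<in> Obj X \<Longrightarrow> PO x = M \<Longrightarrow> y \<in> Obj X \<Longrightarrow> PO y = M \<Longrightarrow> sphi S (x, y) \<in> Arr X"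
    "\<And>x y. x \<in> Obj X \<Longrightarrow> PO x = M \<Longrightarrow> y \<in> Obj X \<Longrightarrow> PO y = M \<Longrightarrow>
      Dom X (sphi S (x, y)) = push E n (prd K (fO (sfun S) x) (fO (sfun S) y))"
    "\<And>x y. x \<in> Obj X \<Longrightarrow> PO x = M \<Longrightarrow> y \<in> Obj X \<Longrightarrow> PO y = M \<Longrightarrow>
      Cod X (sphi S (x, y)) = fO (sfun S) (push E m (prd K x y))"
    "\<And>x y. x \<in> Obj X \<Longrightarrow> PO x = M \<Longrightarrow> y \<in> Obj X \<Longrightarrow> PO y = M \<Longrightarrow> PA (sphi S (x, y)) = idn B N"
    "\<And>x y a b. x \<in> Obj X \<Longrightarrow> PO x = M \<Longrightarrow> y \<in> Obj X \<Longrightarrow> PO y = M \<Longrightarrow> a \<in> Arr X \<Longrightarrow> b \<in> Arr X \<Longrightarrow>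
      Dom X a = Dom X b \<Longrightarrow> Cod X a = x \<Longrightarrow> Cod X b = y \<Longrightarrow>
      sphi S (x, y) \<cdot>\<^bsub>X\<^esub> emul n (\<kappa> x \<cdot>\<^bsub>X\<^esub> a) (\<kappa> y \<cdot>\<^bsub>X\<^esub> b) = \<kappa> (push E m (prd K x y)) \<cdot>\<^bsub>X\<^esub> emul m a b"
  and sphi0_simps [simp]: "sphi0 S \<in> Arr X" "Dom X (sphi0 S) = push E u (one K)"
    "Cod X (sphi0 S) = fO (sfun S) (push E e (one K))" "PA (sphi0 S) = idn B N"
    "\<And>t. t \<in> Arr X \<Longrightarrow> Cod X t = one K \<Longrightarrow>
      sphi0 S \<cdot>\<^bsub>X\<^esub> lift E u (one K) \<cdot>\<^bsub>X\<^esub> t = \<kappa> (push E e (one K)) \<cdot>\<^bsub>X\<^esub> lift E e (one K) \<cdot>\<^bsub>X\<^esub> t"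
begin

lemma kappa_Arr [simp]: "x \<in> Obj X \<Longrightarrow> PO x = M \<Longrightarrow> \<kappa> x \<in> Arr X"
  using cocart_Arr kappa by blast

lemma F_Obj [simp]: assumes "x \<in> Obj X" "PO x = M" shows "fO (sfun S) x \<in> Obj X"
    "PO (fO (sfun S) x) = N"
proof -
  have "x \<in> Obj (fibre E M)" using assms by (simp add: fib_Obj)
  then have "fO (sfun S) x \<in> Obj (fibre E N)" using S_simps(3,4,5)
      by (auto simp: is_functor_def Let_def)
  then show "fO (sfun S) x \<in> Obj X" "PO (fO (sfun S) x) = N" by (simp_all add: fib_Obj)
qed

lemma F_Arr [simp]: assumes "v \<in> Arr X" "PO (Dom X v) = M" "PA v = idn B M"
  shows "fA (sfun S) v \<in> Arr X" "Dom X (fA (sfun S) v) = fO (sfun S) (Dom X v)"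
    "Cod X (fA (sfun S) v) = fO (sfun S) (Cod X v)" "PA (fA (sfun S) v) = idn B N"
proof -
  have "v \<in> Arr (fibre E M)" using assms by (simp add: fib_Arr_iff)
  then have "fA (sfun S) v \<in> hom (fibre E N) (fO (sfun S) (Dom X v)) (fO (sfun S) (Cod X v))"
    using S_simps(3,4,5) by (auto simp: is_functor_def Let_def)
  then show "fA (sfun S) v \<in> Arr X" "Dom X (fA (sfun S) v) = fO (sfun S) (Dom X v)"
    "Cod X (fA (sfun S) v) = fO (sfun S) (Cod X v)" "PA (fA (sfun S) v) = idn B N"
    by (simp_all add: fib_Arr_iff)
qed

lemma dense_kappa:
  assumes "dense w Q" "w \<in> Obj X" "PO w = M"
  shows "dense (fO (sfun S) w) (\<lambda>s. \<exists>a. Q a \<and> a \<in> Arr X \<and> Cod X a = w \<and> s = \<kappa> w \<cdot>\<^bsub>X\<^esub> a)"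
proof -
  obtain c where c: "cocartesian (proj E) c" "Cod X c = w"
     "\<And>s. s \<in> Arr X \<Longrightarrow> Cod X s = Dom X c \<Longrightarrow> Q (c \<cdot>\<^bsub>X\<^esub> s)"
    using assms(1) by (auto simp: dense_def)
  note ca = cocart_Arr[OF c(1)]
  show ?thesis unfolding dense_def
  proof (rule exI[of _ "\<kappa> w \<cdot>\<^bsub>X\<^esub> c"], intro conjI ballI impI)
    show "cocartesian (proj E) (\<kappa> w \<cdot>\<^bsub>X\<^esub> c)" using assms c by (intro cocart_comp') auto
    show "Cod X (\<kappa> w \<cdot>\<^bsub>X\<^esub> c) = fO (sfun S) w" using assms c ca by simp
    fix s assume "s \<in> Arr X" "Cod X s = Dom X (\<kappa> w \<cdot>\<^bsub>X\<^esub> c)"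
    then show "\<exists>a. Q a \<and> a \<in> Arr X \<and> Cod X a = w \<and> (\<kappa> w \<cdot>\<^bsub>X\<^esub> c) \<cdot>\<^bsub>X\<^esub> s = \<kappa> w \<cdot>\<^bsub>X\<^esub> a"
      using c assms ca by (intro exI[of _ "c \<cdot>\<^bsub>X\<^esub> s"]) simp
  qed
qed

lemma iso_sphi:
  assumes [simp]: "x \<in> Obj X" "PO x = M" "y \<in> Obj X" "PO y = M"
  shows "iso (fibre E N) (sphi S (x, y))"
proof -
  let ?d = "\<kappa> (push E m (prd K x y)) \<cdot>\<^bsub>X\<^esub> lift E m (prd K x y)"
  let ?c = "lift E n (prd K (fO (sfun S) x) (fO (sfun S) y)) \<cdot>\<^bsub>X\<^esub> prodmap K (\<kappa> x) (\<kappa> y)"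
  have "cocartesian (proj E) ?d" by (rule cocart_comp') simp_all
  moreover have "cocartesian (proj E) ?c" by (intro cocart_comp' cocart_prod) simp_all
  \<comment> \<open>The pair of projections is the generic pair of elements; at it the evaluation
    rule for \<open>sphi S\<close> says precisely that \<open>sphi S (x, y)\<close> carries
    \<open>?c\<close> to \<open>?d\<close>.\<close>
  moreover have "?c = emul n (\<kappa> x \<cdot>\<^bsub>X\<^esub> pr1 K x y) (\<kappa> y \<cdot>\<^bsub>X\<^esub> pr2 K x y)"
    "?d = \<kappa> (push E m (prd K x y)) \<cdot>\<^bsub>X\<^esub> emul m (pr1 K x y) (pr2 K x y)"
    by (simp_all add: emul_def KK.prodmap_eq)
  ultimately show ?thesis
    by (intro vertical_iso[of ?c ?d]) simp_all
qed

lemma iso_sphi0: "iso (fibre E N) (sphi0 S)"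
proof (rule vertical_iso)
  show "cocartesian (proj E) (lift E u (one K))" by simp
  show "cocartesian (proj E) (\<kappa> (push E e (one K)) \<cdot>\<^bsub>X\<^esub> lift E e (one K))" by (rule cocart_comp') simp_all
  show "sphi0 S \<cdot>\<^bsub>X\<^esub> lift E u (one K) = \<kappa> (push E e (one K)) \<cdot>\<^bsub>X\<^esub> lift E e (one K)"
    using sphi0_simps(5)[of "idn X (one K)"] by simp
qed simp_all

text \<open>Elements of the form \<open>\<kappa> x \<cdot> a\<close> suffice for testing. In the
  associativity axiom, for instance, both sides send the product of the images of \<open>a\<close>,
  \<open>b\<close>, \<open>c\<close> under \<open>\<kappa>\<close> to the image of
  \<open>a (b c)\<close>.\<close>

lemma strong_monoidal_S: "strong_monoidal S"
  unfolding strong_monoidal_def Let_def S_simps(1,2,4,5) G.V_simps(1,2) H.V_simps(1,2) fib_simps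
proof (intro conjI ballI S_simps G.monoidal_category_V H.monoidal_category_V refl)
  show "sphi0 S \<in> hom (fibre E N) (push E u (one K)) (fO (sfun S) (push E e (one K)))"
    by (simp add: fib_Arr_iff)
  show "iso (fibre E N) (sphi0 S)" by (rule iso_sphi0)
  fix x assume "x \<in> Obj (fibre E M)"
  then have [simp]: "x \<in> Obj X" "PO x = M" by (simp_all add: fib_Obj)
  show "fA (sfun S) (mlunit G.V x) \<cdot>\<^bsub>X\<^esub> sphi S (push E e (one K), x) \<cdot>\<^bsub>X\<^esub> tenA H.V (sphi0 S) (idn X (fO
      (sfun S) x)) =
         mlunit H.V (fO (sfun S) x)"
    by (rule dense_ext[OF H.dense_emul[OF H.dense_unit
        dense_kappa[OF dense_top]], of x]) ((elim exE conjE)?, simp)+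
  show "fA (sfun S) (mrunit G.V x) \<cdot>\<^bsub>X\<^esub> sphi S (x, push E e (one K)) \<cdot>\<^bsub>X\<^esub> tenA H.V (idn X (fO (sfun S) x))
      (sphi0 S) =
         mrunit H.V (fO (sfun S) x)"
    by (rule dense_ext[OF H.dense_emul[OF
        dense_kappa[OF dense_top] H.dense_unit], of x]) ((elim exE conjE)?, simp)+
  fix y assume "y \<in> Obj (fibre E M)"
  then have [simp]: "y \<in> Obj X" "PO y = M" by (simp_all add: fib_Obj)
  show "sphi S (x, y) \<in> hom (fibre E N) (tenO H.V (fO (sfun S) x) (fO (sfun S) y)) (fO (sfun S) (tenO
      G.V x y))"
    by (simp add: fib_Arr_iff)
  show "iso (fibre E N) (sphi S (x, y))" by (rule iso_sphi) simp_all
  fix z assume "z \<in> Obj (fibre E M)"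
  then have [simp]: "z \<in> Obj X" "PO z = M" by (simp_all add: fib_Obj)
  show "fA (sfun S) (massoc G.V x y z) \<cdot>\<^bsub>X\<^esub> sphi S (tenO G.V x y, z) \<cdot>\<^bsub>X\<^esub> tenA H.V (sphi S (x, y)) (idn X
      (fO (sfun S) z)) =
     sphi S (x, tenO G.V y z) \<cdot>\<^bsub>X\<^esub> tenA H.V (idn X (fO (sfun S) x)) (sphi S (y, z)) \<cdot>\<^bsub>X\<^esub>
       massoc H.V (fO (sfun S) x) (fO (sfun S) y) (fO (sfun S) z)"
    by (rule dense_ext[OF H.dense_emul[OF H.dense_emul[OF dense_kappa[OF dense_top]
        dense_kappa[OF dense_top]]
        dense_kappa[OF dense_top]], of x y z]) ((elim exE conjE)?, simp)+
next
  fix f assume "f \<in> Arr (fibre E M)"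
  then have f [simp]: "f \<in> Arr X" "PO (Dom X f) = M" "PA f = idn B M" "PO (Cod X f) = M"
    using vert_Cod by (auto simp add: fib_Arr_iff)
  fix g assume "g \<in> Arr (fibre E M)"
  then have g [simp]: "g \<in> Arr X" "PO (Dom X g) = M" "PA g = idn B M" "PO (Cod X g) = M"
    using vert_Cod by (auto simp add: fib_Arr_iff)
  show "sphi S (Cod X f, Cod X g) \<cdot>\<^bsub>X\<^esub> tenA H.V (fA (sfun S) f) (fA (sfun S) g) =
      fA (sfun S) (tenA G.V f g) \<cdot>\<^bsub>X\<^esub> sphi S (Dom X f, Dom X g)"
    by (rule dense_ext[OF H.dense_emul[OF dense_kappa[OF dense_top]
        dense_kappa[OF dense_top]], of "Dom X f" "Dom X g"])
      ((elim exE conjE)?, simp)+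
qed

text \<open>Since the structure maps of \<open>S\<close> and \<open>T\<close> are determined by
  \<open>\<kappa>\<close> and \<open>\<kappa>'\<close>, a transformation carrying
  \<open>\<kappa>\<close> to \<open>\<kappa>'\<close> respects them automatically.\<close>

lemma monoidal_ntransI:
  assumes T: "mfun E M m e N n u T \<kappa>'" and t: "is_ntrans t" "nsrc t = sfun S" "ntrg t = sfun T"
    and el: "\<And>x. x \<in> Obj X \<Longrightarrow> PO x = M \<Longrightarrow> nc t x \<cdot>\<^bsub>X\<^esub> \<kappa> x = \<kappa>' x"
  shows "monoidal_ntrans \<lparr>mnsrc = S, mntrg = T, mnt = t\<rparr>"
proof -
  interpret T: mfun E M m e N n u T \<kappa>' by (rule T)
  have h: "nc t x \<in> hom (fibre E N) (fO (sfun S) x) (fO (sfun T) x)" if "x \<in> Obj X" "PO x = M" for x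
  proof -
    have "x \<in> Obj (fibre E M)" using that by (simp add: fib_Obj)
    then show ?thesis using t S_simps(4,5) unfolding is_ntrans_def Let_def by metis
  qed
  then have [simp]: "nc t x \<in> Arr X" "Dom X (nc t x) = fO (sfun S) x" "Cod X (nc t x) = fO (sfun T) x"
    "PA (nc t x) = idn B N" if "x \<in> Obj X" "PO x = M" for x using that by (auto simp: fib_Arr_iff)
  have [simp]: "nc t x \<cdot>\<^bsub>X\<^esub> \<kappa> x \<cdot>\<^bsub>X\<^esub> a = \<kappa>' x \<cdot>\<^bsub>X\<^esub> a" if "x \<in> Obj X" "PO x = M" "a \<in> Arr X" "Cod X a = x"
      for x a
  proof -
    have "nc t x \<cdot>\<^bsub>X\<^esub> \<kappa> x \<cdot>\<^bsub>X\<^esub> a = (nc t x \<cdot>\<^bsub>X\<^esub> \<kappa> x) \<cdot>\<^bsub>X\<^esub> a" using that by simp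
    then show ?thesis using el that by simp
  qed
  show ?thesis
    unfolding monoidal_ntrans_def Let_def mntrans.simps S_simps T.S_simps G.V_simps(1,2) H.V_simps(1,2)
        fib_simps
  proof (intro conjI ballI strong_monoidal_S T.strong_monoidal_S refl t)
    show "nc t (push E e (one K)) \<cdot>\<^bsub>X\<^esub> sphi0 S = sphi0 T"
      by (rule dense_ext[OF H.dense_unit]) ((elim exE conjE)?, simp)+
    fix x y assume "x \<in> Obj (fibre E M)" "y \<in> Obj (fibre E M)"
    then have [simp]: "x \<in> Obj X" "PO x = M" "y \<in> Obj X" "PO y = M" by (simp_all add: fib_Obj)
    show "nc t (tenO G.V x y) \<cdot>\<^bsub>X\<^esub> sphi S (x, y) = sphi T (x, y) \<cdot>\<^bsub>X\<^esub> tenA H.V (nc t x) (nc t y)"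
      by (rule dense_ext[OF H.dense_emul[OF dense_kappa[OF dense_top]
          dense_kappa[OF dense_top]], of x y])
        ((elim exE conjE)?, simp)+
  qed
qed

text \<open>The inverse of \<open>t\<close> in \<open>CAT\<close> carries \<open>\<kappa>'\<close>
  back to \<open>\<kappa>\<close>, so it is monoidal by the same criterion.\<close>

lemma inv_cell_TWOGP:
  assumes T: "mfun E M m e N n u T \<kappa>'" and t: "is_niso t" "nsrc t = sfun S" "ntrg t = sfun T"
    and el: "\<And>x. x \<in> Obj X \<Longrightarrow> PO x = M \<Longrightarrow> nc t x \<cdot>\<^bsub>X\<^esub> \<kappa> x = \<kappa>' x"
  shows "inv_cell2 TWOGP S T \<lparr>mnsrc = S, mntrg = T, mnt = t\<rparr>"
proof -
  interpret T: mfun E M m e N n u T \<kappa>' by (rule T)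
  have S': "mfun E M m e N n u S \<kappa>" by unfold_locales
  have tn: "is_ntrans t" using t by (simp add: is_niso_def)
  have h: "nc t x \<in> hom (fibre E N) (fO (sfun S) x) (fO (sfun T) x)" if "x \<in> Obj X" "PO x = M" for x
  proof -
    have "x \<in> Obj (fibre E M)" using that by (simp add: fib_Obj)
    then show ?thesis using tn t S_simps(4,5) unfolding is_ntrans_def Let_def by metis
  qed
  obtain s where s: "is_ntrans s" "nsrc s = sfun T" "ntrg s = sfun S" "nvcomp s t = nid (sfun S)"
      "nvcomp t s = nid (sfun T)"
    using niso_inv_cell[OF t(1)] t by (auto simp: inv_cell2_def CAT_def)
  have hs: "nc s x \<in> hom (fibre E N) (fO (sfun T) x) (fO (sfun S) x)" if "x \<in> Obj X" "PO x = M" for x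
  proof -
    have "x \<in> Obj (fibre E M)" using that by (simp add: fib_Obj)
    then show ?thesis using s T.S_simps(4,5) unfolding is_ntrans_def Let_def by metis
  qed
  have "nc s x \<cdot>\<^bsub>X\<^esub> \<kappa>' x = \<kappa> x" if x: "x \<in> Obj X" "PO x = M" for x
  proof -
    have "x \<in> Obj (fibre E M)" using x by (simp add: fib_Obj)
    then have i: "nc s x \<cdot>\<^bsub>X\<^esub> nc t x = idn X (fO (sfun S) x)"
      using fun_cong[OF arg_cong[OF s(4), of nc], of x] t by (simp add: nvcomp_def nid_def)
    have "nc s x \<cdot>\<^bsub>X\<^esub> \<kappa>' x = nc s x \<cdot>\<^bsub>X\<^esub> nc t x \<cdot>\<^bsub>X\<^esub> \<kappa> x" using el x by simp
    also have "\<dots> = (nc s x \<cdot>\<^bsub>X\<^esub> nc t x) \<cdot>\<^bsub>X\<^esub> \<kappa> x" using x h[OF x] hs[OF x] by (simp add: fib_Arr_iff)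
    finally show ?thesis using i x by simp
  qed
  then have sm: "monoidal_ntrans \<lparr>mnsrc = T, mntrg = S, mnt = s\<rparr>"
    by (intro T.monoidal_ntransI[OF S'] s)
  have tm: "monoidal_ntrans \<lparr>mnsrc = S, mntrg = T, mnt = t\<rparr>"
    by (intro monoidal_ntransI[OF T] tn t el)
  show ?thesis unfolding inv_cell2_def
    using sm tm s by (auto simp: TWOGP_def intro!: bexI[of _ "\<lparr>mnsrc = T, mntrg = S, mnt = s\<rparr>"])
qed

end

section \<open>Changes of base as monoidal functors, and the pseudofunctor to 2-groups\<close>

context cmo begin

lemma cmo_monoidI: "group_object L G \<Longrightarrow> cmo_monoid E (gcar G) (gmul G) (gunit G)"
  by (intro cmo_monoid.intro cmo_axioms) (use LB.group_objI[of G] in \<open>simp add: group_obj_def\<close>)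

text \<open>For \<open>F(f)\<close> the arrow \<open>\<kappa> x\<close> is the chosen lifting. The
  two homomorphism equations are the equalities of base images under which the structure maps,
  defined by \<open>vfactor\<close>, exist.\<close>

lemma mfun_group_smfun:
  assumes "(G, f, H) \<in> Arr (group_cat L)"
  shows "mfun E (gcar G) (gmul G) (gunit G) (gcar H) (gmul H) (gunit H) (group_smfun E (G, f, H)) (lift
      E f)"
proof -
  have o: "group_object L G" "group_object L H" and f [simp]: "f \<in> Arr B" "Dom B f = gcar G"
      "Cod B f = gcar H"
    and fm: "f \<cdot>\<^bsub>B\<^esub> gmul G = gmul H \<cdot>\<^bsub>B\<^esub> prodmap L f f" and fe: "f \<cdot>\<^bsub>B\<^esub> gunit G = gunit H"
    using assms by (auto simp: LB.group_cat_simps)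
  interpret G: cmo_monoid E "gcar G" "gmul G" "gunit G" by (rule cmo_monoidI[OF o(1)])
  interpret H: cmo_monoid E "gcar H" "gmul H" "gunit H" by (rule cmo_monoidI[OF o(2)])
  let ?S = "group_smfun E (G, f, H)" and ?m = "gmul G" and ?n = "gmul H"
  have s: "ssrc ?S = group_moncat E G" "strg ?S = group_moncat E H" "sfun ?S = change_base E f"
    "sphi0 ?S = vfactor E (lift E (gunit H) (one K)) (lift E f (push E (gunit G) (one K)) \<cdot>\<^bsub>X\<^esub> lift E
        (gunit G) (one K))"
    by (simp_all add: group_smfun_def Let_def)
  have h: "f \<in> hom B (gcar G) (gcar H)" by simp
  define c where "c = (\<lambda>x y. lift E ?n (prd K (push E f x) (push E f y)) \<cdot>\<^bsub>X\<^esub> prodmap K (lift E f x) (lift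
      E f y))"
  define d where "d = (\<lambda>x y. lift E f (push E ?m (prd K x y)) \<cdot>\<^bsub>X\<^esub> lift E ?m (prd K x y))"
  have p: "sphi ?S (x, y) = vfactor E (c x y) (d x y)"
      if "x \<in> Obj X" "PO x = gcar G" "y \<in> Obj X" "PO y = gcar G" for x y
    using that by (simp add: group_smfun_def Let_def c_def d_def fib_Obj)
  have cd: "cocartesian (proj E) (c x y)" "d x y \<in> Arr X" "Dom X (d x y) = Dom X (c x y)"
      "PA (d x y) = PA (c x y)"
      "Dom X (c x y) = prd K x y"
      "Cod X (c x y) = push E ?n (prd K (push E f x) (push E f y))"
          "Cod X (d x y) = push E f (push E ?m (prd K x y))"
    if [simp]: "x \<in> Obj X" "PO x = gcar G" "y \<in> Obj X" "PO y = gcar G" for x y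
  proof -
    show "cocartesian (proj E) (c x y)" unfolding c_def by (intro cocart_comp' cocart_prod) simp_all
    show "d x y \<in> Arr X" "Dom X (d x y) = Dom X (c x y)" "PA (d x y) = PA (c x y)"
        "Dom X (c x y) = prd K x y"
      "Cod X (c x y) = push E ?n (prd K (push E f x) (push E f y))"
          "Cod X (d x y) = push E f (push E ?m (prd K x y))"
      by (simp_all add: c_def d_def fm)
  qed
  have 1: "sphi ?S (x, y) \<in> Arr X"
      "Dom X (sphi ?S (x, y)) = push E ?n (prd K (push E f x) (push E f y))"
    "Cod X (sphi ?S (x, y)) = push E f (push E ?m (prd K x y))" "PA (sphi ?S (x, y)) = idn B (gcar H)"
    if xy [simp]: "x \<in> Obj X" "PO x = gcar G" "y \<in> Obj X" "PO y = gcar G" for x y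
    unfolding p[OF xy] using vfactor_simps[OF cd(1-4)[OF xy]] cd(5-7)[OF xy] by simp_all
  have 2: "sphi ?S (x, y) \<cdot>\<^bsub>X\<^esub> emul ?n (lift E f x \<cdot>\<^bsub>X\<^esub> a) (lift E f y \<cdot>\<^bsub>X\<^esub> b) =
      lift E f (push E ?m (prd K x y)) \<cdot>\<^bsub>X\<^esub> emul ?m a b"
    if xy [simp]: "x \<in> Obj X" "PO x = gcar G" "y \<in> Obj X" "PO y = gcar G"
      and ab: "a \<in> Arr X" "b \<in> Arr X" "Dom X a = Dom X b" "Cod X a = x" "Cod X b = y" for x y a b
  proof -
    have "emul ?n (lift E f x \<cdot>\<^bsub>X\<^esub> a) (lift E f y \<cdot>\<^bsub>X\<^esub> b) = c x y \<cdot>\<^bsub>X\<^esub> pairing K a b"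
      using ab by (simp add: emul_def c_def)
    then have "sphi ?S (x, y) \<cdot>\<^bsub>X\<^esub> emul ?n (lift E f x \<cdot>\<^bsub>X\<^esub> a) (lift E f y \<cdot>\<^bsub>X\<^esub> b) =
        (sphi ?S (x, y) \<cdot>\<^bsub>X\<^esub> c x y) \<cdot>\<^bsub>X\<^esub> pairing K a b"
      using 1[OF xy] ab cd[OF xy] cocart_Arr[OF cd(1)[OF xy]] by simp
    also have "sphi ?S (x, y) \<cdot>\<^bsub>X\<^esub> c x y = d x y"
      unfolding p[OF xy] by (rule vfactor_simps[OF cd(1-4)[OF xy]])
    finally show ?thesis using ab by (simp add: d_def emul_def)
  qed
  let ?c0 = "lift E (gunit H) (one K)" and ?d0 =
      "lift E f (push E (gunit G) (one K)) \<cdot>\<^bsub>X\<^esub> lift E (gunit G) (one K)"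
  note v0 = vfactor_simps[of ?c0 ?d0, folded s(4)]
  have 3: "sphi0 ?S \<in> Arr X" "Dom X (sphi0 ?S) = push E (gunit H) (one K)"
    "Cod X (sphi0 ?S) = push E f (push E (gunit G) (one K))" "PA (sphi0 ?S) = idn B (gcar H)"
        "sphi0 ?S \<cdot>\<^bsub>X\<^esub> ?c0 = ?d0"
    using v0 by (simp_all add: fe)
  have 4: "sphi0 ?S \<cdot>\<^bsub>X\<^esub> ?c0 \<cdot>\<^bsub>X\<^esub> t = lift E f (push E (gunit G) (one K)) \<cdot>\<^bsub>X\<^esub> lift E (gunit G) (one K) \<cdot>\<^bsub>X\<^esub> t"
    if "t \<in> Arr X" "Cod X t = one K" for t
  proof -
    have "sphi0 ?S \<cdot>\<^bsub>X\<^esub> ?c0 \<cdot>\<^bsub>X\<^esub> t = (sphi0 ?S \<cdot>\<^bsub>X\<^esub> ?c0) \<cdot>\<^bsub>X\<^esub> t"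
      using 3(1-4) that by simp
    then show ?thesis unfolding 3(5) using that by simp
  qed
  have ext: "sphi ?S \<in> extensional (Obj (fibre E (gcar G)) \<times> Obj (fibre E (gcar G)))"
    by (simp add: group_smfun_def Let_def)
  show ?thesis
    by (unfold_locales; (simp add: s(1-3) functor_chg[OF h] chg_simps[OF h] ext 1 2 3(1-4) 4; fail)?)
qed

lemma functor_comp:
  assumes "is_functor F" "fsrc F = fibre E A" "ftrg F = fibre E C" "u \<in> Arr X" "PO (Dom X u) = A"
      "PA u = idn B A"
    "v \<in> Arr X" "PA v = idn B A" "Dom X v = Cod X u"
  shows "fA F (v \<cdot>\<^bsub>X\<^esub> u) = fA F v \<cdot>\<^bsub>X\<^esub> fA F u"
proof -
  have "u \<in> Arr (fibre E A)" "v \<in> Arr (fibre E A)" using assms vert_Cod[of u A]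
      by (auto simp: fib_Arr_iff)
  then show ?thesis using assms(1-3,9) unfolding is_functor_def Let_def by simp
qed

lemma functor_idn:
  assumes "is_functor F" "fsrc F = fibre E A" "ftrg F = fibre E C" "x \<in> Obj X" "PO x = A"
  shows "fA F (idn X x) = idn X (fO F x)"
proof -
  have "x \<in> Obj (fibre E A)" using assms by (auto simp: fib_Obj)
  then show ?thesis using assms(1-3) unfolding is_functor_def Let_def by simp
qed

lemma fcomp_app:
  "fsrc F = fibre E A \<Longrightarrow> x \<in> Obj X \<Longrightarrow> PO x = A \<Longrightarrow> fO (G \<bullet> F) x = fO G (fO F x)"
  "fsrc F = fibre E A \<Longrightarrow> u \<in> Arr X \<Longrightarrow> PO (Dom X u) = A \<Longrightarrow> PA u = idn B A \<Longrightarrow> fA (G \<bullet> F) u = fA G (fA F u)"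
  by (simp_all add: fcomp_def fib_Obj fib_Arr_iff)

lemma mfun_smid:
  assumes "cmo_monoid E M m e"
  shows "mfun E M m e M m e (smid (monoid_moncat E M m e)) (idn X)"
proof -
  interpret cmo_monoid E M m e by (rule assms)
  have f: "fO (fid (fibre E M)) x = x" if "x \<in> Obj X" "PO x = M" for x using that
      by (simp add: fid_def fib_Obj)
  have f': "fA (fid (fibre E M)) u = u" if "u \<in> Arr X" "PO (Dom X u) = M" "PA u = idn B M" for u
    using that by (simp add: fid_def fib_Arr_iff)
  have s: "ssrc (smid V) = V" "strg (smid V) = V" "sfun (smid V) = fid (fibre E M)"
      "fsrc (fid (fibre E M)) = fibre E M"
    "ftrg (fid (fibre E M)) = fibre E M" "sphi0 (smid V) = idn X (push E e (one K))"
    "sphi (smid V) \<in> extensional (Obj (fibre E M) \<times> Obj (fibre E M))"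
    by (simp_all add: smid_def fid_def)
  have p: "sphi (smid V) (x, y) = idn X (push E m (prd K x y))"
      if "x \<in> Obj X" "PO x = M" "y \<in> Obj X" "PO y = M" for x y
    using that by (simp add: smid_def fib_Obj)
  show ?thesis
    by (unfold_locales; (simp add: s is_functor_fid[OF cat_fibre] cocart_id p f f' vert_Cod; fail)?)
qed

lemma mfun_smcomp:
  assumes "mfun E M m e N n u S \<kappa>" "mfun E N n u Q q v T \<kappa>'"
  shows "mfun E M m e Q q v (smcomp T S) (\<lambda>x. \<kappa>' (fO (sfun S) x) \<cdot>\<^bsub>X\<^esub> \<kappa> x)"
proof -
  interpret S: mfun E M m e N n u S \<kappa> by (rule assms)
  interpret T: mfun E N n u Q q v T \<kappa>' by (rule assms)
  have s: "ssrc (smcomp T S) = S.G.V" "strg (smcomp T S) = T.H.V" "sfun (smcomp T S) = sfun T \<bullet> sfun S"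
    "fsrc (sfun T \<bullet> sfun S) = fibre E M" "ftrg (sfun T \<bullet> sfun S) = fibre E Q"
    "sphi0 (smcomp T S) = fA (sfun T) (sphi0 S) \<cdot>\<^bsub>X\<^esub> sphi0 T"
    "sphi (smcomp T S) \<in> extensional (Obj (fibre E M) \<times> Obj (fibre E M))"
    by (simp_all add: smcomp_def Let_def fcomp_def)
  have p: "sphi (smcomp T S) (x, y) =
      fA (sfun T) (sphi S (x, y)) \<cdot>\<^bsub>X\<^esub> sphi T (fO (sfun S) x, fO (sfun S) y)"
    if "x \<in> Obj X" "PO x = M" "y \<in> Obj X" "PO y = M" for x y
    using that by (simp add: smcomp_def Let_def fib_Obj)
  have fn: "is_functor (sfun T \<bullet> sfun S)" by (rule is_functor_fcomp) simp_all
  have c: "cocartesian (proj E) (\<kappa>' (fO (sfun S) x) \<cdot>\<^bsub>X\<^esub> \<kappa> x)" if "x \<in> Obj X" "PO x = M" for x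
    using that by (intro cocart_comp') simp_all
  note fa = fcomp_app[OF S.S_simps(4)]
  show ?thesis
    by (unfold_locales; (simp add: s fn c p fa vert_Cod[where A = M]; fail)?)
      (clarsimp simp add: s fa vert_Cod[where A = M])
qed

text \<open>2-cells record their source and target, so composites have to agree as records. The
  structure maps agree by functoriality of \<open>sfun W\<close>.\<close>

lemma smcomp_assoc:
  assumes "mfun E M m e N n u S \<kappa>" "mfun E N n u Q q v T \<kappa>'" "mfun E Q q v R r w W \<kappa>''"
  shows "smcomp W (smcomp T S) = smcomp (smcomp W T) S"
proof -
  interpret S: mfun E M m e N n u S \<kappa> by (rule assms)
  interpret T: mfun E N n u Q q v T \<kappa>' by (rule assms)
  interpret W: mfun E Q q v R r w W \<kappa>'' by (rule assms)
  have f: "(sfun W \<bullet> sfun T) \<bullet> sfun S = sfun W \<bullet> (sfun T \<bullet> sfun S)" by (rule fcomp_assoc) simp_all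
  note fa = fcomp_app[OF S.S_simps(4)] fcomp_app[OF T.S_simps(4)]
  note fc = functor_comp[OF W.S_simps(3,4,5)]
  show ?thesis
    by (auto simp: smcomp_def Let_def f fa fc fun_eq_iff restrict_def fib_Obj)
qed

lemma smcomp_smid:
  assumes "mfun E M m e N n u S \<kappa>"
  shows "smcomp S (smid (monoid_moncat E M m e)) = S" "smcomp (smid (monoid_moncat E N n u)) S = S"
proof -
  interpret S: mfun E M m e N n u S \<kappa> by (rule assms)
  have f: "fO (fid (fibre E A)) x = x" if "x \<in> Obj X" "PO x = A" for x A using that
      by (simp add: fid_def fib_Obj)
  have f': "fA (fid (fibre E A)) u = u" if "u \<in> Arr X" "PO (Dom X u) = A" "PA u = idn B A" for u A
    using that by (simp add: fid_def fib_Arr_iff)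
  have c: "sfun S \<bullet> fid (fibre E M) = sfun S" "fid (fibre E N) \<bullet> sfun S = sfun S"
    using fcomp_fid[OF S.S_simps(3)] by simp_all
  note fi = functor_idn[OF S.S_simps(3,4,5)]
  \<comment> \<open>Equality of records compares \<open>sphi\<close> on all pairs, also on those
    outside the fibre.\<close>
  have e: "sphi S (x, y) = undefined" if "\<not> (x \<in> Obj X \<and> PO x = M \<and> y \<in> Obj X \<and> PO y = M)" for x y
    using S.S_simps(6) that by (auto simp: extensional_def fib_Obj)
  show "smcomp S (smid (monoid_moncat E M m e)) = S" "smcomp (smid (monoid_moncat E N n u)) S = S"
    by (rule smfun.equality; auto simp: smcomp_def smid_def Let_def f f' c fi fun_eq_iff restrict_def
        fib_Obj e)+
qed

lemma group_smfun_simps: "sfun (group_smfun E (G, f, H)) = change_base E f"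
  "ssrc (group_smfun E (G, f, H)) = group_moncat E G"
      "strg (group_smfun E (G, f, H)) = group_moncat E H"
  by (simp_all add: group_smfun_def Let_def)

text \<open>The structure cells are those of the pseudofunctor to \<open>CAT\<close>. They compare
  composites of liftings, so they carry one \<open>\<kappa>\<close> to the other and are invertible
  monoidal cells by \<open>inv_cell_TWOGP\<close>.\<close>

lemma groupal_if_two_groups:
  assumes tg: "\<And>G. group_object L G \<Longrightarrow> two_group (group_moncat E G)"
  shows "groupal E"
proof -
  let ?F = "assoc_pseudofunctor E" and ?P = "group_pseudofunctor E" and ?G = "group_cat L"
  let ?U = "\<lambda>a. fst (snd a)"
  note gs = LB.group_cat_simps
  have catG: "category ?G" by (rule LB.category_group_cat)
  have U: "fA (group_forget L) a = ?U a" if "a \<in> Arr ?G" for a using that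
      by (simp add: group_forget_def)
  have UO: "fO (group_forget L) A = gcar A" if "group_object L A" for A using that
      by (simp add: group_forget_def gs)
  have P: "psO ?P = group_moncat E" "psA ?P = group_smfun E"
    "mnsrc (psC ?P b a) = smcomp (group_smfun E b) (group_smfun E a)"
    "mntrg (psC ?P b a) = group_smfun E (b \<cdot>\<^bsub>?G\<^esub> a)"
    "a \<in> Arr ?G \<Longrightarrow> b \<in> Arr ?G \<Longrightarrow> mnt (psC ?P b a) = psC ?F (?U b) (?U a)"
    "mnsrc (psI ?P A) = smid (group_moncat E A)" "mntrg (psI ?P A) = group_smfun E (idn ?G A)"
    "group_object L A \<Longrightarrow> mnt (psI ?P A) = psI ?F (gcar A)" for a b A
    by (simp_all add: group_pseudofunctor_def Let_def ps_precomp_def U UO)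
  have PC: "psC ?P b a = \<lparr>mnsrc = smcomp (group_smfun E b) (group_smfun E a), mntrg =
      group_smfun E (b \<cdot>\<^bsub>?G\<^esub> a),
      mnt = psC ?F (?U b) (?U a)\<rparr>" if "a \<in> Arr ?G" "b \<in> Arr ?G" for a b
    using P(3)[of b a] P(4)[of b a] P(5)[OF that] by (cases "psC ?P b a") simp
  have PI: "psI ?P A = \<lparr>mnsrc = smid (group_moncat E A), mntrg = group_smfun E (idn ?G A), mnt =
      psI ?F (gcar A)\<rparr>"
    if "group_object L A" for A using P(6)[of A] P(7)[of A] P(8)[OF that] by (cases "psI ?P A") simp
  note T = TWOGP_def
  have Fs: "psA ?F = change_base E" "psO ?F = fibre E"
      "nsrc (psC ?F g f) = change_base E g \<bullet> change_base E f"
    "ntrg (psC ?F g f) = change_base E (g \<cdot>\<^bsub>B\<^esub> f)" "nsrc (psI ?F A) = fid (fibre E A)"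
    "ntrg (psI ?F A) = change_base E (idn B A)" for g f A by (simp_all add: assoc_pseudofunctor_def)
  \<comment> \<open>Supplies the coherence equations for the underlying transformations; an equation
    in \<open>TWOGP\<close> adds only the equality of the recorded sources and targets.\<close>
  note pf = pseudofunctor_assoc[unfolded pseudofunctor_def Fs]
  have C: "lwhisker2 CAT = nlwhisker" "rwhisker2 CAT = nrwhisker" "vcomp2 CAT = nvcomp" "one2 CAT = nid"
    by (simp_all add: CAT_def)
  have arr: "\<exists>G f H. a = (G, f, H) \<and> group_object L G \<and> group_object L H \<and> f \<in> Arr B \<and>
      Dom B f = gcar G \<and> Cod B f = gcar H"
    if "a \<in> Arr ?G" for a using that by (cases a) (simp add: gs)
  have mf: "mfun E (gcar G) (gmul G) (gunit G) (gcar H) (gmul H) (gunit H) (group_smfun E (G, f, H))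
      (lift E f)"
    if "(G, f, H) \<in> Arr ?G" for G f H by (rule mfun_group_smfun[OF that])
  have "pseudofunctor ?G TWOGP ?P"
    unfolding pseudofunctor_def P(1,2)
  proof (intro conjI ballI impI catG)
    fix A assume "A \<in> Obj ?G"
    then have A: "group_object L A" by (simp add: gs)
    interpret A: cmo_monoid E "gcar A" "gmul A" "gunit A" by (rule cmo_monoidI[OF A])
    have i: "(A, idn B (gcar A), A) \<in> Arr ?G"
      using catG A unfolding category_def by (auto simp: gs(1,5))
    show "group_moncat E A \<in> obj2 TWOGP" using tg[OF A] by (simp add: T)
    have "inv_cell2 TWOGP (smid (group_moncat E A)) (group_smfun E (A, idn B (gcar A), A))
      \<lparr>mnsrc = smid (group_moncat E A), mntrg = group_smfun E (A, idn B (gcar A), A), mnt =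
          psI ?F (gcar A)\<rparr>"
    proof (rule mfun.inv_cell_TWOGP[OF mfun_smid[OF A.cmo_monoid_axioms] mf[OF i] unitor])
      show "nc (psI ?F (gcar A)) x \<cdot>\<^bsub>X\<^esub> idn X x = lift E (idn B (gcar A)) x"
          if "x \<in> Obj X" "PO x = gcar A" for x
        using that by (simp add: assoc_pseudofunctor_def fib_Obj)
    qed (simp_all add: Fs group_smfun_simps smid_def)
    then show "inv_cell2 TWOGP (one1 TWOGP (group_moncat E A)) (group_smfun E (idn ?G A)) (psI ?P A)"
      unfolding PI[OF A] by (simp add: T gs)
  next
    fix a assume a: "a \<in> Arr ?G"
    then obtain G f H where a': "a = (G, f, H)" "group_object L G" "group_object L H"
      and f: "f \<in> Arr B" "Dom B f = gcar G" "Cod B f = gcar H" using arr by blast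
    interpret fm: mfun E "gcar G" "gmul G" "gunit G" "gcar H" "gmul H" "gunit H"
        "group_smfun E (G, f, H)" "lift E f"
      by (rule mf) (use a a' in simp)
    show "group_smfun E a \<in> mor2 TWOGP (group_moncat E (Dom ?G a)) (group_moncat E (Cod ?G a))"
      using tg a' fm.strong_monoidal_S by (simp add: T gs group_smfun_simps)
    have i: "idn ?G G \<in> Arr ?G" "idn ?G H \<in> Arr ?G" using catG a'(2,3) unfolding category_def
        by (auto simp: gs(1))
    have ai: "a \<cdot>\<^bsub>?G\<^esub> idn ?G G = a" "idn ?G H \<cdot>\<^bsub>?G\<^esub> a = a" using f a' by (simp_all add: gs)
    have iU: "?U (idn ?G G) = idn B (gcar G)" "?U (idn ?G H) = idn B (gcar H)" "?U a = f" using a'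
        by (simp_all add: gs)
    have dc: "Dom ?G a = G" "Cod ?G a = H" using a' by (simp_all add: gs)
    note sm = smcomp_smid[OF fm.mfun_axioms]
    have u: "nvcomp (psC ?F f (idn B (gcar G))) (nlwhisker (change_base E f) (psI ?F (gcar G))) =
        nid (change_base E f)"
      "nvcomp (psC ?F (idn B (gcar H)) f) (nrwhisker (psI ?F (gcar H)) (change_base E f)) =
          nid (change_base E f)"
      using pf f unfolding C by auto
    show "vcomp2 TWOGP (psC ?P a (idn ?G (Dom ?G a))) (lwhisker2 TWOGP (group_smfun E a) (psI ?P (Dom ?G
        a))) =
        one2 TWOGP (group_smfun E a)"
      unfolding dc PI[OF a'(2)] PC[OF i(1) a] using sm(1) u(1) ai iU
          by (simp add: T a'(1) group_smfun_simps)
    show "vcomp2 TWOGP (psC ?P (idn ?G (Cod ?G a)) a) (rwhisker2 TWOGP (psI ?P (Cod ?G a)) (group_smfun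
        E a)) =
        one2 TWOGP (group_smfun E a)"
      unfolding dc PI[OF a'(3)] PC[OF a i(2)] using sm(2) u(2) ai iU
          by (simp add: T a'(1) group_smfun_simps)
    fix b assume b: "b \<in> Arr ?G" "Dom ?G b = Cod ?G a"
    then obtain g Q where b': "b = (H, g, Q)" "group_object L Q" and g: "g \<in> Arr B" "Dom B g = gcar H"
        "Cod B g = gcar Q"
      using arr[OF b(1)] a' by (auto simp: gs)
    interpret gm: mfun E "gcar H" "gmul H" "gunit H" "gcar Q" "gmul Q" "gunit Q"
        "group_smfun E (H, g, Q)" "lift E g"
      by (rule mf) (use b b' in simp)
    have ba: "b \<cdot>\<^bsub>?G\<^esub> a = (G, g \<cdot>\<^bsub>B\<^esub> f, Q)" using a' b' by (simp add: gs)
    have baA: "b \<cdot>\<^bsub>?G\<^esub> a \<in> Arr ?G" using catG a b unfolding category_def by (auto simp: hom_def)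
    have hf: "f \<in> hom B (gcar G) (gcar H)" "g \<in> hom B (gcar H) (gcar Q)" using f g by auto
    have "inv_cell2 TWOGP (smcomp (group_smfun E (H, g, Q)) (group_smfun E (G, f, H))) (group_smfun E
        (G, g \<cdot>\<^bsub>B\<^esub> f, Q))
      \<lparr>mnsrc = smcomp (group_smfun E (H, g, Q)) (group_smfun E (G, f, H)), mntrg =
          group_smfun E (G, g \<cdot>\<^bsub>B\<^esub> f, Q),
       mnt = psC ?F g f\<rparr>"
    proof (rule mfun.inv_cell_TWOGP[OF mfun_smcomp[OF fm.mfun_axioms gm.mfun_axioms]
        mf[OF baA[unfolded ba]] compositor[OF hf]])
      \<comment> \<open>The \<open>\<kappa>\<close> of the composite functor is a composite of two
        liftings, and the compositor is by construction its comparison with the lifting of the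
        composite.\<close>
      show "nc (psC ?F g f) x \<cdot>\<^bsub>X\<^esub> lift E g (fO (sfun (group_smfun E (G, f, H))) x) \<cdot>\<^bsub>X\<^esub> lift E f x =
          lift E (g \<cdot>\<^bsub>B\<^esub> f) x"
        if "x \<in> Obj X" "PO x = gcar G" for x
        using compositor_arr(2)[OF hf, of x] that f by (simp add: group_smfun_simps fib_Obj)
    qed (simp_all add: Fs group_smfun_simps smcomp_def Let_def)
    then show "inv_cell2 TWOGP (comp1 TWOGP (group_smfun E b) (group_smfun E a)) (group_smfun E (b \<cdot>\<^bsub>?G\<^esub>
        a)) (psC ?P b a)"
      unfolding PC[OF a b(1)] ba by (simp add: T a' b')
    fix c assume c: "c \<in> Arr ?G" "Dom ?G c = Cod ?G b"
    then obtain h R where c': "c = (Q, h, R)" "group_object L R" and h: "h \<in> Arr B" "Dom B h = gcar Q"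
        "Cod B h = gcar R"
      using arr[OF c(1)] b' by (auto simp: gs)
    interpret hm: mfun E "gcar Q" "gmul Q" "gunit Q" "gcar R" "gmul R" "gunit R"
        "group_smfun E (Q, h, R)" "lift E h"
      by (rule mf) (use c c' in simp)
    have cbA: "c \<cdot>\<^bsub>?G\<^esub> b \<in> Arr ?G" using catG c b unfolding category_def by (auto simp: hom_def)
    have cb: "c \<cdot>\<^bsub>?G\<^esub> b = (H, h \<cdot>\<^bsub>B\<^esub> g, R)" using c' b' by (simp add: gs)
    have cba: "(c \<cdot>\<^bsub>?G\<^esub> b) \<cdot>\<^bsub>?G\<^esub> a = c \<cdot>\<^bsub>?G\<^esub> b \<cdot>\<^bsub>?G\<^esub> a" using a' b' c' f g h by (simp add: gs)
    note sa = smcomp_assoc[OF fm.mfun_axioms gm.mfun_axioms hm.mfun_axioms]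
    have coh: "nvcomp (psC ?F h (g \<cdot>\<^bsub>B\<^esub> f)) (nlwhisker (change_base E h) (psC ?F g f)) =
        nvcomp (psC ?F (h \<cdot>\<^bsub>B\<^esub> g) f) (nrwhisker (psC ?F h g) (change_base E f))"
      using pf f g h unfolding C by auto
    show "vcomp2 TWOGP (psC ?P c (b \<cdot>\<^bsub>?G\<^esub> a)) (lwhisker2 TWOGP (group_smfun E c) (psC ?P b a)) =
      vcomp2 TWOGP (psC ?P (c \<cdot>\<^bsub>?G\<^esub> b) a) (rwhisker2 TWOGP (psC ?P c b) (group_smfun E a))"
      unfolding PC[OF a b(1)] PC[OF b(1) c(1)] PC[OF baA c(1)] PC[OF a cbA] cba
      using coh sa by (simp add: T group_smfun_simps a'(1) b'(1) c'(1) gs)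
  qed
  moreover have "psfun_eq ?G (ps_postcomp mcat sfun mnt ?P) (ps_precomp ?F (group_forget L))"
    unfolding psfun_eq_def
  proof (intro conjI ballI impI)
    fix A assume "A \<in> Obj ?G"
    then have A: "group_object L A" by (simp add: gs)
    interpret A: cmo_monoid E "gcar A" "gmul A" "gunit A" by (rule cmo_monoidI[OF A])
    show "psO (ps_postcomp mcat sfun mnt ?P) A = psO (ps_precomp ?F (group_forget L)) A"
       "psI (ps_postcomp mcat sfun mnt ?P) A = psI (ps_precomp ?F (group_forget L)) A"
      using A by (simp_all add: ps_postcomp_def ps_precomp_def P UO Fs)
  next
    fix a assume a: "a \<in> Arr ?G"
    then show "psA (ps_postcomp mcat sfun mnt ?P) a = psA (ps_precomp ?F (group_forget L)) a"
      by (cases a) (simp add: ps_postcomp_def ps_precomp_def P U Fs group_smfun_simps)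
    fix b assume "b \<in> Arr ?G"
    then show "psC (ps_postcomp mcat sfun mnt ?P) b a = psC (ps_precomp ?F (group_forget L)) b a"
      using a by (simp add: ps_postcomp_def ps_precomp_def P U)
  qed
  ultimately show ?thesis by (simp add: groupal_def)
qed

end

section \<open>Invertibility of the units\<close>

context cmo begin

text \<open>An identity is a cocartesian arrow over the same base arrow, so
  \<open>vertical_iso\<close> applies. This translates invertibility of unit components into
  cocartesianness.\<close>

lemma vertical_iso_iff:
  assumes "u \<in> Arr (fibre E A)"
  shows "iso (fibre E A) u \<longleftrightarrow> cocartesian (proj E) u"
proof
  show "cocartesian (proj E) u" if "iso (fibre E A) u" by (rule cocart_iso[OF iso_fibre[OF that]])
  have u: "u \<in> Arr X" "PO (Dom X u) = A" "PA u = idn B A" using assms by (auto simp: fib_Arr_iff)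
  show "iso (fibre E A) u" if "cocartesian (proj E) u"
    by (rule vertical_iso[OF cocart_id[of "Dom X u"] that]) (use u in simp_all)
qed

lemma term_map_fibre: "x \<in> Obj (fibre E (one L)) \<Longrightarrow> term_map K x \<in> Arr (fibre E (one L))"
  using LB.to_one[of "idn B (one L)"] by (auto simp: fib_Arr_iff fib_Obj)

lemma eta1_niso_iff_fibre:
  "is_niso (eta1 E) \<longleftrightarrow> (\<forall>x \<in> Obj (fibre E (one L)). cocartesian (proj E) (term_map K x))"
proof -
  have "is_ntrans (eta1 E)" using adjunction_LR1 by (simp add: adjunction_def)
  then show ?thesis
    using vertical_iso_iff[OF term_map_fibre] by (auto simp: is_niso_def eta1_def Let_def fid_def)
qed

text \<open>The terminal map of any \<open>x\<close> factors as the lifting of the terminal map of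
  its base object, followed by the terminal map of an object over \<open>one L\<close>.\<close>

lemma eta1_niso_iff_total:
  "is_niso (eta1 E) \<longleftrightarrow> (\<forall>x \<in> Obj X. cocartesian (proj E) (term_map K x))"
  unfolding eta1_niso_iff_fibre
proof (intro iffI ballI)
  fix x assume h: "\<forall>x \<in> Obj (fibre E (one L)). cocartesian (proj E) (term_map K x)" and x: "x \<in> Obj X"
  let ?l = "lift E (term_map L (PO x)) x" and ?y = "push E (term_map L (PO x)) x"
  have y: "?y \<in> Obj (fibre E (one L))" using x by (simp add: fib_Obj)
  have "cocartesian (proj E) (term_map K ?y \<cdot>\<^bsub>X\<^esub> ?l)"
    by (rule cocart_comp') (use h y x in \<open>auto simp: fib_Obj\<close>)
  then show "cocartesian (proj E) (term_map K x)" using x by simp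
qed (auto simp: fib_Obj)

lemma eta_Arr:
  assumes "A \<in> Obj B" "C \<in> Obj B" "z \<in> Obj (fibre E (prd L A C))"
  shows "nc (eta E A C) z \<in> Arr (fibre E (prd L A C))"
  using eta_arr(1)[OF assms] by simp

lemma eta_niso_iff:
  assumes "A \<in> Obj B" "C \<in> Obj B"
  shows "is_niso (eta E A C) \<longleftrightarrow>
      (\<forall>z \<in> Obj (fibre E (prd L A C)). iso (fibre E (prd L A C)) (nc (eta E A C) z))"
  using eta_ntrans[OF assms] by (simp add: is_niso_def) (simp add: eta_def Let_def fid_def)

text \<open>The unit at the pushforward of \<open>x\<close> along the diagonal of \<open>A\<close> turns the lifting of that diagonal
  into \<open>x \<rightarrow> x \<times> x\<close>, up to vertical isomorphisms.\<close>

lemma cocart_diagonal: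
  assumes A: "A \<in> Obj B" and niso: "is_niso (eta E A A)" and x: "x \<in> Obj X" "PO x = A"
  shows "cocartesian (proj E) (pairing K (idn X x) (idn X x))"
proof -
  let ?D = "pairing L (idn B A) (idn B A)"
  define z where "z = push E ?D x"
  define l where "l = lift E ?D x"
  define l1 l2 where "l1 = lift E (pr1 L A A) z" and "l2 = lift E (pr2 L A A) z"
  note [simp] = A x
  have z: "z \<in> Obj X" "PO z = prd L A A" by (simp_all add: z_def)
  have l [simp]: "cocartesian (proj E) l" "l \<in> Arr X" "Dom X l = x" "Cod X l = z" "PA l = ?D"
    by (simp_all add: l_def z_def)
  have l12 [simp]: "cocartesian (proj E) l1" "l1 \<in> Arr X" "Dom X l1 = z" "PA l1 = pr1 L A A"
    "cocartesian (proj E) l2" "l2 \<in> Arr X" "Dom X l2 = z" "PA l2 = pr2 L A A"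
    using z by (simp_all add: l1_def l2_def)
  \<comment> \<open>Each projection after the diagonal is an identity, so these composites are
    vertical as well as cocartesian. Their inverses \<open>g\<close> and \<open>h\<close> correct
    both components of the unit after \<open>l\<close> to identities, which leaves the diagonal of
    \<open>x\<close>.\<close>
  have i: "iso (fibre E A) (l1 \<cdot>\<^bsub>X\<^esub> l)" "iso (fibre E A) (l2 \<cdot>\<^bsub>X\<^esub> l)"
    by (subst vertical_iso_iff; simp add: fib_Arr_iff cocart_comp')+
  obtain g where g: "iso X g" "Dom X g = Cod X l1" "Cod X g = x" "g \<cdot>\<^bsub>X\<^esub> l1 \<cdot>\<^bsub>X\<^esub> l = idn X x"
    by (rule iso_inverse[OF iso_fibre[OF i(1)]]) simp
  obtain h where h: "iso X h" "Dom X h = Cod X l2" "Cod X h = x" "h \<cdot>\<^bsub>X\<^esub> l2 \<cdot>\<^bsub>X\<^esub> l = idn X x"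
    by (rule iso_inverse[OF iso_fibre[OF i(2)]]) simp
  note g' = cocart_Arr[OF cocart_iso[OF g(1)]] and h' = cocart_Arr[OF cocart_iso[OF h(1)]]
  have gh: "cocartesian (proj E) (prodmap K g h)" by (intro cocart_prod cocart_iso g h)
  have zf: "z \<in> Obj (fibre E (prd L A A))" using z by (simp add: fib_Obj)
  have e: "nc (eta E A A) z = pairing K l1 l2" using zf by (simp add: eta_def Let_def l1_def l2_def)
  have "cocartesian (proj E) (pairing K l1 l2)"
    using niso zf eta_Arr[OF A A zf] vertical_iso_iff
        unfolding eta_niso_iff[OF A A] e[symmetric] by blast
  then have "cocartesian (proj E) (prodmap K g h \<cdot>\<^bsub>X\<^esub> pairing K l1 l2 \<cdot>\<^bsub>X\<^esub> l)"
    using gh g' g(2) h' h(2) by (intro cocart_comp') simp_all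
  moreover have "prodmap K g h \<cdot>\<^bsub>X\<^esub> pairing K l1 l2 \<cdot>\<^bsub>X\<^esub> l = pairing K (idn X x) (idn X x)"
    using g' g(2-4) h' h(2-4) by simp
  ultimately show ?thesis by simp
qed

text \<open>The projection is \<open>x \<times> y \<rightarrow> x \<times> 1\<close>, a product of
  cocartesian arrows, followed by the isomorphism to \<open>x\<close>.\<close>

lemma cocart_pr1:
  assumes "cocartesian (proj E) (term_map K y)" "x \<in> Obj X" "y \<in> Obj X"
  shows "cocartesian (proj E) (pr1 K x y)"
proof -
  have "cocartesian (proj E) (pr1 K x (one K) \<cdot>\<^bsub>X\<^esub> prodmap K (idn X x) (term_map K y))"
    using assms by (intro cocart_comp' cocart_prod cocart_id cocart_iso[OF KK.iso_pr_one(1)]) simp_all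
  then show ?thesis using assms by (simp add: KK.prodmap_eq)
qed

text \<open>With the ternary operation \<open>k a b c = a b\<^sup>-\<^sup>1 c\<close> of the group, the inverse of \<open>u : x \<rightarrow> y\<close>
  is \<open>v b = k b (u a) a\<close>: since \<open>k b b a = a\<close>, the value lies in \<open>x\<close>, and since \<open>k b a a = b\<close> in the
  base, it descends along the cocartesian projection \<open>y \<times> x \<rightarrow> y\<close>.\<close>

lemma vertical_left_inverse:
  assumes G: "group_object L G" and tau: "\<And>x. x \<in> Obj X \<Longrightarrow> cocartesian (proj E) (term_map K x)"
    and niso: "is_niso (eta E (gcar G) (gcar G))" and u: "u \<in> Arr (fibre E (gcar G))"
  shows "\<exists>v \<in> Arr (fibre E (gcar G)). Dom X v = Cod X u \<and> Cod X v = Dom X u \<and> v \<cdot>\<^bsub>X\<^esub> u = idn X (Dom X u)"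
proof -
  define A m i where "A = gcar G" and "m = gmul G" and "i = ginv G"
  interpret G: group_obj L A m "gunit G" i unfolding A_def m_def i_def by (rule LB.group_objI[OF G])
  define x y where "x = Dom X u" and "y = Cod X u"
  have u [simp]: "u \<in> Arr X" "Dom X u = x" "Cod X u = y" "PA u = idn B A" "PO x = A" "PO y = A"
      "x \<in> Obj X" "y \<in> Obj X"
    using u vert_Cod[of u A] by (auto simp: fib_Arr_iff x_def y_def A_def)
  define k where "k = m \<cdot>\<^bsub>B\<^esub> prodmap L (m \<cdot>\<^bsub>B\<^esub> prodmap L (idn B A) i) (idn B A)"
  have [simp]: "k \<in> Arr B" "Dom B k = prd L (prd L A A) A" "Cod B k = A" by (simp_all add: k_def)
  have k: "k \<cdot>\<^bsub>B\<^esub> pairing L (pairing L a a) c = c" "k \<cdot>\<^bsub>B\<^esub> pairing L (pairing L a c) c = a"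
    if "a \<in> Arr B" "c \<in> Arr B" "Dom B a = Dom B c" "Cod B a = A" "Cod B c = A" for a c
    using that by (simp_all add: k_def G.inv_right G.mul_unit G.mul_assoc G.inv_left)
  define t where "t = lift E k (prd K (prd K y y) x)"
  have t [simp]: "t \<in> Arr X" "Dom X t = prd K (prd K y y) x" "cocartesian (proj E) t" "PA t = k"
      by (simp_all add: t_def)
  let ?d = "pairing K (idn X y) (idn X y)"
  \<comment> \<open>On elements \<open>s\<close> sends \<open>(b, a)\<close> to
    \<open>k b b a\<close>. It is cocartesian over the second projection, so
    \<open>pr2 K y x\<close> factors through it by a vertical \<open>g\<close>, which identifies
    \<open>k b b a\<close> with \<open>a\<close>.\<close>
  define s where "s = t \<cdot>\<^bsub>X\<^esub> prodmap K ?d (idn X x)"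
  have s: "cocartesian (proj E) s" unfolding s_def
    by (intro cocart_comp' cocart_prod cocart_diagonal[OF G.m_simps(1)] cocart_id)
      (use niso in \<open>simp_all add: A_def[symmetric]\<close>)
  have s' [simp]: "s \<in> Arr X" "Dom X s = prd K y x" "Cod X s = Cod X t" by (simp_all add: s_def)
  have Ps: "PA (pr2 K y x) = PA s" by (simp add: s_def LB.prodmap_eq k)
  define g where "g = vfactor E s (pr2 K y x)"
  have "PO (Cod X s) = PO x" using vfactor_PO[OF s, of "pr2 K y x"] Ps by simp
  then have g: "g \<in> Arr X" "Dom X g = Cod X t" "Cod X g = x" "PA g = idn B A" "g \<cdot>\<^bsub>X\<^esub> s = pr2 K y x"
      "PO (Cod X t) = A"
    using vfactor_simps[OF s, of "pr2 K y x"] Ps by (simp_all add: g_def del: P_simps(8,9))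
  \<comment> \<open>The candidate inverse before descent: \<open>(b, a)\<close> goes to
    \<open>k b (u a) a\<close>, followed by \<open>g\<close>. As \<open>u\<close> is vertical, its
    base image is \<open>k b a a = b\<close>; \<open>LB.pairing_eta_id\<close> is removed since it
    would collapse the inner pair to an identity and hide this pattern.\<close>
  define r where "r = g \<cdot>\<^bsub>X\<^esub> t \<cdot>\<^bsub>X\<^esub> pairing K (pairing K (pr1 K y x) (u \<cdot>\<^bsub>X\<^esub> pr2 K y x)) (pr2 K y x)"
  have r: "r \<in> Arr X" "Dom X r = prd K y x" "Cod X r = x" "PA r = PA (pr1 K y x)"
    using g(1-4) by (simp_all add: r_def k g(6) del: LB.pairing_eta_id)
  have c: "cocartesian (proj E) (pr1 K y x)" by (rule cocart_pr1[OF tau]) simp_all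
  define v where "v = vfactor E (pr1 K y x) r"
  have v: "v \<in> Arr X" "Dom X v = y" "Cod X v = x" "PA v = idn B A" "v \<cdot>\<^bsub>X\<^esub> pr1 K y x = r"
    using vfactor_simps[OF c, of r] r by (simp_all add: v_def)
  \<comment> \<open>Evaluated at \<open>b = u a\<close> with \<open>a\<close> the generic element:
    \<open>r\<close> becomes \<open>g\<close> applied to \<open>k (u a) (u a) a\<close>, that is
    \<open>g \<cdot> s\<close> at \<open>(u a, a)\<close>, which is \<open>a\<close>.\<close>
  have "v \<cdot>\<^bsub>X\<^esub> u = v \<cdot>\<^bsub>X\<^esub> pr1 K y x \<cdot>\<^bsub>X\<^esub> pairing K u (idn X x)" by simp
  also have "\<dots> = r \<cdot>\<^bsub>X\<^esub> pairing K u (idn X x)"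
    unfolding v(5)[symmetric] using v(1-4) by simp
  also have "\<dots> = g \<cdot>\<^bsub>X\<^esub> s \<cdot>\<^bsub>X\<^esub> pairing K u (idn X x)" using g(1-3) by (simp add: r_def s_def)
  also have "\<dots> = (g \<cdot>\<^bsub>X\<^esub> s) \<cdot>\<^bsub>X\<^esub> pairing K u (idn X x)" using g(1-3) by simp
  also have "\<dots> = idn X x" unfolding g(5) by simp
  finally show ?thesis using v(1-4) by (intro bexI[of _ v]) (simp_all add: fib_Arr_iff A_def[symmetric])
qed

text \<open>The left inverse \<open>v\<close> of \<open>u\<close> has a left inverse
  \<open>w\<close> in turn, and then \<open>w = w v u = u\<close>, so \<open>v\<close> is
  two-sided.\<close>

lemma groupoid_fibre:
  assumes G: "group_object L G" and tau: "\<And>x. x \<in> Obj X \<Longrightarrow> cocartesian (proj E) (term_map K x)"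
    and niso: "is_niso (eta E (gcar G) (gcar G))"
  shows "groupoid (fibre E (gcar G))"
  unfolding groupoid_def
proof (intro conjI ballI cat_fibre)
  fix u assume u: "u \<in> Arr (fibre E (gcar G))"
  obtain v where v: "v \<in> Arr (fibre E (gcar G))" "Dom X v = Cod X u" "Cod X v = Dom X u"
      "v \<cdot>\<^bsub>X\<^esub> u = idn X (Dom X u)"
    using vertical_left_inverse[OF G tau niso u] by blast
  obtain w where w: "w \<in> Arr (fibre E (gcar G))" "Dom X w = Cod X v" "Cod X w = Dom X v"
      "w \<cdot>\<^bsub>X\<^esub> v = idn X (Dom X v)"
    using vertical_left_inverse[OF G tau niso v(1)] by blast
  have a: "u \<in> Arr X" "v \<in> Arr X" "w \<in> Arr X" using u v w by (auto simp: fib_Arr_iff)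
  have "w = w \<cdot>\<^bsub>X\<^esub> v \<cdot>\<^bsub>X\<^esub> u" using a v(2-4) w(2,3) by simp
  also have "\<dots> = (w \<cdot>\<^bsub>X\<^esub> v) \<cdot>\<^bsub>X\<^esub> u" using a v(2,3) w(2,3) by simp
  also have "\<dots> = u" unfolding w(4) using a v(2) by simp
  finally show "iso (fibre E (gcar G)) u" using u v w unfolding iso_iff_inverse fib_simps by auto
qed

lemma two_group_moncat:
  assumes G: "group_object L G" and tau: "\<And>x. x \<in> Obj X \<Longrightarrow> cocartesian (proj E) (term_map K x)"
    and niso: "is_niso (eta E (gcar G) (gcar G))"
  shows "two_group (group_moncat E G)"
proof -
  define A m e i where "A = gcar G" and "m = gmul G" and "e = gunit G" and "i = ginv G"
  interpret BG: group_obj L A m e i unfolding A_def m_def i_def e_def by (rule LB.group_objI[OF G])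
  interpret cmo_monoid E A m e unfolding A_def m_def e_def by (rule cmo_monoidI[OF G])
  have V: "group_moncat E G = V" by (simp add: A_def m_def e_def)
  have "\<exists>y \<in> Obj (fibre E A). isomorphic (fibre E A) (tenO V x y) (munit V) \<and>
      isomorphic (fibre E A) (tenO V y x) (munit V)"
    if "x \<in> Obj (fibre E A)" for x
  proof -
    have [simp]: "x \<in> Obj X" "PO x = A" using that by (simp_all add: fib_Obj)
    let ?y = "push E i x" and ?d = "pairing K (idn X x) (idn X x)"
    let ?c = "lift E e (one K) \<cdot>\<^bsub>X\<^esub> term_map K x"
    have d: "cocartesian (proj E) ?d"
        by (rule cocart_diagonal[OF BG.m_simps(1)]) (use niso in \<open>simp_all add: A_def[symmetric]\<close>)
    have c: "cocartesian (proj E) ?c" "PA ?c = e \<cdot>\<^bsub>B\<^esub> term_map L A" by (intro cocart_comp' tau) simp_all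
    \<comment> \<open>Stated for an arbitrary cocartesian \<open>f : x \<rightarrow> z\<close> so as
      to cover both orders of \<open>x\<close> and its weak inverse.\<close>
    have isom: "isomorphic (fibre E A) (push E m z) (munit V)"
      if f: "cocartesian (proj E) f" "Dom X f = x" "Cod X f = z" "m \<cdot>\<^bsub>B\<^esub> PA f = e \<cdot>\<^bsub>B\<^esub> term_map L A"
          "PO z = prd L A A" for f z
    proof -
      have [simp]: "f \<in> Arr X" "z \<in> Obj X" using cocart_Arr[OF f(1)] f(3) by auto
      have q: "cocartesian (proj E) (lift E m z \<cdot>\<^bsub>X\<^esub> f)" by (rule cocart_comp') (use f in simp_all)
      have p: "PA ?c = PA (lift E m z \<cdot>\<^bsub>X\<^esub> f)" using f c by simp
      show ?thesis unfolding isomorphic_def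
      proof (rule bexI[of _ "vfactor E (lift E m z \<cdot>\<^bsub>X\<^esub> f) ?c"])
        show "iso (fibre E A) (vfactor E (lift E m z \<cdot>\<^bsub>X\<^esub> f) ?c)"
          by (rule vfactor_iso'[OF q c(1) _ p]) (use f in simp_all)
        show "vfactor E (lift E m z \<cdot>\<^bsub>X\<^esub> f) ?c \<in> hom (fibre E A) (push E m z) (munit V)"
          using vfactor_simps[OF q _ _ p] f by (simp add: fib_Arr_iff)
      qed
    qed
    have "isomorphic (fibre E A) (push E m (prd K x ?y)) (munit V)"
    proof (rule isom)
      show "cocartesian (proj E) (prodmap K (idn X x) (lift E i x) \<cdot>\<^bsub>X\<^esub> ?d)"
        by (intro cocart_comp' cocart_prod cocart_id d) simp_all
      show "m \<cdot>\<^bsub>B\<^esub> PA (prodmap K (idn X x) (lift E i x) \<cdot>\<^bsub>X\<^esub> ?d) = e \<cdot>\<^bsub>B\<^esub> term_map L A"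
        using BG.inv_law by simp
    qed simp_all
    moreover have "isomorphic (fibre E A) (push E m (prd K ?y x)) (munit V)"
    proof (rule isom)
      show "cocartesian (proj E) (prodmap K (lift E i x) (idn X x) \<cdot>\<^bsub>X\<^esub> ?d)"
        by (intro cocart_comp' cocart_prod cocart_id d) simp_all
      show "m \<cdot>\<^bsub>B\<^esub> PA (prodmap K (lift E i x) (idn X x) \<cdot>\<^bsub>X\<^esub> ?d) = e \<cdot>\<^bsub>B\<^esub> term_map L A"
        using BG.inv_left[of "idn B A"] by simp
    qed simp_all
    ultimately show ?thesis by (intro bexI[of _ ?y]) (simp_all add: fib_Obj)
  qed
  moreover have "groupoid (fibre E A)" using groupoid_fibre[OF G tau niso] by (simp add: A_def)
  ultimately show ?thesis unfolding V two_group_def V_simps(1) using monoidal_category_V by blast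
qed

section \<open>From 2-groups back to the units, and the equivalence\<close>

lemma groupal_groupoid:
  assumes "groupal E" "group_object L G"
  shows "groupoid (fibre E (gcar G))"
proof -
  have "\<forall>A \<in> Obj (group_cat L). psO (group_pseudofunctor E) A \<in> obj2 TWOGP"
    using assms(1) by (simp add: groupal_def pseudofunctor_def)
  then have "two_group (group_moncat E G)"
    using assms(2) by (simp add: LB.group_cat_simps(1) TWOGP_def group_pseudofunctor_def Let_def)
  then show ?thesis by (simp add: two_group_def monoid_moncat_def Let_def)
qed

lemma groupal_iff:
  "is_niso (eta1 E) \<and> (\<forall>G. group_object L G \<longrightarrow> is_niso (eta E (gcar G) (gcar G))) \<longleftrightarrow> groupal E"
proof
  assume h: "is_niso (eta1 E) \<and> (\<forall>G. group_object L G \<longrightarrow> is_niso (eta E (gcar G) (gcar G)))"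
  show "groupal E"
    by (rule groupal_if_two_groups, rule two_group_moncat) (use h in \<open>auto simp: eta1_niso_iff_total\<close>)
next
  assume g: "groupal E"
  have i: "iso (fibre E (gcar G)) u" if "group_object L G" "u \<in> Arr (fibre E (gcar G))" for G u
    using groupal_groupoid[OF g that(1)] that(2) by (simp add: groupoid_def)
  have "is_niso (eta1 E)"
    unfolding eta1_niso_iff_fibre
        using i[OF LB.trivial_group] vertical_iso_iff[OF term_map_fibre] term_map_fibre by auto
  moreover have "is_niso (eta E (gcar G) (gcar G))" if G: "group_object L G" for G
  proof -
    interpret BG: group_obj L "gcar G" "gmul G" "gunit G" "ginv G" by (rule LB.group_objI[OF G])
    obtain n u j where "group_object L \<lparr>gcar = prd L (gcar G) (gcar G), gmul = n, gunit = u, ginv = j\<rparr>"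
      using BG.square_group by blast
    from i[OF this] show ?thesis
      using eta_niso_iff[OF BG.m_simps(1) BG.m_simps(1)] eta_Arr[OF BG.m_simps(1) BG.m_simps(1)] by simp
  qed
  ultimately show "is_niso (eta1 E) \<and>
      (\<forall>G. group_object L G \<longrightarrow> is_niso (eta E (gcar G) (gcar G)))" by blast
qed

end

theorem theorem5p4:
  fixes E :: "('x, 'u, 'b, 'f) opfib"
  assumes "cartesian_monoidal_opfibration E"
  shows
    "(is_niso (eta1 E) \<longleftrightarrow>
        (\<forall>X \<in> Obj (fibre E (one (base E))). cocartesian (proj E) (term_map (tot E) X))) \<and>
     (is_niso (eta1 E) \<longleftrightarrow>
        (\<forall>X \<in> Obj (ccat (tot E)). cocartesian (proj E) (term_map (tot E) X))) \<and>
     ((is_niso (eta1 E) \<and>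
         (\<forall>G. group_object (base E) G \<longrightarrow> is_niso (eta E (gcar G) (gcar G)))) \<longleftrightarrow>
      groupal E)"
proof -
  interpret cmo E by unfold_locales (rule assms)
  show ?thesis using eta1_niso_iff_fibre eta1_niso_iff_total groupal_iff by blast
qed

end
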